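(* Let $T$ be the knot $8_{18}$, with knot group $\pi(T)$ presented as in the context. Denote a general element $\chi$ of the irreducible ${\rm SL}(2,\mathbb{C})$-character variety $\mathcal{X}^{\rm irr}(T)$ by $$(t_{12},t_{23},t_{34},t_{14};\ t_{13},t_{24};\ t_{123},t_{124},t_{134},t_{234}),$$ where $t_{i_1\cdots i_r}=\chi(x_{i_1}\cdots x_{i_r})$, with the understanding that $t=t_1=\chi(x_1)$ is also part of the data (so that elements are points of $\mathbb{C}^{11}$, and $t$ varies in each set below). Put $\alpha=t^2-1$, and $$\tau=\Big(\alpha^2-3\alpha+\frac{4}{\alpha}\Big)\mu-\alpha^3+4\alpha^2-7,$$ $$\sigma_+=\Big(\frac1\alpha+1\Big)\mu-2+\frac{\mu}{\alpha}x,\qquad \sigma_-=\frac{\mu^2}{\alpha}+\Big(\frac1\alpha+1\Big)\mu-2-\frac{\mu}{\alpha}x .$$ Then $\mathcal{X}^{\rm irr}(T)$ decomposes as the disjoint union $$\mathcal{X}^{\rm irr}(T)=\mathcal{X}_{1,1}\sqcup\mathcal{X}_{1,2}\sqcup\mathcal{X}_{2,1}\sqcup\mathcal{X}_{2,2}\sqcup\mathcal{X}_3\sqcup\mathcal{X}_4\sqcup\mathcal{X}_{5,1}\sqcup\mathcal{X}_{5,2}\sqcup\mathcal{X}_{6,1}\sqcup\mathcal{X}_{6,2},$$ where (the parameters $t,x,\mu,z,\gamma,u,\eta$ being complex numbers subject to the listed conditions): $\mathcal{X}_{1,1}$ is the set of $(x+1,\mu+1-x,\mu+1-x,x+1;\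 1,\tau;\ t\mu/\alpha,\,t\sigma_+,\,t\mu/\alpha,\,t\sigma_-)$ with $x^2-\mu x+2\mu/\alpha+\alpha-4=0$, $\mu^2+(\alpha^2-4\alpha)\mu+4\alpha^2-\alpha^3=0$, $\alpha\neq 0,2,4$, and $(\alpha,\mu)\neq(2+2\sqrt2,2\sqrt2),\,(2-2\sqrt2,-2\sqrt2)$. $\mathcal{X}_{1,2}$ is the set of $(x+1,x+1,\mu+1-x,\mu+1-x;\ \tau,1;\ t\sigma_+,\,t\mu/\alpha,\,t\sigma_-,\,t\mu/\alpha)$ with $x^2-\mu x+2\mu/\alpha+\alpha-4=0$, $\mu^2+(\alpha^2-4\alpha)\mu+4\alpha^2-\alpha^3=0$, $\alpha\neq 0,2,4$, and $(\alpha,\mu)\neq(2+2\sqrt2,2\sqrt2),\,(2-2\sqrt2,-2\sqrt2)$. $\mathcal{X}_{2,1}$ is the set of $\big(\gamma+\alpha-1,\,z+1,\,z^2/\gamma+\alpha-1,\,z+1;\ 1,1;\ t+tz\gamma/\alpha,\ t+tz\gamma/\alpha,\ t+tz^3/(\alpha\gamma),\ t+tz^3/(\alpha\gamma)\big)$ with $z^2-\alpha z+\alpha=0$, $\gamma^2+((\alpha-2)z^2-2z)\gamma+z^2=0$, $\alpha\neq 0,2,4$, and $(\alpha,z)\neq(2+2\sqrt2,\sqrt2),\,(2-2\sqrt2,-\sqrt2)$. $\mathcal{X}_{2,2}$ is the set of $\big(z+1,\,\gamma+\alpha-1,\,z+1,\,z^2/\gamma+\alpha-1;\ 1,1;\ t+tz^3/(\alpha\gamma),\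 t+tz^3/(\alpha\gamma),\ t+tz\gamma/\alpha,\ t+tz\gamma/\alpha\big)$ with $z^2-\alpha z+\alpha=0$, $\gamma^2+((\alpha-2)z^2-2z)\gamma+z^2=0$, $\alpha\neq 0,2,4$, and $(\alpha,z)\neq(2+2\sqrt2,\sqrt2),\,(2-2\sqrt2,-\sqrt2)$. $\mathcal{X}_3$ is the set of $(u,u,u,u;\ t^2-2,t^2-2;\ tu-t,tu-t,tu-t,tu-t)$ with $u^2-(t^2+1)u+2t^2-1=0$ and $t^2\neq5$. $\mathcal{X}_4$ is the set of $(u,u,u,u;\ 2u+2-t^2,2u+2-t^2;\ \eta,\eta,\eta,\eta)$ with $t\eta=u^2+u-t^2+1$, $u\neq1$, and $\eta^2+t(t^2+4-2u)\eta-5t^2u+t^4+4t^2-6=0$. $\mathcal{X}_{5,1}$ is the set of $(1,t^2-2,1,t^2-2;\ 1,1;\ 0,0,0,0)$ with $t^2\neq3$. $\mathcal{X}_{5,2}$ is the set of $(t^2-2,1,t^2-2,1;\ 1,1;\ 0,0,0,0)$ with $t^2\neq3$. $\mathcal{X}_{6,1}$ is the set of $(1,1,1,1;\ 1,4t^2-2-t^4;\ 0,3t-t^3,0,3t-t^3)$ with $t^2\neq3$. $\mathcal{X}_{6,2}$ is the set of $(1,1,1,1;\ 4t^2-2-t^4,1;\ 3t-t^3,0,3t-t^3,0)$ with $t^2\neq3$.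
   Context: $T$ denotes the knot $8_{18}$ (Rolfsen's table; the Turk's head knot $Th(3,4)$), and $\pi(T)$ is the fundamental group of its exterior in $S^3$. It has the Wirtinger presentation $$\pi(T)=\langle x_1,x_2,x_3,x_4\mid x_1x_2x_1^{-1}x_4x_1=x_2x_3x_2^{-1}x_1x_2=x_3x_4x_3^{-1}x_2x_3=x_4x_1x_4^{-1}x_3x_4\rangle,$$ in which $x_1,\dots,x_4$ all belong to the same conjugacy class of $\pi(T)$; in particular every character takes the same value $t$ on all $x_i$. Let $G={\rm SL}(2,\mathbb{C})$. The character of a homomorphism $\rho:\pi(T)\to G$ is the function $\chi_\rho:\pi(T)\to\mathbb{C}$, $\chi_\rho(g)={\rm tr}(\rho(g))$. The representation $\rho$ is called reducible if the elements of its image have a common eigenvector, and irreducible otherwise. $\mathcal{X}^{\rm irr}(T)=\{\chi_\rho:\rho\in\hom(\pi(T),G)\text{ irreducible}\}$. Each such character is determined by the eleven values $t,t_{12},t_{23},t_{34},t_{14},t_{13},t_{24},t_{123},t_{124},t_{134},t_{234}$, so $\mathcal{X}^{\rm irr}(T)$ embeds in $\mathbb{C}^{11}$.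
   Formalization: σ₊ and σ₋ are each taken smaller than printed by μ²/α, and the triple traces of X_{2,2} are (t+tzγ/α, t+tz³/(αγ), t+tz³/(αγ), t+tzγ/α), because the printed values violate trace identities forced by the relations. *)

theory Defs
  imports "HOL-Analysis.Analysis" "HOL-Algebra.Group"
begin

section \<open>Groups given by generators and relations\<close>

text \<open>A letter \<open>(x, True)\<close> stands for the generator \<open>x\<close> and \<open>(x, False)\<close> for its inverse.
  Every element of the type \<open>'g\<close> is a generator; a relation \<open>l = r\<close> is the pair \<open>(l, r)\<close>.\<close>

type_synonym 'g word = "('g \<times> bool) list"

inductive pres_eq :: "('g word \<times> 'g word) set \<Rightarrow> 'g word \<Rightarrow> 'g word \<Rightarrow> bool"
  for R :: "('g word \<times> 'g word) set" where
  refl: "pres_eq R w w"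
| sym: "pres_eq R v w \<Longrightarrow> pres_eq R w v"
| trans: "pres_eq R u v \<Longrightarrow> pres_eq R v w \<Longrightarrow> pres_eq R u w"
| cancel: "pres_eq R (u @ [(x, b), (x, \<not> b)] @ v) (u @ v)"
| relation: "(l, r) \<in> R \<Longrightarrow> pres_eq R (u @ l @ v) (u @ r @ v)"

definition pres_class :: "('g word \<times> 'g word) set \<Rightarrow> 'g word \<Rightarrow> 'g word set" where
  "pres_class R w = {v. pres_eq R w v}"

definition presented_group :: "('g word \<times> 'g word) set \<Rightarrow> 'g word set monoid" where
  "presented_group R =
    \<lparr> carrier = range (pres_class R),
      mult = (\<lambda>A B. {w. \<exists>u\<in>A. \<exists>v\<in>B. pres_eq R (u @ v) w}),
      one = pres_class R [] \<rparr>"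

lemma pres_eq_context: "pres_eq R v w \<Longrightarrow> pres_eq R (a @ v @ b) (a @ w @ b)"
proof (induction rule: pres_eq.induct)
  case (cancel u x c v)
  show ?case using pres_eq.cancel[of R "a @ u" x c "v @ b"] by simp
next
  case (relation l r u v)
  show ?case using pres_eq.relation[OF relation, of "a @ u" "v @ b"] by simp
qed (auto intro: pres_eq.intros)

lemma pres_eq_append: "pres_eq R u u' \<Longrightarrow> pres_eq R v v' \<Longrightarrow> pres_eq R (u @ v) (u' @ v')"
  using pres_eq_context[of R u u' "[]" v] pres_eq_context[of R v v' u' "[]"]
  by (auto intro: pres_eq.trans)

lemma pres_class_eq_iff: "pres_class R v = pres_class R w \<longleftrightarrow> pres_eq R v w"
  unfolding pres_class_def by (auto intro: pres_eq.intros)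

lemma presented_group_mult:
  "pres_class R u \<otimes>\<^bsub>presented_group R\<^esub> pres_class R v = pres_class R (u @ v)"
proof -
  have "pres_eq R (u @ v) w" if "pres_eq R u u'" "pres_eq R v v'" "pres_eq R (u' @ v') w" for u' v' w
    using pres_eq_append[OF that(1,2)] that(3) by (rule pres_eq.trans)
  thus ?thesis
    unfolding presented_group_def pres_class_def by (auto intro: pres_eq.refl)
qed

lemma pres_eq_inverse: "pres_eq R (rev (map (\<lambda>(x, b). (x, \<not> b)) w) @ w) []"
proof (induction w)
  case Nil
  show ?case by (simp add: pres_eq.refl)
next
  case (Cons l w)
  obtain x b where l: "l = (x, b)" by (cases l)
  let ?w' = "rev (map (\<lambda>(x, b). (x, \<not> b)) w)"
  have "pres_eq R (?w' @ [(x, \<not> b), (x, \<not> \<not> b)] @ w) (?w' @ w)" by (rule pres_eq.cancel)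
  with Cons show ?case by (auto simp: l intro: pres_eq.trans)
qed

lemma group_presented_group: "group (presented_group R)"
proof (rule groupI)
  fix A assume "A \<in> carrier (presented_group R)"
  then obtain w where A: "A = pres_class R w" by (auto simp: presented_group_def)
  let ?B = "pres_class R (rev (map (\<lambda>(x, b). (x, \<not> b)) w))"
  have "?B \<otimes>\<^bsub>presented_group R\<^esub> A = \<one>\<^bsub>presented_group R\<^esub>"
    unfolding A presented_group_mult
    using pres_eq_inverse[of R w] by (simp add: presented_group_def pres_class_eq_iff)
  moreover have "?B \<in> carrier (presented_group R)" by (simp add: presented_group_def)
  ultimately show "\<exists>B\<in>carrier (presented_group R).
      B \<otimes>\<^bsub>presented_group R\<^esub> A = \<one>\<^bsub>presented_group R\<^esub>" by blast
next
  fix A B C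
  assume "A \<in> carrier (presented_group R)" "B \<in> carrier (presented_group R)"
    "C \<in> carrier (presented_group R)"
  then obtain u v w where "A = pres_class R u" "B = pres_class R v" "C = pres_class R w"
    by (auto simp: presented_group_def)
  thus "A \<otimes>\<^bsub>presented_group R\<^esub> B \<otimes>\<^bsub>presented_group R\<^esub> C =
        A \<otimes>\<^bsub>presented_group R\<^esub> (B \<otimes>\<^bsub>presented_group R\<^esub> C)"
    by (simp add: presented_group_mult)
next
  fix A B
  assume "A \<in> carrier (presented_group R)" "B \<in> carrier (presented_group R)"
  then obtain u v where "A = pres_class R u" "B = pres_class R v"
    by (auto simp: presented_group_def)
  thus "A \<otimes>\<^bsub>presented_group R\<^esub> B \<in> carrier (presented_group R)"
    using presented_group_mult[of R u v] by (simp add: presented_group_def)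
next
  show "\<one>\<^bsub>presented_group R\<^esub> \<in> carrier (presented_group R)"
    by (simp add: presented_group_def)
next
  fix A assume "A \<in> carrier (presented_group R)"
  then obtain w where "A = pres_class R w" by (auto simp: presented_group_def)
  thus "\<one>\<^bsub>presented_group R\<^esub> \<otimes>\<^bsub>presented_group R\<^esub> A = A"
    using presented_group_mult[of R "[]" w] by (simp add: presented_group_def)
qed


section \<open>The group of the knot \<open>8\<^sub>1\<^sub>8\<close>\<close>

datatype gen = x1 | x2 | x3 | x4

abbreviation (input) pos :: "gen \<Rightarrow> gen \<times> bool" where "pos x \<equiv> (x, True)"
abbreviation (input) neg :: "gen \<Rightarrow> gen \<times> bool" where "neg x \<equiv> (x, False)"

definition T_rels :: "(gen word \<times> gen word) set" where
  "T_rels =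
    (let w1 = [pos x1, pos x2, neg x1, pos x4, pos x1];
         w2 = [pos x2, pos x3, neg x2, pos x1, pos x2];
         w3 = [pos x3, pos x4, neg x3, pos x2, pos x3];
         w4 = [pos x4, pos x1, neg x4, pos x3, pos x4]
     in {(w1, w2), (w2, w3), (w3, w4)})"

definition knot_group_T :: "gen word set monoid" where
  "knot_group_T = presented_group T_rels"


section \<open>The irreducible \<open>SL(2,\<complex>)\<close>-character variety\<close>

definition SL2C :: "(complex^2^2) monoid" where
  "SL2C = \<lparr> carrier = {A. det A = 1}, mult = (**), one = mat 1 \<rparr>"

lemma group_SL2C: "group SL2C"
proof (rule groupI)
  fix A assume "A \<in> carrier SL2C"
  hence d: "det A = 1" by (simp add: SL2C_def)
  then obtain B where B: "A ** B = mat 1" "B ** A = mat 1"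
    using invertible_det_nz[of A] unfolding invertible_def by auto
  have "det B = 1" using det_mul[of B A] B(2) d by (simp add: det_I)
  with B show "\<exists>B\<in>carrier SL2C. B \<otimes>\<^bsub>SL2C\<^esub> A = \<one>\<^bsub>SL2C\<^esub>"
    by (auto simp: SL2C_def)
qed (auto simp: SL2C_def det_mul det_I matrix_mul_assoc)

definition reducible_rep :: "('a, 'b) monoid_scheme \<Rightarrow> ('a \<Rightarrow> complex^2^2) \<Rightarrow> bool" where
  "reducible_rep G \<rho> \<longleftrightarrow>
    (\<exists>v. v \<noteq> 0 \<and> (\<forall>g\<in>carrier G. \<exists>c. \<rho> g *v v = c *s v))"

text \<open>A character is made undefined outside the carrier, so that equality of characters is
  equality as functions on the group.\<close>

definition character :: "('a, 'b) monoid_scheme \<Rightarrow> ('a \<Rightarrow> complex^2^2) \<Rightarrow> 'a \<Rightarrow> complex" where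
  "character G \<rho> = (\<lambda>g\<in>carrier G. trace (\<rho> g))"

definition irr_characters :: "('a, 'b) monoid_scheme \<Rightarrow> ('a \<Rightarrow> complex) set" where
  "irr_characters G = {character G \<rho> | \<rho>. \<rho> \<in> hom G SL2C \<and> \<not> reducible_rep G \<rho>}"

definition X_irr_T :: "(gen word set \<Rightarrow> complex) set" where
  "X_irr_T = irr_characters knot_group_T"


section \<open>Coordinates\<close>

text \<open>\<open>t_val \<phi> [x\<^sub>i\<^sub>1, \<dots>, x\<^sub>i\<^sub>r]\<close> is \<open>\<phi>(x\<^sub>i\<^sub>1 \<cdots> x\<^sub>i\<^sub>r)\<close>.\<close>

definition t_val :: "(gen word set \<Rightarrow> complex) \<Rightarrow> gen list \<Rightarrow> complex" where
  "t_val \<phi> xs = \<phi> (pres_class T_rels (map pos xs))"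

text \<open>A point of \<open>\<complex>\<^sup>1\<^sup>1\<close>, grouped as
  \<open>(t, (t\<^sub>1\<^sub>2, t\<^sub>2\<^sub>3, t\<^sub>3\<^sub>4, t\<^sub>1\<^sub>4), (t\<^sub>1\<^sub>3, t\<^sub>2\<^sub>4), (t\<^sub>1\<^sub>2\<^sub>3, t\<^sub>1\<^sub>2\<^sub>4, t\<^sub>1\<^sub>3\<^sub>4, t\<^sub>2\<^sub>3\<^sub>4))\<close>.\<close>

type_synonym point =
  "complex \<times> (complex \<times> complex \<times> complex \<times> complex) \<times> (complex \<times> complex) \<times>
   (complex \<times> complex \<times> complex \<times> complex)"

definition coords :: "(gen word set \<Rightarrow> complex) \<Rightarrow> point" where
  "coords \<phi> =
    (t_val \<phi> [x1],
     (t_val \<phi> [x1, x2], t_val \<phi> [x2, x3], t_val \<phi> [x3, x4], t_val \<phi> [x1, x4]),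
     (t_val \<phi> [x1, x3], t_val \<phi> [x2, x4]),
     (t_val \<phi> [x1, x2, x3], t_val \<phi> [x1, x2, x4], t_val \<phi> [x1, x3, x4], t_val \<phi> [x2, x3, x4]))"


section \<open>The components\<close>

definition \<tau> :: "complex \<Rightarrow> complex \<Rightarrow> complex" where
  "\<tau> \<alpha> \<mu> = (\<alpha>^2 - 3*\<alpha> + 4/\<alpha>) * \<mu> - \<alpha>^3 + 4*\<alpha>^2 - 7"

text \<open>The published formulas for \<open>\<sigma>\<^sub>+\<close> and \<open>\<sigma>\<^sub>-\<close> are both larger by \<open>\<mu>\<^sup>2/\<alpha>\<close>, a misprint.
  Expanding the trace of \<open>x\<^sub>i x\<^sub>j x\<^sub>i\<inverse> x\<^sub>k x\<^sub>i\<close> for each of the four equal words of the presentation shows that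
  \<open>\<alpha> t\<^sub>1\<^sub>2\<^sub>4 - t (t\<^sub>2\<^sub>4 + (t\<^sub>1\<^sub>2 - 1)(t\<^sub>1\<^sub>4 - 1))\<close>,
  \<open>\<alpha> t\<^sub>1\<^sub>2\<^sub>3 - t (t\<^sub>1\<^sub>3 + (t\<^sub>1\<^sub>2 - 1)(t\<^sub>2\<^sub>3 - 1))\<close>,
  \<open>\<alpha> t\<^sub>2\<^sub>3\<^sub>4 - t (t\<^sub>2\<^sub>4 + (t\<^sub>2\<^sub>3 - 1)(t\<^sub>3\<^sub>4 - 1))\<close> and
  \<open>\<alpha> t\<^sub>1\<^sub>3\<^sub>4 - t (t\<^sub>1\<^sub>3 + (t\<^sub>1\<^sub>4 - 1)(t\<^sub>3\<^sub>4 - 1))\<close> coincide for every character. Together with the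
  other published coordinates this forces the values below.\<close>

definition \<sigma>_plus :: "complex \<Rightarrow> complex \<Rightarrow> complex \<Rightarrow> complex" where
  "\<sigma>_plus \<alpha> \<mu> x = (1/\<alpha> + 1) * \<mu> - 2 + \<mu>/\<alpha> * x - \<mu>^2/\<alpha>"

definition \<sigma>_minus :: "complex \<Rightarrow> complex \<Rightarrow> complex \<Rightarrow> complex" where
  "\<sigma>_minus \<alpha> \<mu> x = (1/\<alpha> + 1) * \<mu> - 2 - \<mu>/\<alpha> * x"

definition cond_1 :: "complex \<Rightarrow> complex \<Rightarrow> complex \<Rightarrow> bool" where
  "cond_1 \<alpha> \<mu> x \<longleftrightarrow>
     x^2 - \<mu>*x + 2*\<mu>/\<alpha> + \<alpha> - 4 = 0 \<and>
     \<mu>^2 + (\<alpha>^2 - 4*\<alpha>)*\<mu> + 4*\<alpha>^2 - \<alpha>^3 = 0 \<and>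
     \<alpha> \<noteq> 0 \<and> \<alpha> \<noteq> 2 \<and> \<alpha> \<noteq> 4 \<and>
     (\<alpha>, \<mu>) \<noteq> (2 + 2 * complex_of_real (sqrt 2), 2 * complex_of_real (sqrt 2)) \<and>
     (\<alpha>, \<mu>) \<noteq> (2 - 2 * complex_of_real (sqrt 2), - 2 * complex_of_real (sqrt 2))"

definition X_1_1 :: "point set" where
  "X_1_1 = {(t, (x + 1, \<mu> + 1 - x, \<mu> + 1 - x, x + 1), (1, \<tau> \<alpha> \<mu>),
             (t*\<mu>/\<alpha>, t * \<sigma>_plus \<alpha> \<mu> x, t*\<mu>/\<alpha>, t * \<sigma>_minus \<alpha> \<mu> x))
            | t \<alpha> \<mu> x. \<alpha> = t^2 - 1 \<and> cond_1 \<alpha> \<mu> x}"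

definition X_1_2 :: "point set" where
  "X_1_2 = {(t, (x + 1, x + 1, \<mu> + 1 - x, \<mu> + 1 - x), (\<tau> \<alpha> \<mu>, 1),
             (t * \<sigma>_plus \<alpha> \<mu> x, t*\<mu>/\<alpha>, t * \<sigma>_minus \<alpha> \<mu> x, t*\<mu>/\<alpha>))
            | t \<alpha> \<mu> x. \<alpha> = t^2 - 1 \<and> cond_1 \<alpha> \<mu> x}"

definition cond_2 :: "complex \<Rightarrow> complex \<Rightarrow> complex \<Rightarrow> bool" where
  "cond_2 \<alpha> z \<gamma> \<longleftrightarrow>
     z^2 - \<alpha>*z + \<alpha> = 0 \<and>
     \<gamma>^2 + ((\<alpha> - 2)*z^2 - 2*z)*\<gamma> + z^2 = 0 \<and>
     \<alpha> \<noteq> 0 \<and> \<alpha> \<noteq> 2 \<and> \<alpha> \<noteq> 4 \<and>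
     (\<alpha>, z) \<noteq> (2 + 2 * complex_of_real (sqrt 2), complex_of_real (sqrt 2)) \<and>
     (\<alpha>, z) \<noteq> (2 - 2 * complex_of_real (sqrt 2), - complex_of_real (sqrt 2))"

definition X_2_1 :: "point set" where
  "X_2_1 = {(t, (\<gamma> + \<alpha> - 1, z + 1, z^2/\<gamma> + \<alpha> - 1, z + 1), (1, 1),
             (t + t*z*\<gamma>/\<alpha>, t + t*z*\<gamma>/\<alpha>, t + t*z^3/(\<alpha>*\<gamma>), t + t*z^3/(\<alpha>*\<gamma>)))
            | t \<alpha> z \<gamma>. \<alpha> = t^2 - 1 \<and> cond_2 \<alpha> z \<gamma>}"

text \<open>The published list of triple traces here reads
  \<open>t + t z\<^sup>3/(\<alpha>\<gamma>), t + t z\<^sup>3/(\<alpha>\<gamma>), t + t z \<gamma>/\<alpha>, t + t z \<gamma>/\<alpha>\<close>, a misprint: by the identities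
  stated before \<open>\<sigma>_plus\<close>, \<open>t\<^sub>1\<^sub>2 = t\<^sub>3\<^sub>4\<close> and \<open>t\<^sub>1\<^sub>3 = t\<^sub>2\<^sub>4 = 1\<close> force \<open>t\<^sub>1\<^sub>2\<^sub>3 = t\<^sub>2\<^sub>3\<^sub>4\<close> and \<open>t\<^sub>1\<^sub>2\<^sub>4 = t\<^sub>1\<^sub>3\<^sub>4\<close>.
  The set below is the image of \<open>X_2_1\<close> under the automorphism
  \<open>x\<^sub>1 \<mapsto> x\<^sub>2 \<mapsto> x\<^sub>3 \<mapsto> x\<^sub>4 \<mapsto> x\<^sub>1\<close>.\<close>

definition X_2_2 :: "point set" where
  "X_2_2 = {(t, (z + 1, \<gamma> + \<alpha> - 1, z + 1, z^2/\<gamma> + \<alpha> - 1), (1, 1),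
             (t + t*z*\<gamma>/\<alpha>, t + t*z^3/(\<alpha>*\<gamma>), t + t*z^3/(\<alpha>*\<gamma>), t + t*z*\<gamma>/\<alpha>))
            | t \<alpha> z \<gamma>. \<alpha> = t^2 - 1 \<and> cond_2 \<alpha> z \<gamma>}"

definition X_3 :: "point set" where
  "X_3 = {(t, (u, u, u, u), (t^2 - 2, t^2 - 2), (t*u - t, t*u - t, t*u - t, t*u - t))
          | t u. u^2 - (t^2 + 1)*u + 2*t^2 - 1 = 0 \<and> t^2 \<noteq> 5}"

definition X_4 :: "point set" where
  "X_4 = {(t, (u, u, u, u), (2*u + 2 - t^2, 2*u + 2 - t^2), (\<eta>, \<eta>, \<eta>, \<eta>))
          | t u \<eta>. t*\<eta> = u^2 + u - t^2 + 1 \<and> u \<noteq> 1 \<and>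
              \<eta>^2 + t*(t^2 + 4 - 2*u)*\<eta> - 5*t^2*u + t^4 + 4*t^2 - 6 = 0}"

definition X_5_1 :: "point set" where
  "X_5_1 = {(t, (1, t^2 - 2, 1, t^2 - 2), (1, 1), (0, 0, 0, 0)) | t. t^2 \<noteq> 3}"

definition X_5_2 :: "point set" where
  "X_5_2 = {(t, (t^2 - 2, 1, t^2 - 2, 1), (1, 1), (0, 0, 0, 0)) | t. t^2 \<noteq> 3}"

definition X_6_1 :: "point set" where
  "X_6_1 = {(t, (1, 1, 1, 1), (1, 4*t^2 - 2 - t^4), (0, 3*t - t^3, 0, 3*t - t^3))
            | t. t^2 \<noteq> 3}"

definition X_6_2 :: "point set" where
  "X_6_2 = {(t, (1, 1, 1, 1), (4*t^2 - 2 - t^4, 1), (3*t - t^3, 0, 3*t - t^3, 0))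
            | t. t^2 \<noteq> 3}"

end

theory Submission
  imports Defs
begin

text \<open>
  Let \<open>X, L, R\<close> be the images of \<open>x\<^sub>i, x\<^sub>i\<^sub>-\<^sub>1, x\<^sub>i\<^sub>+\<^sub>1\<close>. Since \<open>X Y X = tr(X Y) X - Y\<inverse>\<close> in \<open>SL(2,\<complex>)\<close>, each of
  the four equal words of the presentation is \<open>c\<^sub>i X - L\<inverse> X R\<inverse>\<close> with a scalar \<open>c\<^sub>i\<close>. Comparing the
  traces of the four words multiplied by \<open>1, x\<^sub>1, \<dots>, x\<^sub>4\<close> gives equations that are affine in the triple
  traces, and \<open>(t\<^sup>2 - 1) t\<^sub>i\<^sub>j\<^sub>k\<close> becomes a polynomial in the pair traces and the common trace of the
  words. Together with the Gram relations \<open>4 D\<^sub>I D\<^sub>J = - det G\<^sub>I\<^sub>J\<close>, where \<open>D\<^sub>I = tr(x\<^sub>i [x\<^sub>j, x\<^sub>k])\<close> and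
  \<open>G\<^sub>i\<^sub>j = 2 t\<^sub>i\<^sub>j - t\<^sub>i t\<^sub>j\<close>, they leave exactly the listed families. The few spurious solutions are
  degenerate: there some \<open>x\<^sub>i - x\<^sub>j\<close> is nilpotent and orthogonal to all generators, which
  for an irreducible representation forces \<open>x\<^sub>i = x\<^sub>j\<close>.

  Conversely, when \<open>x\<^sub>1, x\<^sub>3\<close> have no common eigenvector, traces against \<open>1, x\<^sub>1, x\<^sub>3, x\<^sub>1 x\<^sub>3\<close> determine a
  matrix; so \<open>x\<^sub>2, x\<^sub>4\<close> can be chosen with prescribed traces, and the relations can be tested on these
  four traces. The remaining points come from pairs of matrices, and the second set of each pair of
  families from the automorphism \<open>x\<^sub>1 \<mapsto> x\<^sub>2 \<mapsto> x\<^sub>3 \<mapsto> x\<^sub>4 \<mapsto> x\<^sub>1\<close>.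
\<close>

section \<open>Matrices of size two\<close>

text \<open>Comparison with opposite generators leaves \<open>(c1 - c3) * (p - 1) = 0\<close> and
  \<open>(c2 - c4) * (q - 1) = 0\<close> for \<open>p = t13\<close>, \<open>q = t24\<close>, so the
  case split is by which of \<open>p\<close>, \<open>q\<close> equal 1. If neither does,
  \<open>p = q\<close> and opposite pair traces agree (\<open>X_3\<close>, \<open>X_4\<close>,
  \<open>X_5\<close>); if one does, \<open>X_1\<close> and \<open>X_6\<close> arise; if both do,
  \<open>X_2\<close> or again equal opposite traces. Two places resist elimination. At
  \<open>t^2 = 1\<close> the factor \<open>a = t^2 - 1\<close> vanishes and the triple traces are
  not determined by pair traces and \<open>b\<close>. At \<open>t = 0\<close> equations known only
  up to the factor \<open>t\<close> are void, and a Gram relation takes their place. Apart from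
  \<open>\<alpha> = 0\<close>, the values excluded in \<open>cond_1\<close> and
  \<open>cond_2\<close> are the double roots of the quadratics for \<open>x\<close> and \<gamma>.
  Excluding them says that two opposite pair traces differ, which also separates the families. The
  coordinates are injective because every word in the generators reduces to the 16 products with
  increasing indices, with coefficients and traces fixed by the eleven values. This reduction is run
  for two representations at once, through a relation between matrices, so that no coefficient has
  to be named.\<close>

type_synonym m2 = "complex^2^2"

text \<open>The adjugate. On determinant 1 it is the inverse, but it is linear in the entries, so
  identities with inverses become polynomial identities.\<close>

definition adj2 :: "m2 \<Rightarrow> m2" where
  "adj2 A = mat (trace A) - A"

lemma m2_eq_iff: "(A::m2) = B \<longleftrightarrow>
    A$1$1 = B$1$1 \<and> A$1$2 = B$1$2 \<and> A$2$1 = B$2$1 \<and> A$2$2 = B$2$2"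
  by (auto simp: vec_eq_iff forall_2)

lemma m2_mult_nth: "((A::m2) ** B)$i$j = A$i$1 * B$1$j + A$i$2 * B$2$j"
  by (simp add: matrix_matrix_mult_def sum_2)

lemma m2_mat_nth: "(mat c :: m2)$1$1 = c" "(mat c :: m2)$1$2 = 0" "(mat c :: m2)$2$1 = 0" "(mat c :: m2)$2$2 = c"
  by (simp_all add: mat_def)

lemma m2_trace: "trace (A::m2) = A$1$1 + A$2$2"
  by (simp add: trace_def sum_2)

lemma adj2_nth: "adj2 A$1$1 = A$2$2" "adj2 A$1$2 = - A$1$2" "adj2 A$2$1 = - A$2$1" "adj2 A$2$2 = A$1$1"
  by (simp_all add: adj2_def m2_mat_nth m2_trace)

lemmas m2_simps = m2_eq_iff m2_mult_nth m2_mat_nth m2_trace adj2_nth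

lemma adj2_right: "(A::m2) ** adj2 A = mat (det A)"
  and adj2_left: "adj2 A ** (A::m2) = mat (det A)"
  by (simp_all add: m2_simps det_2 algebra_simps)

lemma adj2_mult: "adj2 (A ** B) = adj2 B ** adj2 (A::m2)"
  by (simp add: m2_simps algebra_simps)

lemma adj2_adj2 [simp]: "adj2 (adj2 A) = A"
  by (simp add: m2_simps)

lemma trace_adj2 [simp]: "trace (adj2 A) = trace A"
  by (simp add: m2_simps)

lemma det_adj2 [simp]: "det (adj2 A) = det A"
  by (simp add: m2_simps det_2)

text \<open>Cayley-Hamilton for \<open>X ** Y\<close>, multiplied on the right by the inverse of
  \<open>Y\<close>; in this polynomial form \<open>Y\<close> may be singular.\<close>

lemma sandwich: "det (X::m2) = 1 \<Longrightarrow> X ** Y ** X = mat (trace (X ** Y)) ** X - adj2 Y"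
  unfolding m2_eq_iff det_2
  by (intro conjI; simp add: m2_simps; algebra)

lemma trace_scale: "trace (mat c ** (A::m2)) = c * trace A"
  by (simp add: m2_simps algebra_simps)

section \<open>Traces of the words of the presentation\<close>

text \<open>One word of the presentation: \<open>X\<close> is the image of a generator,
  \<open>L\<close> and \<open>R\<close> are those of its cyclic predecessor and successor.\<close>

definition crossing :: "m2 \<Rightarrow> m2 \<Rightarrow> m2 \<Rightarrow> m2" where
  "crossing L X R = X ** R ** adj2 X ** L ** X"

definition crossing_coeff :: "m2 \<Rightarrow> m2 \<Rightarrow> m2 \<Rightarrow> complex" where
  "crossing_coeff L X R = trace (X ** (R ** adj2 X ** L))"

lemma crossing_eq:
  assumes "det X = 1"
  shows "crossing L X R = mat (crossing_coeff L X R) ** X - adj2 L ** X ** adj2 R"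
  using sandwich[OF assms, of "R ** adj2 X ** L"]
  by (simp add: crossing_def crossing_coeff_def adj2_mult matrix_mul_assoc)

lemma crossing_coeff_eq:
  assumes "det X = 1"
  shows "crossing_coeff L X R = trace X * trace (L ** X ** R) - trace (L ** X) * trace (X ** R)
     + trace L * trace R - trace (L ** R)"
proof -
  have "crossing_coeff L X R = trace X * trace (L ** X ** R) - trace (X ** R ** X ** L)"
    unfolding crossing_coeff_def by (simp add: m2_simps algebra_simps)
  also have "\<dots> = trace X * trace (L ** X ** R) - (trace (X ** R) * trace (X ** L) - trace (adj2 R ** L))"
    unfolding sandwich[OF assms] by (simp add: m2_simps algebra_simps)
  also have "\<dots> = trace X * trace (L ** X ** R) - trace (L ** X) * trace (X ** R)
     + trace L * trace R - trace (L ** R)"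
    by (simp add: m2_simps algebra_simps)
  finally show ?thesis .
qed

lemma trace_crossing:
  assumes "det X = 1"
  shows "trace (crossing L X R ** Z) = crossing_coeff L X R * trace (X ** Z)
    - trace (adj2 L ** X ** adj2 R ** Z)"
  unfolding crossing_eq[OF assms] by (simp add: m2_simps algebra_simps)

lemma trace_cyc3: "trace ((A::m2) ** B ** C) = trace (B ** C ** A)"
  using trace_mul_sym[of A "B ** C"] by (simp add: matrix_mul_assoc)

text \<open>A polarised form of Cayley-Hamilton, linear in each matrix. It makes the fourfold trace
  a polynomial in the shorter ones, so no fourfold coordinate occurs.\<close>

lemma trace4:
  "2 * trace ((A::m2) ** B ** C ** E) =
     trace A * trace (B ** C ** E) + trace B * trace (A ** C ** E) + trace C * trace (A ** B ** E)
     + trace E * trace (A ** B ** C) + trace (A ** B) * trace (C ** E) + trace (A ** E) * trace (B ** C)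
     - trace (A ** C) * trace (B ** E) - trace A * trace B * trace (C ** E)
     - trace A * trace E * trace (B ** C) - trace B * trace C * trace (A ** E)
     - trace C * trace E * trace (A ** B) + trace A * trace B * trace C * trace E"
  unfolding m2_simps by algebra

section \<open>The trace form and the volume form on traceless parts\<close>

text \<open>Twice the trace form on the traceless parts \<open>X - mat (trace X / 2)\<close>. These
  form a three-dimensional quadratic space, where linear algebra replaces matrix algebra.\<close>

definition gr :: "m2 \<Rightarrow> m2 \<Rightarrow> complex" where
  "gr X Y = 2 * trace (X ** Y) - trace X * trace Y"

text \<open>Alternating in the three traceless parts, hence a multiple of their determinant. It
  carries the part of a triple trace that the pair traces fix only up to sign (\<open>br_eq\<close>,
  \<open>br_mult_br\<close>).\<close>

definition br :: "m2 \<Rightarrow> m2 \<Rightarrow> m2 \<Rightarrow> complex" where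
  "br X Y Z = trace (X ** Y ** Z) - trace (X ** Z ** Y)"

lemma br_eq: "br X Y Z = 2 * trace (X ** Y ** Z) - trace X * trace (Y ** Z) - trace Y * trace (X ** Z)
   - trace Z * trace (X ** Y) + trace X * trace Y * trace Z"
  unfolding br_def m2_simps by algebra

lemma gr_entries: "gr X Y = (X$1$1 - X$2$2) * (Y$1$1 - Y$2$2) + 2 * X$1$2 * Y$2$1 + 2 * X$2$1 * Y$1$2"
  unfolding gr_def m2_simps by algebra

lemma br_entries: "br X Y Z =
   (X$1$1 - X$2$2) * (Y$1$2 * Z$2$1 - Z$1$2 * Y$2$1)
 - (Y$1$1 - Y$2$2) * (X$1$2 * Z$2$1 - Z$1$2 * X$2$1)
 + (Z$1$1 - Z$2$2) * (X$1$2 * Y$2$1 - Y$1$2 * X$2$1)"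
  unfolding br_def m2_simps by algebra

definition det3 :: "complex \<Rightarrow> complex \<Rightarrow> complex \<Rightarrow> complex \<Rightarrow> complex \<Rightarrow> complex \<Rightarrow> complex \<Rightarrow> complex
   \<Rightarrow> complex \<Rightarrow> complex" where
  "det3 a b c d e f g h i = a * (e * i - f * h) - b * (d * i - f * g) + c * (d * h - e * g)"

text \<open>Multiplicativity of the determinant: in the coordinates
  \<open>(X11 - X22, X12, X21)\<close> the matrix of \<open>gr\<close> has determinant -4.\<close>

lemma det3_product:
  fixes r1 :: complex
  shows "4 * (r1 * (s2 * z3 - z2 * s3) - s1 * (r2 * z3 - z2 * r3) + z1 * (r2 * s3 - s2 * r3))
     * (u1 * (v2 * w3 - w2 * v3) - v1 * (u2 * w3 - w2 * u3) + w1 * (u2 * v3 - v2 * u3)) =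
   - det3 (r1 * u1 + 2 * r2 * u3 + 2 * r3 * u2) (r1 * v1 + 2 * r2 * v3 + 2 * r3 * v2) (r1 * w1 + 2 * r2 * w3 + 2 * r3 * w2)
          (s1 * u1 + 2 * s2 * u3 + 2 * s3 * u2) (s1 * v1 + 2 * s2 * v3 + 2 * s3 * v2) (s1 * w1 + 2 * s2 * w3 + 2 * s3 * w2)
          (z1 * u1 + 2 * z2 * u3 + 2 * z3 * u2) (z1 * v1 + 2 * z2 * v3 + 2 * z3 * v2) (z1 * w1 + 2 * z2 * w3 + 2 * z3 * w2)"
  unfolding det3_def by (simp add: algebra_simps)

lemma br_mult_br: "4 * br X Y Z * br U V W =
   - det3 (gr X U) (gr X V) (gr X W) (gr Y U) (gr Y V) (gr Y W) (gr Z U) (gr Z V) (gr Z W)"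
  unfolding gr_entries br_entries by (rule det3_product)

text \<open>Four vectors in a three-dimensional space are dependent, with the volumes of triples as
  coefficients; the dependency is paired with \<open>Z\<close>.\<close>

lemma br_linear:
  "br B C E * gr A Z - br A C E * gr B Z + br A B E * gr C Z - br A B C * gr E Z = 0"
proof -
  have *: "(b1*(c2 * e3 - e2 * c3) - c1*(b2 * e3 - e2 * b3) + e1*(b2 * c3 - c2 * b3)) * (a1 * z1 + 2 * a2 * z3 + 2 * a3 * z2)
    - (a1*(c2 * e3 - e2 * c3) - c1*(a2 * e3 - e2 * a3) + e1*(a2 * c3 - c2 * a3)) * (b1 * z1 + 2 * b2 * z3 + 2 * b3 * z2)
    + (a1*(b2 * e3 - e2 * b3) - b1*(a2 * e3 - e2 * a3) + e1*(a2 * b3 - b2 * a3)) * (c1 * z1 + 2 * c2 * z3 + 2 * c3 * z2)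
    - (a1*(b2 * c3 - c2 * b3) - b1*(a2 * c3 - c2 * a3) + c1*(a2 * b3 - b2 * a3)) * (e1 * z1 + 2 * e2 * z3 + 2 * e3 * z2) = 0"
    for a1 a2 a3 b1 b2 b3 c1 c2 c3 e1 e2 e3 z1 z2 z3 :: complex
    by algebra
  show ?thesis unfolding gr_entries br_entries by (rule *)
qed

section \<open>The trace equations and their solutions\<close>

text \<open>Here \<open>u\<^sub>i = t\<^sub>i\<^sub>,\<^sub>i\<^sub>+\<^sub>1 - 1\<close> with indices mod 4, \<open>p = t\<^sub>1\<^sub>3\<close>, \<open>q = t\<^sub>2\<^sub>4\<close>, \<open>T\<^sub>i\<close> is the triple trace over
  \<open>x\<^sub>i\<^sub>-\<^sub>1, x\<^sub>i, x\<^sub>i\<^sub>+\<^sub>1\<close> (so \<open>T\<^sub>1 = t\<^sub>1\<^sub>2\<^sub>4\<close>), and \<open>b\<close> is the common trace of the four words.\<close>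

locale char_eqs =
  fixes t a u1 u2 u3 u4 p q T1 T2 T3 T4 c1 c2 c3 c4 b D1 D2 D3 D4 :: complex
  assumes a: "a = t^2 - 1"
    and F1: "a * T1 = b - t + t * (q + u1 * u4)"
    and F2: "a * T2 = b - t + t * (p + u1 * u2)"
    and F3: "a * T3 = b - t + t * (q + u2 * u3)"
    and F4: "a * T4 = b - t + t * (p + u3 * u4)"
    and c1: "c1 = t * T1 - (u1 + 1) * (u4 + 1) + t^2 - q"
    and c2: "c2 = t * T2 - (u1 + 1) * (u2 + 1) + t^2 - p"
    and c3: "c3 = t * T3 - (u2 + 1) * (u3 + 1) + t^2 - q"
    and c4: "c4 = t * T4 - (u3 + 1) * (u4 + 1) + t^2 - p"
    and P1: "c1 * (u1 + 1) + c2 = t * b + t^2 - 1 - u4"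
    and P2: "c2 * (u2 + 1) + c3 = t * b + t^2 - 1 - u1"
    and P3: "c3 * (u3 + 1) + c4 = t * b + t^2 - 1 - u2"
    and P4: "c4 * (u4 + 1) + c1 = t * b + t^2 - 1 - u3"
    and P1': "c2 * (u1 + 1) + c1 = t * b + t^2 - 1 - u2"
    and P2': "c3 * (u2 + 1) + c2 = t * b + t^2 - 1 - u3"
    and P3': "c4 * (u3 + 1) + c3 = t * b + t^2 - 1 - u4"
    and P4': "c1 * (u4 + 1) + c4 = t * b + t^2 - 1 - u1"
    and C13: "(c1 - c3) * (p - 1) = 0"
    and C24: "(c2 - c4) * (q - 1) = 0"
    and Q13: "2 * (c1 * p + c3) = 2 * t * b + 2 * t^2 * p - 2 * t * (T2 + T4) + t * (T1 + T2 + T3 + T4)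
       + (u1 + 1) * (u3 + 1) + (u2 + 1) * (u4 + 1) - p * q - t^2 * (u1 + u2 + u3 + u4 + 4) + t^4"
    and Q24: "2 * (c2 * q + c4) = 2 * t * b + 2 * t^2 * q - 2 * t * (T1 + T3) + t * (T1 + T2 + T3 + T4)
       + (u1 + 1) * (u3 + 1) + (u2 + 1) * (u4 + 1) - p * q - t^2 * (u1 + u2 + u3 + u4 + 4) + t^4"
    and D1: "D1 = 2 * T1 - t * (u1 + u4 + 2 + q) + t^3"
    and D2: "D2 = 2 * T2 - t * (u1 + u2 + 2 + p) + t^3"
    and D3: "D3 = 2 * T3 - t * (u2 + u3 + 2 + q) + t^3"
    and D4: "D4 = 2 * T4 - t * (u3 + u4 + 2 + p) + t^3"
    and S1: "4 * D1^2 = - det3 (t^2 - 4) (2*u1 + 2 - t^2) (2*u4 + 2 - t^2)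
                               (2*u1 + 2 - t^2) (t^2 - 4) (2*q - t^2)
                               (2*u4 + 2 - t^2) (2*q - t^2) (t^2 - 4)"
    and S2: "4 * D2^2 = - det3 (t^2 - 4) (2*u1 + 2 - t^2) (2*p - t^2)
                               (2*u1 + 2 - t^2) (t^2 - 4) (2*u2 + 2 - t^2)
                               (2*p - t^2) (2*u2 + 2 - t^2) (t^2 - 4)"
    and S23: "4 * D2 * D3 = - det3 (2*u1 + 2 - t^2) (2*p - t^2) (2*u4 + 2 - t^2)
                               (t^2 - 4) (2*u2 + 2 - t^2) (2*q - t^2)
                               (2*u2 + 2 - t^2) (t^2 - 4) (2*u3 + 2 - t^2)"
    and S24: "4 * D2 * D4 = - det3 (t^2 - 4) (2*p - t^2) (2*u4 + 2 - t^2)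
                               (2*u1 + 2 - t^2) (2*u2 + 2 - t^2) (2*q - t^2)
                               (2*p - t^2) (t^2 - 4) (2*u3 + 2 - t^2)"
    and L1: "D3 * (t^2 - 4) - D4 * (2*u1 + 2 - t^2) + D1 * (2*p - t^2) - D2 * (2*u4 + 2 - t^2) = 0"
    and L2: "D3 * (2*u1 + 2 - t^2) - D4 * (t^2 - 4) + D1 * (2*u2 + 2 - t^2) - D2 * (2*q - t^2) = 0"
    and irr: "\<not> (u1 = t^2 - 3 \<and> u2 = t^2 - 3 \<and> u3 = t^2 - 3 \<and> u4 = t^2 - 3 \<and> p = t^2 - 2 \<and> q = t^2 - 2)"
    and coinc12: "u1 = t^2 - 3 \<Longrightarrow> p = u2 + 1 \<Longrightarrow> q = u4 + 1 \<Longrightarrow> T2 = t * p - t"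
    and coinc23: "u2 = t^2 - 3 \<Longrightarrow> p = u1 + 1 \<Longrightarrow> q = u3 + 1 \<Longrightarrow> T2 = t * p - t"
    and inv12: "\<not> (t^2 = 2 \<and> u1 = 1 \<and> u3 = 1 \<and> u2 = 0 \<and> u4 = 0 \<and> p = 1 \<and> q = 1)"
    and inv23: "\<not> (t^2 = 2 \<and> u2 = 1 \<and> u4 = 1 \<and> u1 = 0 \<and> u3 = 0 \<and> p = 1 \<and> q = 1)"
begin

text \<open>\<open>F1\<close> contains \<open>a * T1\<close> and \<open>c1\<close> contains
  \<open>t * T1\<close>; eliminating \<open>T1\<close> leaves only pair traces and
  \<open>b\<close>.\<close>

lemma ac1: "a * c1 = t * (b - t) + q + (u1 - a) * (u4 - a)"
  using F1 c1 a by algebra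
lemma ac2: "a * c2 = t * (b - t) + p + (u1 - a) * (u2 - a)"
  using F2 c2 a by algebra
lemma ac3: "a * c3 = t * (b - t) + q + (u2 - a) * (u3 - a)"
  using F3 c3 a by algebra
lemma ac4: "a * c4 = t * (b - t) + p + (u3 - a) * (u4 - a)"
  using F4 c4 a by algebra

text \<open>The two equations \<open>P1\<close> and \<open>P1'\<close> over the same edge differ by
  an expression without \<open>b\<close>; after multiplication by \<open>a\<close> only pair traces
  remain.\<close>

lemma A1: "u1 * (q - p) + (u1^2 - a * u1 + a) * (u4 - u2) = 0"
  using ac1 ac2 P1 P1' by algebra
lemma A2: "u2 * (p - q) + (u2^2 - a * u2 + a) * (u1 - u3) = 0"
  using ac2 ac3 P2 P2' by algebra
lemma A3: "u3 * (q - p) + (u3^2 - a * u3 + a) * (u2 - u4) = 0"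
  using ac3 ac4 P3 P3' by algebra
lemma A4: "u4 * (p - q) + (u4^2 - a * u4 + a) * (u3 - u1) = 0"
  using ac4 ac1 P4 P4' by algebra

text \<open>\<open>L1\<close> factors here as \<open>D2\<close> times a linear form, and the factors
  give the two alternatives: a linear relation between \<open>p\<close> and \<open>u1\<close>, or
  vanishing volumes of all triples.\<close>

lemma all_equal:
  assumes u: "u2 = u1" "u3 = u1" "u4 = u1" and q: "q = p" and T: "T2 = T1" "T3 = T1" "T4 = T1"
  shows "(T1 = t * u1 \<and> p = t^2 - 2 \<and> u1^2 - a * u1 + a = 0 \<and> a \<noteq> 4) \<or>
    (p = 2 * u1 + 4 - t^2 \<and> t * T1 = u1^2 + 3 * u1 + 3 - t^2 \<and> u1 \<noteq> 0 \<and>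
     T1^2 + t * (t^2 + 2 - 2 * u1) * T1 - 5 * t^2 * (u1 + 1) + t^4 + 4 * t^2 - 6 = 0)"
proof -
  have D: "D1 = D2" "D3 = D2" "D4 = D2"
    using D1 D2 D3 D4 u q T by auto
  have pnot: "\<not> (u1 = t^2 - 3 \<and> p = t^2 - 2)"
    using irr u q by auto
  have "D2 * (p - 2 * u1 - 4 + t^2) = 0"
    using L1 unfolding D u by algebra
  then have "D2 = 0 \<or> p = 2 * u1 + 4 - t^2" by algebra
  then consider "p = 2 * u1 + 4 - t^2" | "D2 = 0" "p \<noteq> 2 * u1 + 4 - t^2" by blast
  then show ?thesis
  proof cases
    case 1
    have "(u1 + 2 - a) * (t * T1 - (u1^2 + 3 * u1 + 3 - t^2)) = 0"
      using F1 c1 c2 P1 1 a unfolding u q T by algebra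
    \<comment> \<open>The removed factor belongs to four equal generators, the configuration
      excluded by \<open>irr\<close>.\<close>
    moreover have "u1 + 2 - a \<noteq> 0"
    proof
      assume "u1 + 2 - a = 0"
      then have "u1 = t^2 - 3" "p = t^2 - 2" using 1 a by algebra+
      with pnot show False by simp
    qed
    ultimately have tT: "t * T1 = u1^2 + 3 * u1 + 3 - t^2" by simp
    have "4 * (2 * T1 - t * (2 * u1 + 2 + p) + t^3)^2 = - det3 (t^2 - 4) (2*u1 + 2 - t^2) (2*p - t^2)
                               (2*u1 + 2 - t^2) (t^2 - 4) (2*u1 + 2 - t^2)
                               (2*p - t^2) (2*u1 + 2 - t^2) (t^2 - 4)"
      using S2 D2 unfolding u T by algebra
    then have quad: "T1^2 + t * (t^2 + 2 - 2 * u1) * T1 - 5 * t^2 * (u1 + 1) + t^4 + 4 * t^2 - 6 = 0"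
      using tT unfolding 1 det3_def by algebra
    \<comment> \<open>At \<open>u1 = 0\<close> the two equations are compatible only for
      \<open>t^2 = 3\<close>, which is again the point excluded by \<open>irr\<close>.\<close>
    have "u1 \<noteq> 0"
    proof
      assume u0: "u1 = 0"
      have "t * T1 = 3 - t^2" "T1^2 + t * (t^2 + 2) * T1 - 5 * t^2 + t^4 + 4 * t^2 - 6 = 0"
        using quad tT u0 by simp_all
      then have "(t^2 - 3)^2 = 0" by algebra
      then have "t^2 = 3" by simp
      with pnot u0 1 show False by simp
    qed
    with 1 tT quad show ?thesis by simp
  next
    case 2
    let ?g = "t^2 - 4" let ?h = "2*p - t^2" let ?k = "2*u1 + 2 - t^2"
    have s2: "(?g - ?h) * (?g^2 + ?g * ?h - 2 * ?k^2) = 0"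
      using S2 2(1) unfolding u det3_def by algebra
    have s23: "?k * (?g - ?h)^2 = 0"
      using S23 unfolding 2 D u q det3_def by algebra
    have s24: "?g * (?k * ?k - ?h * ?g) - ?h * (?k * ?k - ?h * ?h) + ?k * (?k * ?g - ?k * ?h) = 0"
      using S24 unfolding 2 D u q det3_def by algebra
    have ghk: "?g + ?h \<noteq> 2 * ?k"
      using 2(2) by algebra
    have "?g = ?h"
    proof (rule ccontr)
      assume ne: "?g \<noteq> ?h"
      then have k: "?k = 0" and "?g * (?g + ?h) = 0" using s2 s23 by algebra+
      with ghk have g: "?g = 0" by auto
      have "?h * ?h * ?h = 0" using s24 unfolding k g by simp
      with ne g show False by auto
    qed
    then have p: "p = t^2 - 2" by algebra
    have T: "T1 = t * u1"
      using 2(1) D2 unfolding u T p by algebra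
    have "(u1 + 2 - a) * (u1^2 - a * u1 + a) = 0"
      using F1 c1 c2 P1 a unfolding u q \<open>T2 = T1\<close> p T by algebra
    moreover have ne: "u1 + 2 - a \<noteq> 0"
    proof
      assume "u1 + 2 - a = 0"
      then have "u1 = t^2 - 3" using p a by algebra
      with pnot p show False by simp
    qed
    ultimately have f: "u1^2 - a * u1 + a = 0" by simp
    \<comment> \<open>At \<open>a = 4\<close> the quadratic has the double root
      \<open>u1 = a - 2\<close>, which was just excluded.\<close>
    have "a \<noteq> 4"
    proof
      assume "a = 4"
      with f have "(u1 - 2)^2 = 0" by (simp add: power2_eq_square algebra_simps)
      with ne \<open>a = 4\<close> show False by simp
    qed
    with T p f show ?thesis by simp
  qed
qed

text \<open>All \<open>c\<close> equal 1, and \<open>Q13\<close> becomes an equality of squares. One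
  sign makes two neighbouring generators coincide (\<open>coinc12\<close>, \<open>coinc23\<close>);
  the other leads only to neighbours inverse to each other, which \<open>inv12\<close> and
  \<open>inv23\<close> rule out.\<close>

lemma two_values:
  assumes u: "u3 = u1" "u4 = u2" "u1 \<noteq> u2" and q: "q = p" and T: "T2 = T1" "T3 = T1" "T4 = T1"
  shows "p = 1 \<and> T1 = 0 \<and> t^2 \<noteq> 3 \<and> (u1 = 0 \<and> u2 = t^2 - 3 \<or> u1 = t^2 - 3 \<and> u2 = 0)"
proof -
  have D: "D1 = D2" "D3 = D2" "D4 = D2"
    using D1 D2 D3 D4 u q T by (auto simp: add.commute)
  have c: "c2 = c1" "c3 = c1" "c4 = c1"
    unfolding c1 c2 c3 c4 u q T by (simp_all add: algebra_simps)
  have "(c1 - 1) * (u1 - u2) = 0"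
    using P1 P2 unfolding u c by algebra
  with u have c1_1: "c1 = 1" by simp
  have tb: "t * b = u1 + u2 + 3 - t^2"
    using P1 unfolding c c1_1 u by algebra
  have tT: "t * T1 = 1 + (u1 + 1) * (u2 + 1) - t^2 + p"
    using c1 unfolding c1_1 u q by algebra
  have p: "a = t * b - t^2 + p + (u1 - a) * (u2 - a)"
    using ac1 unfolding c1_1 u q by algebra
  have "(p - t^2)^2 = (u1 + u2 - 2 * a + 2)^2"
    using Q13 tb tT p a unfolding c c1_1 u q T by algebra
  then have p2: "p - t^2 = u1 + u2 - 2 * a + 2 \<or> p - t^2 = - (u1 + u2 - 2 * a + 2)"
    by (auto simp: power2_eq_iff)
  have plus: ?thesis if 1: "p - t^2 = u1 + u2 - 2 * a + 2"
  proof -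
    \<comment> \<open>\<open>u1 = a - 2\<close> says that the trace of the neighbouring product is
      \<open>t^2 - 2\<close>, as it is for equal matrices.\<close>
    have "(u1 - a + 2) * (u2 - a + 2) = 0"
      using p 1 tb a by algebra
    then have "u1 = a - 2 \<or> u2 = a - 2" by algebra
    then show ?thesis
    proof
      assume 2: "u1 = a - 2"
      have u1: "u1 = t^2 - 3" using 2 a by simp
      have p2: "p = u2 + 1" using 1 2 a by algebra
      have T2: "T1 = t * p - t" using coinc12 u1 p2 u q T by simp
      have "p = 1" using tT T2 p2 u1 by algebra
      moreover from this have "u2 = 0" "T1 = 0" using p2 T2 by auto
      ultimately show ?thesis using u u1 by auto
    next
      assume 2: "u2 = a - 2"
      have u2: "u2 = t^2 - 3" using 2 a by simp
      have p2: "p = u1 + 1" using 1 2 a by algebra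
      have T2: "T1 = t * p - t" using coinc23 u2 p2 u q T by simp
      have "p = 1" using tT T2 p2 u2 by algebra
      moreover from this have "u1 = 0" "T1 = 0" using p2 T2 by auto
      ultimately show ?thesis using u u2 by auto
    qed
  qed
  show ?thesis
  proof (rule ccontr)
    assume not_thesis: "\<not> ?thesis"
    then have plus_ne: "p - t^2 \<noteq> u1 + u2 - 2 * a + 2" using plus by blast
    with p2 have minus: "p = t^2 - u1 - u2 + 2 * a - 2" by algebra
    have "D2 = 0"
    proof -
      have "D2 * (p - t^2 - (u1 + u2 - 2 * a + 2)) = 0"
        using L1 minus a unfolding D u by algebra
      with plus_ne show ?thesis by simp
    qed
    have s2: "det3 (t^2 - 4) (2*u1 + 2 - t^2) (2*p - t^2)
                   (2*u1 + 2 - t^2) (t^2 - 4) (2*u2 + 2 - t^2)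
                   (2*p - t^2) (2*u2 + 2 - t^2) (t^2 - 4) = 0"
      using S2 \<open>D2 = 0\<close> by simp
    have tD: "t^2 * (u1 + u2 + 2 + p) - t^4 = 2 * (1 + (u1 + 1) * (u2 + 1) - t^2 + p)"
      using D2 \<open>D2 = 0\<close> tT unfolding T by algebra
    have S_ne: "u1 + u2 - 2 * a + 2 \<noteq> 0" using plus_ne minus by algebra
    have "(u1 - a) * (u2 - a) = 0" using p minus tb a by algebra
    then have "u1 = a \<or> u2 = a" by algebra
    then show False
    proof
      assume 1: "u1 = a"
      \<comment> \<open>Once \<open>u1 = a\<close>, the Gram determinant of the triple splits into
        linear factors, and only \<open>a = 1\<close> survives.\<close>
      have "(u2 - a) * (a - 1) * (u1 + u2 - 2 * a + 2) = 0"
        using s2 minus a 1 unfolding det3_def by algebra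
      with S_ne u 1 have a1: "a = 1" by auto
      have t2: "t^2 = 2" using a a1 by algebra
      have "u2 = 0" using tD t2 minus 1 a1 by algebra
      with inv12 t2 1 a1 minus u q show False by simp
    next
      assume 1: "u2 = a"
      have "(u1 - a) * (a - 1) * (u1 + u2 - 2 * a + 2) = 0"
        using s2 minus a 1 unfolding det3_def by algebra
      with S_ne u 1 have a1: "a = 1" by auto
      have t2: "t^2 = 2" using a a1 by algebra
      have "u1 = 0" using tD t2 minus 1 a1 by algebra
      with inv23 t2 1 a1 minus u q show False by simp
    qed
  qed
qed

lemma T_equal:
  assumes "a \<noteq> 0" "u3 = u1" "u4 = u2" "q = p"
  shows "T2 = T1" "T3 = T1" "T4 = T1"
proof -
  have "a * T2 = a * T1" "a * T3 = a * T1" "a * T4 = a * T1"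
    unfolding F1 F2 F3 F4 assms by (simp_all add: mult.commute)
  with assms show "T2 = T1" "T3 = T1" "T4 = T1" by simp_all
qed

lemma alternating_zero:
  assumes "a \<noteq> 0" "p \<noteq> q"
    and "u2 = u4 \<or> u1 = u3"
  shows "u1 = 0" "u2 = 0" "u3 = 0" "u4 = 0"
  using A1 A2 A3 A4 assms by auto

text \<open>\<open>A1\<close> and \<open>A3\<close> form a homogeneous linear system with the
  nonzero solution \<open>(q - p, u4 - u2)\<close>; its determinant gives the first equation.
  \<open>A2\<close> and \<open>A4\<close> give the same equation for \<open>u2, u4\<close>, and the
  two pairs turn out to have equal sum and product.\<close>

lemma two_pairs:
  assumes a0: "a \<noteq> 0" and pq: "p \<noteq> q" and ne: "u2 \<noteq> u4" "u1 \<noteq> u3"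
  shows "(u1 + u3) * (u1 * u3 + a) = 2 * a * (u1 * u3)" "u1 * u3 \<noteq> 0"
    "u1 = u2 \<and> u3 = u4 \<or> u1 = u4 \<and> u3 = u2"
proof -
  have nz: "u1 \<noteq> 0" "u2 \<noteq> 0" "u3 \<noteq> 0" "u4 \<noteq> 0"
    using A1 A2 A3 A4 a0 ne by auto
  have "(u4 - u2) * ((u1 + u3) * (u1 * u3 + a) - 2 * a * (u1 * u3)) = 0"
    using A1 A3 by algebra
  with ne show S: "(u1 + u3) * (u1 * u3 + a) = 2 * a * (u1 * u3)" by simp
  have "(u1 - u3) * ((u2 + u4) * (u2 * u4 + a) - 2 * a * (u2 * u4)) = 0"
    using A2 A4 by algebra
  with ne have S': "(u2 + u4) * (u2 * u4 + a) = 2 * a * (u2 * u4)" by simp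
  have f1: "2 * (u1 * u3) * (u1^2 - a * u1 + a) = u1 * (u1 - u3) * (u1 * u3 - a)"
    using S by algebra
  have f2: "2 * (u2 * u4) * (u2^2 - a * u2 + a) = u2 * (u2 - u4) * (u2 * u4 - a)"
    using S' by algebra
  have "u2 * (u1^2 - a * u1 + a) * (u4 - u2) + u1 * (u2^2 - a * u2 + a) * (u1 - u3) = 0"
    using A1 A2 by algebra
  then have "u1 * u2 * (u1 - u3) * (u4 - u2) * a * (u1 * u3 - u2 * u4) = 0"
    using f1 f2 by algebra
  with nz ne a0 have P: "u1 * u3 = u2 * u4" by simp
  show "u1 * u3 \<noteq> 0" using nz by simp
  with S a0 have "u1 * u3 + a \<noteq> 0" by auto
  moreover have "(u1 * u3 + a) * (u1 + u3 - u2 - u4) = 0"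
    using S S' unfolding P by algebra
  ultimately have "u1 + u3 - u2 - u4 = 0" by (metis mult_eq_0_iff)
  then have S2: "u1 + u3 = u2 + u4" by algebra
  have "(u1 - u2) * (u1 - u4) = 0" using P S2 by algebra
  then show "u1 = u2 \<and> u3 = u4 \<or> u1 = u4 \<and> u3 = u2" using S2 by auto
qed

text \<open>With neither \<open>p\<close> nor \<open>q\<close> equal to 1, \<open>C13\<close> and
  \<open>C24\<close> make opposite coefficients equal, which clashes with every other pattern of
  pair traces.\<close>

lemma generic:
  assumes a0: "a \<noteq> 0" and p1: "p \<noteq> 1" and q1: "q \<noteq> 1"
  shows "q = p \<and> u3 = u1 \<and> u4 = u2"
proof -
  have c: "c1 = c3" "c2 = c4" using C13 C24 p1 q1 by auto
  have v: "(u1 - a) * (u4 - a) = (u2 - a) * (u3 - a)" "(u1 - a) * (u2 - a) = (u3 - a) * (u4 - a)"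
    using ac1 ac2 ac3 ac4 c by algebra+
  show ?thesis
  proof (cases "p = q")
    case True
    have f: "(u1^2 - a * u1 + a) * (u4 - u2) = 0" "(u3^2 - a * u3 + a) * (u2 - u4) = 0"
      "(u2^2 - a * u2 + a) * (u1 - u3) = 0" "(u4^2 - a * u4 + a) * (u3 - u1) = 0"
      using A1 A2 A3 A4 True by simp_all
    consider "u1 = u3" "u2 = u4" | "u1 = u3" "u2 \<noteq> u4" | "u1 \<noteq> u3" "u2 = u4" | "u1 \<noteq> u3" "u2 \<noteq> u4"
      by blast
    then show ?thesis
    proof cases
      case 1
      with True show ?thesis by simp
    next
      case 2
      have "(u1 - a) * (u4 - u2) = 0" using v 2 by algebra
      with 2 have "u1 = a" by simp
      with f 2 a0 show ?thesis by (auto simp: power2_eq_square)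
    next
      case 3
      have "(u2 - a) * (u1 - u3) = 0" using v 3 by algebra
      with 3 have "u2 = a" by simp
      with f 3 a0 show ?thesis by (auto simp: power2_eq_square)
    next
      case 4
      then have f: "u1^2 - a * u1 + a = 0" "u3^2 - a * u3 + a = 0" "u2^2 - a * u2 + a = 0"
        "u4^2 - a * u4 + a = 0" using f by auto
      have "(u1 - u3) * (u1 + u3 - a) = 0" "(u2 - u4) * (u2 + u4 - a) = 0"
        using f by algebra+
      with 4 have "u1 + u3 - a = 0" "u2 + u4 - a = 0" by simp_all
      then have S: "u3 = a - u1" "u4 = a - u2" by algebra+
      have "(u1 - u2) * (u1 - u4) = 0" using f S by algebra
      then have "u2 = u1 \<or> u4 = u1" by auto
      then have "a * (u1 - u3) = 0"
      proof
        assume u2: "u2 = u1"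
        show ?thesis using v(2) unfolding S u2 by algebra
      next
        assume u4: "u4 = u1"
        have u2: "u2 = a - u1" using S(2) u4 by simp
        show ?thesis using v(1) unfolding u2 u4 S(1) by algebra
      qed
      with a0 4 show ?thesis by simp
    qed
  next
    case pq: False
    show ?thesis
    proof (cases "u2 = u4 \<or> u1 = u3")
      case False
      then have ne: "u2 \<noteq> u4" "u1 \<noteq> u3" by auto
      note tp = two_pairs[OF a0 pq ne]
      have "(u1 - u3) * (u1 + u3 - 2 * a) = 0" using v tp(3) by algebra
      with ne have "u1 + u3 = 2 * a" by simp
      with tp(1) have "2 * a * a = 0" by algebra
      with a0 show ?thesis by simp
    next
      case True
      note u = alternating_zero[OF a0 pq True]
      let ?M = "t * (b - t)"
      have d: "2 * ?M * (p - q) + 2 * (q - p) + 2 * a^2 * (p - q) = 2 * a * (a + 1) * (p - q) + 4 * (a + 1) * (q - p)"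
        using Q13 Q24 ac1 ac2 ac3 ac4 F1 F2 F3 F4 a unfolding u by algebra
      have "(p - q) * (?M + a + 1) = 0" using d by algebra
      with pq have "?M + a + 1 = 0" by simp
      then have M: "?M = - (a + 1)" by algebra
      have s: "p + q = 2 * a + 2 - a^2"
        using P1 ac1 ac2 M a unfolding u by algebra
      have "(a + 2) * (p * q + a^2 - 2 * a - 1) = 0"
        using Q13 ac1 ac3 F1 F2 F3 F4 a s M unfolding u by algebra
      moreover have "p * q + a^2 - 2 * a - 1 \<noteq> 0"
      proof
        assume "p * q + a^2 - 2 * a - 1 = 0"
        with s have "(p - 1) * (q - 1) = 0" by algebra
        with p1 q1 show False by simp
      qed
      \<comment> \<open>A spurious solution of the equations used so far; only the linear relations
        between the volumes refute it.\<close>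
      ultimately have a2: "a = -2" by algebra
      have "a * T3 = a * T1" "a * T4 = a * T2" unfolding F1 F2 F3 F4 u by simp_all
      with a0 have T: "T3 = T1" "T4 = T2" by simp_all
      have D: "D3 = D1" "D4 = D2" using D1 D2 D3 D4 T u by simp_all
      have t2: "t^2 = -1" using a a2 by algebra
      have l: "D1 * (2 * p - 4) = 6 * D2" "D1 * 6 = D2 * (2 * q - 4)"
        using L1 L2 t2 unfolding D u by algebra+
      have tD: "- 2 * (t * D1) = - 4 - 4 * q" "- 2 * (t * D2) = - 4 - 4 * p"
        using D1 D2 F1 F2 M a a2 t2 unfolding u by algebra+
      have "D1 \<noteq> 0"
      proof
        assume "D1 = 0"
        moreover from this have "D2 = 0" using l by simp
        ultimately have "p = q" using tD by simp
        with pq show False by simp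
      qed
      moreover have "D1 * ((p - 2) * (q - 2) - 9) = 0" using l by algebra
      ultimately have "(p - 2) * (q - 2) = 9" by simp
      moreover have "p + q + 6 = 0" using s a2 by simp
      moreover have "(p - 1) * (q - 1) = ((p - 2) * (q - 2) - 9) + (p + q + 6)"
        by (simp add: algebra_simps)
      ultimately have "(p - 1) * (q - 1) = 0" by simp
      with p1 q1 show ?thesis by simp
    qed
  qed
qed

text \<open>With all \<open>u\<close> zero the Gram relation gives
  \<open>D2^2 = t^2 * (a - 2)^2\<close>, so \<open>D2\<close> is nonzero unless
  \<open>t = 0\<close>, and dividing the linear relations by it determines \<open>q\<close>.\<close>

lemma p_one_zero:
  assumes a0: "a \<noteq> 0" and p: "p = 1" and q: "q \<noteq> 1"
    and u: "u1 = 0" "u2 = 0" "u3 = 0" "u4 = 0"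
  shows "a \<noteq> 2 \<and> q = 2 * a + 1 - a^2 \<and> T1 = t * (2 - a) \<and> T2 = 0 \<and> T3 = t * (2 - a) \<and> T4 = 0"
proof -
  let ?M = "t * (b - t)"
  have "a * T3 = a * T1" "a * T4 = a * T2" unfolding F1 F2 F3 F4 u by simp_all
  with a0 have T: "T3 = T1" "T4 = T2" by simp_all
  have D: "D3 = D1" "D4 = D2" using D1 D2 D3 D4 T u by simp_all
  have s: "?M * (2 - a) = a - 1 - q"
    using P1 ac1 ac2 a0 a unfolding u p by algebra
  have a2: "a \<noteq> 2" using s q by auto
  have D2sq: "D2^2 = (a + 1) * (a - 2)^2"
    using S2 a unfolding u p det3_def by algebra
  have M: "?M = - a - 1"
  proof (cases "t = 0")
    case True
    then show ?thesis using a by simp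
  next
    case False
    then have "a + 1 \<noteq> 0" using a by simp
    with D2sq a2 have "D2 \<noteq> 0" by auto
    moreover have "D2 * (q - (2 * a + 1 - a^2)) = 0"
      using L1 L2 a unfolding D u p by algebra
    ultimately have "q = 2 * a + 1 - a^2" by simp
    then have "(2 - a) * (?M + a + 1) = 0" using s by algebra
    then have "?M + a + 1 = 0" using a2 by simp
    then show ?thesis by algebra
  qed
  have q': "q = 2 * a + 1 - a^2" using s M by algebra
  have "T2 = 0"
  proof (cases "t = 0")
    case True
    then show ?thesis using D2sq D2 a by simp
  next
    case False
    moreover have "a * t * T2 = 0" using F2 M a unfolding u p by algebra
    ultimately show ?thesis using a0 by simp
  qed
  moreover have "a * (T1 - t * (2 - a)) = a * T2" using F1 F2 q' unfolding u p by algebra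
  ultimately show ?thesis using a0 a2 q' T by simp
qed

text \<open>With \<open>w = 2 * a - \<mu>\<close> and \<open>P = u1 * u2\<close> the hypothesis
  \<open>S\<close> reads \<open>P * w = a * \<mu>\<close>. The edge equations and \<open>A1\<close>
  each express \<open>q\<close>; comparing the two leaves
  \<open>(w - 2) * (a^2 * w - a^3 - w^2) = 0\<close>, whose second factor is the curve of
  \<mu>.\<close>

lemma p_one_pairs:
  assumes a0: "a \<noteq> 0" and p: "p = 1" and q: "q \<noteq> 1"
    and u: "u4 = u1" "u3 = u2" and ne: "u1 \<noteq> u2" and nz: "u1 * u2 \<noteq> 0"
    and S: "(u1 + u2) * (u1 * u2 + a) = 2 * a * (u1 * u2)"
  defines "\<mu> \<equiv> u1 + u2"
  shows "\<mu>^2 + (a^2 - 4 * a) * \<mu> + 4 * a^2 - a^3 = 0"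
    "a * (u1 * u2) = 2 * \<mu> + a^2 - 4 * a"
    "a * q = (a^3 - 3 * a^2 + 4) * \<mu> + 4 * a^3 - a^4 - 7 * a"
    "a * T2 = t * \<mu>" "T4 = T2"
    "a * T1 = t * ((1 + a) * \<mu> - 2 * a + \<mu> * u1 - \<mu>^2)"
    "a * T3 = t * ((1 + a) * \<mu> - 2 * a - \<mu> * u1)"
proof -
  let ?M = "t * (b - t)"
  define w where "w = 2 * a - \<mu>"
  define P where "P = u1 * u2"
  have mu: "\<mu> = 2 * a - w" by (simp add: w_def)
  have u2: "u2 = \<mu> - u1" by (simp add: \<mu>_def)
  have Pw: "P * w = a * \<mu>" using S unfolding P_def w_def \<mu>_def by algebra
  have P0: "P \<noteq> 0" using nz by (simp add: P_def)
  have mu0: "\<mu> \<noteq> 0"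
  proof
    assume "\<mu> = 0"
    with Pw P0 have "w = 0" by simp
    with mu \<open>\<mu> = 0\<close> a0 show False by simp
  qed
  then have w0: "w \<noteq> 0" using Pw a0 by auto
  have u1: "u1^2 = \<mu> * u1 - P" unfolding P_def u2 by algebra
  have u2sq: "u2^2 = \<mu> * (\<mu> - u1) - P" unfolding P_def u2 by algebra
  have c12: "a * (c1 + c2) = 2 * ?M + q + 1 - w * (u1 - a)"
    using ac1 ac2 unfolding u p w_def \<mu>_def by algebra
  have c23: "a * (c2 + c3) = 2 * ?M + q + 1 - w * (u2 - a)"
    using ac2 ac3 unfolding u p w_def \<mu>_def by algebra
  have "(c1 + c2) * (u1 + 2) = 2 * (t * b) + 2 * t^2 - 2 - \<mu>"
    using P1 P1' unfolding u \<mu>_def by algebra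
  then have B1: "(2 * ?M + q + 1 - w * (u1 - a)) * (u1 + 2) = a * (2 * ?M + 4 * a + 2 - \<mu>)"
    using c12 a by algebra
  have "(c2 + c3) * (u2 + 2) = 2 * (t * b) + 2 * t^2 - 2 - \<mu>"
    using P2 P2' unfolding u \<mu>_def by algebra
  then have B2: "(2 * ?M + q + 1 - w * (u2 - a)) * (u2 + 2) = a * (2 * ?M + 4 * a + 2 - \<mu>)"
    using c23 a by algebra
  \<comment> \<open>\<open>B1\<close> and \<open>B2\<close> are one equation read at
    \<open>u1\<close> and at \<open>u2\<close>; their difference is divisible by
    \<open>u1 - u2\<close>.\<close>
  have "(u1 - u2) * (2 * ?M + q + 1 - w * (\<mu> + 2 - a)) = 0"
    using B1 B2 unfolding \<mu>_def by algebra
  then have "2 * ?M + q + 1 - w * (\<mu> + 2 - a) = 0" using ne by simp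
  then have h1: "2 * ?M = w * (\<mu> + 2 - a) - q - 1" by algebra
  have "w * (P + 2 * \<mu> + 4) = a * (2 * ?M + 4 * a + 2 - \<mu>)"
    using B1 h1 unfolding P_def \<mu>_def by algebra
  then have E1: "a * q = a * (4 * a + 1 - \<mu>) + a * w * (\<mu> + 2 - a) - w * (P + 2 * \<mu> + 4)"
    using h1 by algebra
  have "2 * (u2 * (u1^2 - a * u1 + a)) = (u1 - u2) * (P - a)"
    using S unfolding P_def by algebra
  moreover have "P * (q - 1) = - (u2 * (u1^2 - a * u1 + a)) * (u1 - u2)"
    using A1 unfolding u p P_def by algebra
  ultimately have "2 * P * (q - 1) = - ((u1 - u2)^2 * (P - a))" by algebra
  moreover have "(u1 - u2)^2 = \<mu>^2 - 4 * P" unfolding \<mu>_def P_def by algebra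
  ultimately have E2: "2 * P * (q - 1) = - ((\<mu>^2 - 4 * P) * (P - a))" by simp
  \<comment> \<open>Multiplying \<open>E2\<close> by \<open>w^2\<close> turns every
    \<open>P * w\<close> into \<open>a * \<mu>\<close>, so that \<open>P\<close> disappears.\<close>
  have "2 * w * (P * w) * (q - 1) + (\<mu>^2 * w - 4 * (P * w)) * (P * w - a * w)
      = w^2 * (2 * P * (q - 1) + (\<mu>^2 - 4 * P) * (P - a))" by algebra
  then have "2 * w * (a * \<mu>) * (q - 1) + (\<mu>^2 * w - 4 * (a * \<mu>)) * (a * \<mu> - a * w) = 0"
    unfolding E2 Pw by simp
  then have "2 * (a * \<mu>) * (w * (q - 1) + (\<mu> * w - 4 * a) * (a - w)) = 0"
    unfolding mu by algebra
  then have E3: "w * (q - 1) + (\<mu> * w - 4 * a) * (a - w) = 0"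
    using a0 mu0 by simp
  have "a * q = a * (4 * a + 1 - \<mu>) + a * w * (\<mu> + 2 - a) - a * \<mu> - w * (2 * \<mu> + 4)"
    using E1 Pw by algebra
  then have "w * (a * (4 * a + 1 - \<mu>) + a * w * (\<mu> + 2 - a) - a * \<mu> - w * (2 * \<mu> + 4)) - a * w
      + a * (\<mu> * w - 4 * a) * (a - w) = 0"
    using E3 by algebra
  then have "2 * ((w - 2) * (a^2 * w - a^3 - w^2)) = 0" unfolding mu by algebra
  then have "(w - 2) * (a^2 * w - a^3 - w^2) = 0" by simp
  then have curve: "a^2 * w - a^3 - w^2 = 0"
  \<comment> \<open>The factor \<open>w = 2\<close> yields no further curve: the Gram relation then
    makes the other factor vanish as well.\<close>
  proof (cases "w = 2")
    case True
    have q': "q = 2 * a - 3" using E3 True mu by algebra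
    have M: "?M = 1" using h1 q' True mu by algebra
    have P': "P = a * (a - 1)" using Pw True mu by algebra
    have tD: "a * t * D2 = a^3 - a^2 + 4"
      using F2 D2 M P' a mu True unfolding p P_def[symmetric] \<mu>_def by algebra
    have D2sq: "D2^2 = a * (a^2 - 3 * a + 4)"
      using S2 P' a mu True unfolding p P_def \<mu>_def det3_def by algebra
    have "4 * (a^3 - 2 * a^2 + 4) = 0" using tD D2sq a by algebra
    then show ?thesis unfolding True by algebra
  qed simp
  show cv: "\<mu>^2 + (a^2 - 4 * a) * \<mu> + 4 * a^2 - a^3 = 0"
    using curve unfolding mu by algebra
  have "w * (a * P - (2 * \<mu> + a^2 - 4 * a)) = 0"
    using Pw curve unfolding mu by algebra
  then have aP: "a * P = 2 * \<mu> + a^2 - 4 * a" using w0 by simp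
  then show "a * (u1 * u2) = 2 * \<mu> + a^2 - 4 * a" by (simp add: P_def)
  show aq: "a * q = (a^3 - 3 * a^2 + 4) * \<mu> + 4 * a^3 - a^4 - 7 * a"
    using E1 Pw cv unfolding w_def by algebra
  show T2: "a * T2 = t * \<mu>"
  \<comment> \<open>The equation is obtained only after multiplication by \<open>t\<close>. At
    \<open>t = 0\<close> the Gram relation gives \<open>D2 = 0\<close> instead, and there
    \<open>D2 = 2 * T2\<close>.\<close>
  proof (cases "t = 0")
    case True
    then have "a = - 1" using a by simp
    have "- P = 2 * \<mu> + 5" using aP \<open>a = -1\<close> by simp
    moreover have "\<mu>^2 + 5 * \<mu> + 5 = 0" using cv unfolding \<open>a = -1\<close> by algebra
    ultimately have "D2^2 = 0"
      using S2 True unfolding p P_def \<mu>_def det3_def by algebra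
    then show ?thesis using D2 True by simp
  next
    case False
    have "2 * a * (t * (a * T2 - t * \<mu>)) = 0"
      using F2 h1 aP aq cv a unfolding p P_def[symmetric] w_def by algebra
    with False a0 show ?thesis by simp
  qed
  have "a * T4 = a * T2" unfolding F2 F4 u p by simp
  with a0 show "T4 = T2" by simp
  show "a * T1 = t * ((1 + a) * \<mu> - 2 * a + \<mu> * u1 - \<mu>^2)"
  proof -
    have "a * (a * T1 - t * ((1 + a) * \<mu> - 2 * a + \<mu> * u1 - \<mu>^2)) = 0"
      using F1 F2 T2 aq aP cv u1 unfolding u p P_def[symmetric] by algebra
    with a0 show ?thesis by simp
  qed
  show "a * T3 = t * ((1 + a) * \<mu> - 2 * a - \<mu> * u1)"
  proof -
    have "a * T3 - a * T2 = t * (q - 1 + \<mu> * (\<mu> - u1) - 2 * P)"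
      unfolding F2 F3 u p P_def[symmetric] using u2sq by algebra
    moreover have "a * (q - 1 + \<mu> * (\<mu> - u1) - 2 * P) = a * (a * \<mu> - 2 * a - \<mu> * u1)"
      using aq aP cv by algebra
    then have "q - 1 + \<mu> * (\<mu> - u1) - 2 * P = a * \<mu> - 2 * a - \<mu> * u1"
      using a0 by simp
    ultimately have "a * T3 - t * \<mu> = t * (a * \<mu> - 2 * a - \<mu> * u1)"
      using T2 by simp
    then show ?thesis by (simp add: algebra_simps)
  qed
qed

text \<open>If both opposite pairs differed, all four values would be roots of the quadratic with
  sum and product of roots equal to \<open>a\<close>. This pins down \<open>a = 2\<close>, where the
  word traces and the Gram relation give different values for the same squared volume.\<close>

lemma pq_one:
  assumes a0: "a \<noteq> 0" and p: "p = 1" and q: "q = 1"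
  shows "u3 = u1 \<or> u4 = u2"
proof (rule ccontr)
  assume "\<not> ?thesis"
  then have ne: "u1 \<noteq> u3" "u2 \<noteq> u4" by auto
  have f: "u1^2 - a * u1 + a = 0" "u3^2 - a * u3 + a = 0" "u2^2 - a * u2 + a = 0"
    "u4^2 - a * u4 + a = 0"
    using A1 A2 A3 A4 ne p q by auto
  have "(u1 - u3) * (u1 + u3 - a) = 0" "(u2 - u4) * (u2 + u4 - a) = 0"
    using f by algebra+
  with ne have "u1 + u3 - a = 0" "u2 + u4 - a = 0" by simp_all
  then have S: "u3 = a - u1" "u4 = a - u2" by algebra+
  have "(u1 - u2) * (u1 - u4) = 0" using f S by algebra
  then have "u2 = u1 \<or> u4 = u1" by auto
  let ?N = "2 * (t * (b - t)) + 2"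
  have e: "?N * (u1 - a + 2) + a * (- 2 * (u1 - a)) = 2 * a^2"
    "?N * (u3 - a + 2) + a * (- 2 * (u3 - a)) = 2 * a^2"
  proof -
    have "(c1 + c2) * (u1 + 2) = 2 * (t * b) + 2 * t^2 - 2 - u2 - u4" using P1 P1' by algebra
    moreover have "a * (c1 + c2) = ?N + (u1 - a) * (u2 + u4 - 2 * a)" using ac1 ac2 p q by algebra
    ultimately show "?N * (u1 - a + 2) + a * (- 2 * (u1 - a)) = 2 * a^2"
      using a f(1) unfolding S by algebra
    have "(c3 + c4) * (u3 + 2) = 2 * (t * b) + 2 * t^2 - 2 - u2 - u4" using P3 P3' by algebra
    moreover have "a * (c3 + c4) = ?N + (u3 - a) * (u2 + u4 - 2 * a)" using ac3 ac4 p q by algebra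
    ultimately have "(?N + (u3 - a) * (u2 + u4 - 2 * a)) * (u3 + 2) = a * (2 * (t * b) + 2 * t^2 - 2 - u2 - u4)"
      by algebra
    moreover have "u2 + u4 = a" using S by simp
    ultimately have "(?N + (u3 - a) * (a - 2 * a)) * (u3 + 2) = a * (2 * (t * b) + 2 * t^2 - 2 - a)"
      by algebra
    then show "?N * (u3 - a + 2) + a * (- 2 * (u3 - a)) = 2 * a^2"
      using a f(2) by algebra
  qed
  have "(u1 - u3) * (?N - 2 * a) = 0" using e by algebra
  with ne have "?N - 2 * a = 0" by simp
  then have N: "?N = 2 * a" by algebra
  have "2 * a * (a - 2) = 0" using e N by algebra
  with a0 have a2: "a = 2" by simp
  have t2: "t^2 = 3" using a a2 by algebra
  have f1: "u1^2 = 2 * u1 - 2" using f(1) a2 by algebra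
  have M: "t * b = 4" using N a2 t2 by algebra
  show False
    using \<open>u2 = u1 \<or> u4 = u1\<close>
  proof
    assume "u2 = u1"
    then have u: "u2 = u1" "u3 = 2 - u1" "u4 = 2 - u1" using S a2 by simp_all
    have "t * T1 = 5" using F1 M a2 t2 f1 unfolding u q by algebra
    moreover have "t * D1 = 2 * (t * T1) - 5 * t^2 + (t^2)^2" using D1 unfolding u q by algebra
    ultimately have "t * D1 = 4" using t2 by simp
    then have "(t * D1)^2 = 16" by simp
    then have "3 * D1^2 = 16" using t2 by (simp add: power_mult_distrib)
    moreover have "4 * D1^2 = 16" using S1 t2 f1 unfolding u q det3_def by algebra
    ultimately show False by simp
  next
    assume "u4 = u1"
    then have u: "u2 = 2 - u1" "u3 = 2 - u1" "u4 = u1" using S a2 by auto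
    have "t * T2 = 5" using F2 M a2 t2 f1 unfolding u p by algebra
    moreover have "t * D2 = 2 * (t * T2) - 5 * t^2 + (t^2)^2" using D2 unfolding u p by algebra
    ultimately have "t * D2 = 4" using t2 by simp
    then have "(t * D2)^2 = 16" by simp
    then have "3 * D2^2 = 16" using t2 by (simp add: power_mult_distrib)
    moreover have "4 * D2^2 = 16" using S2 t2 f1 unfolding u p det3_def by algebra
    ultimately show False by simp
  qed
qed

text \<open>\<open>u1\<close> and \<open>u3\<close> satisfy the same edge equation, so their
  difference determines \<open>t * (b - t)\<close>. With the shift by \<open>2 - a\<close> the
  product \<open>g * g'\<close> is a square, which is why the component is parametrised by \<gamma>
  and \<open>z^2 / \<gamma>\<close>.\<close>

lemma pq_one_pairs:
  assumes a0: "a \<noteq> 0" and p: "p = 1" and q: "q = 1" and u4: "u4 = u2" and ne: "u1 \<noteq> u3"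
  defines "g \<equiv> u1 - a + 2" and "g' \<equiv> u3 - a + 2"
  shows "u2^2 - a * u2 + a = 0" "g * g' = u2^2" "g + g' = 2 * u2 - (a - 2) * u2^2"
    "a * T1 = a * t + t * u2 * g" "T2 = T1" "a * T3 = a * t + t * u2 * g'" "T4 = T3"
proof -
  let ?M = "t * (b - t)"
  have u: "u1 = g + a - 2" "u3 = g' + a - 2" by (simp_all add: g_def g'_def)
  show f: "u2^2 - a * u2 + a = 0" using A2 ne p q by auto
  have z0: "u2 \<noteq> 0" using f a0 by auto
  have v0: "u2 - a \<noteq> 0" using f a0 by (auto simp: power2_eq_square algebra_simps)
  have ac: "a * c1 = ?M + 1 + (u1 - a) * (u2 - a)" "a * c2 = ?M + 1 + (u1 - a) * (u2 - a)"
    "a * c3 = ?M + 1 + (u3 - a) * (u2 - a)" "a * c4 = ?M + 1 + (u3 - a) * (u2 - a)"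
    using ac1 ac2 ac3 ac4 unfolding u4 p q by (simp_all add: mult.commute)
  have e1: "(?M + 1 + (u1 - a) * (u2 - a)) * (u1 + 2) = a * (t * b + t^2 - 1 - u2)"
    using P1 ac unfolding u4 by algebra
  have e3: "(?M + 1 + (u3 - a) * (u2 - a)) * (u3 + 2) = a * (t * b + t^2 - 1 - u2)"
    using P3 ac unfolding u4 by algebra
  have e2: "(?M + 1 + (u1 - a) * (u2 - a)) * (u2 + 1) + (?M + 1 + (u3 - a) * (u2 - a)) = a * (t * b + t^2 - 1 - u1)"
    using P2 ac by algebra
  have "(u1 - u3) * (?M + 1 + (u2 - a) * (u1 + u3 - a + 2)) = 0"
    using e1 e3 by algebra
  with ne have "?M + 1 + (u2 - a) * (u1 + u3 - a + 2) = 0" by simp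
  then have M: "?M = - 1 - (u2 - a) * (g + g' + a - 2)" unfolding u by algebra
  have tb: "t * b = ?M + a + 1" using a by algebra
  have e1': "- (u2 - a) * g' * g - a * (u2 - a) * g' - a * (u2 - a) * g - a^2 * (u2 - a) = a * (?M + 2 * a + 1 - u2)"
    using e1 M tb a unfolding u by algebra
  have "(u2 - a) * (g * g' - u2^2) = 0"
    using e1' M f by algebra
  with v0 show gg: "g * g' = u2^2" by simp
  have "((a - 1) * (u2 - a) + a) * (g + g' - (2 * u2 - (a - 2) * u2^2)) = 0"
    using e2 M tb a f unfolding u by algebra
  \<comment> \<open>This factor and the quadratic of \<open>u2\<close> vanish together only for
    \<open>a = 0\<close>.\<close>
  moreover have "(a - 1) * (u2 - a) + a \<noteq> 0"
  proof
    assume h: "(a - 1) * (u2 - a) + a = 0"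
    have "a = 0" using h f by algebra
    with a0 show False by simp
  qed
  ultimately have "g + g' - (2 * u2 - (a - 2) * u2^2) = 0" by simp
  then show gs: "g + g' = 2 * u2 - (a - 2) * u2^2" by algebra
  have T1_F: "a * T1 = b - t + t * (1 + (g + a - 2) * u2)"
    using F1 unfolding u4 q u by simp
  show T1: "a * T1 = a * t + t * u2 * g"
  proof (cases "t = 0")
    case True
    then have am: "a = - 1" using a by simp
    have "D2 = 2 * T2" using D2 True by simp
    moreover have "4 * D2^2 = 0"
    proof -
      have "4 * D2^2 = - det3 (- 4) (2 * g - 4) 2 (2 * g - 4) (- 4) (2 * u2 + 2) 2 (2 * u2 + 2) (- 4)"
        using S2 True by (simp add: p u am algebra_simps)
      moreover have "u2^2 = 1 - u2" using f am by (simp add: algebra_simps)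
      moreover from this have "g^2 = (3 - u2) * g - (1 - u2)" using gg gs am by algebra
      ultimately show ?thesis unfolding det3_def by algebra
    qed
    moreover have "a * T2 = a * T1" unfolding F1 F2 u4 p q by (simp add: mult.commute)
    ultimately show ?thesis using True a0 by simp
  next
    case False
    have "t * (a * T1 - (a * t + t * u2 * g)) = 0"
      using T1_F M gs f a by algebra
    with False show ?thesis by simp
  qed
  have "a * T2 = a * T1" "a * T4 = a * T3" unfolding F1 F2 F3 F4 u4 p q by (simp_all add: mult.commute)
  with a0 show "T2 = T1" "T4 = T3" by simp_all
  have "a * T3 = a * T1 + t * u2 * (g' - g)"
    using T1_F F3 unfolding q u by algebra
  with T1 show "a * T3 = a * t + t * u2 * g'" by (simp add: algebra_simps)
qed

text \<open>The \<open>F\<close> equations lose their triple traces here and only say that four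
  expressions in pair traces agree. The second alternative collects the points of
  \<open>X_6_1\<close> and \<open>X_6_2\<close> with \<open>t^2 = 1\<close>.\<close>

lemma a_zero:
  assumes a0: "a = 0"
  shows "(u3 = u1 \<and> u4 = u2 \<and> q = p \<and> T2 = T1 \<and> T3 = T1 \<and> T4 = T1) \<or>
    (u1 = 0 \<and> u2 = 0 \<and> u3 = 0 \<and> u4 = 0 \<and> p = 1 \<and> q = 1 \<and>
      (T1 = 2 * t \<and> T2 = 0 \<and> T3 = 2 * t \<and> T4 = 0 \<or> T1 = 0 \<and> T2 = 2 * t \<and> T3 = 0 \<and> T4 = 2 * t))"
proof -
  have t2: "t^2 = 1" using a a0 by simp
  then have t0: "t \<noteq> 0" by auto
  have tt: "t * (t * z) = z" for z using t2 by (simp add: power2_eq_square flip: mult.assoc)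
  \<comment> \<open>Because \<open>t^2 = 1\<close>, passing to \<open>t * T1\<close> loses nothing
    and removes \<open>t\<close> from the equations.\<close>
  define X1 where "X1 = t * T1"
  define X2 where "X2 = t * T2"
  define X3 where "X3 = t * T3"
  define X4 where "X4 = t * T4"
  note X_defs = X1_def X2_def X3_def X4_def
  have T: "T1 = t * X1" "T2 = t * X2" "T3 = t * X3" "T4 = t * X4"
    by (simp_all add: X_defs tt)
  have e: "q + u1 * u4 = 1 - t * b" "p + u1 * u2 = 1 - t * b" "q + u2 * u3 = 1 - t * b" "p + u3 * u4 = 1 - t * b"
    subgoal using F1 t2 unfolding a0 by algebra
    subgoal using F2 t2 unfolding a0 by algebra
    subgoal using F3 t2 unfolding a0 by algebra
    subgoal using F4 t2 unfolding a0 by algebra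
    done
  have c: "c1 = X1 - u1 - u4 - (1 - t * b)" "c2 = X2 - u1 - u2 - (1 - t * b)"
    "c3 = X3 - u2 - u3 - (1 - t * b)" "c4 = X4 - u3 - u4 - (1 - t * b)"
    subgoal using c1 e(1) t2 unfolding X_defs by algebra
    subgoal using c2 e(2) t2 unfolding X_defs by algebra
    subgoal using c3 e(3) t2 unfolding X_defs by algebra
    subgoal using c4 e(4) t2 unfolding X_defs by algebra
    done
  have E1: "u1 * (X1 - X2) = (1 - u1) * (u2 - u4)" using P1 P1' unfolding c by algebra
  have E2: "u2 * (X2 - X3) = (1 - u2) * (u3 - u1)" using P2 P2' unfolding c by algebra
  have E3: "u3 * (X3 - X4) = (1 - u3) * (u4 - u2)" using P3 P3' unfolding c by algebra
  have E4: "u4 * (X4 - X1) = (1 - u4) * (u1 - u3)" using P4 P4' unfolding c by algebra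
  have B1: "X1 + X2 - 2 * u1 - u2 - u4 - 2 * (1 - t * b) + (X2 - u1 - u2 - (1 - t * b)) * u1 = t * b - u2"
    using P1' t2 unfolding c by algebra
  have B2: "X2 + X3 - 2 * u2 - u1 - u3 - 2 * (1 - t * b) + (X3 - u2 - u3 - (1 - t * b)) * u2 = t * b - u3"
    using P2' t2 unfolding c by algebra
  have B3: "X3 + X4 - 2 * u3 - u2 - u4 - 2 * (1 - t * b) + (X4 - u3 - u4 - (1 - t * b)) * u3 = t * b - u4"
    using P3' t2 unfolding c by algebra
  have C13': "(X1 - X3 - u1 - u4 + u2 + u3) * (p - 1) = 0" using C13 unfolding c by algebra
  have tD: "t * D1 = 2 * X1 - u1 - u4 - q - 1" "t * D2 = 2 * X2 - u1 - u2 - p - 1"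
    "t * D3 = 2 * X3 - u2 - u3 - q - 1" "t * D4 = 2 * X4 - u3 - u4 - p - 1"
    subgoal using D1 t2 unfolding X_defs by algebra
    subgoal using D2 t2 unfolding X_defs by algebra
    subgoal using D3 t2 unfolding X_defs by algebra
    subgoal using D4 t2 unfolding X_defs by algebra
    done
  have Dsq: "D1^2 = (2 * X1 - u1 - u4 - q - 1)^2" "D2^2 = (2 * X2 - u1 - u2 - p - 1)^2"
    unfolding tD[symmetric] by (simp_all add: power_mult_distrib t2)
  have S1': "4 * (2 * X1 - u1 - u4 - q - 1)^2 = - det3 (- 3) (2*u1 + 1) (2*u4 + 1) (2*u1 + 1) (- 3) (2*q - 1) (2*u4 + 1) (2*q - 1) (- 3)"
    using S1 unfolding Dsq t2 by (simp add: add.commute)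
  have S2': "4 * (2 * X2 - u1 - u2 - p - 1)^2 = - det3 (- 3) (2*u1 + 1) (2*p - 1) (2*u1 + 1) (- 3) (2*u2 + 1) (2*p - 1) (2*u2 + 1) (- 3)"
    using S2 unfolding Dsq t2 by (simp add: add.commute)
  have all_eq: "T2 = T1 \<and> T3 = T1 \<and> T4 = T1" if "X2 = X1" "X3 = X1" "X4 = X1"
    using that by (simp add: T)
  consider "u3 = u1" "u4 = u2" | "u3 = u1" "u4 \<noteq> u2" | "u3 \<noteq> u1" by blast
  then show ?thesis
  proof cases
    case 1
    have pq: "q = p" using e(1,2) unfolding 1 by algebra
    consider (a)  "u1 \<noteq> 0" "u2 \<noteq> 0" | (b) "u1 = 0" "u2 \<noteq> 0" | (c) "u1 \<noteq> 0" "u2 = 0" | (d) "u1 = 0" "u2 = 0" by blast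
    then show ?thesis
    proof cases
      case a
      then have "X2 = X1" "X3 = X1" "X4 = X1" using E1 E2 E3 1 by auto
      with all_eq 1 pq show ?thesis by blast
    next
      case b
      then have X: "X3 = X2" "X4 = X1" using E2 E4 1 by auto
      show ?thesis
      proof (cases "X1 = X2")
        case True
        have "X2 = X1" "X3 = X1" "X4 = X1" using X True by simp_all
        from all_eq[OF this] 1 pq show ?thesis by blast
      next
        case False
        then have p: "p = 1" using C13' X 1 by auto
        have tb: "t * b = 0" using e(2) b p by simp
        have "(X2 - u2 - 1) * (u2 + 2) = 0" "(X1 - u2 - 1) * (u2 + 2) = 0"
          using P2 P4' tb t2 unfolding c 1 b X by algebra+
        then have "(X1 - X2) * (u2 + 2) = 0" by algebra
        then have "u2 + 2 = 0" using False by simp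
        then have u2: "u2 = - 2" by algebra
        have s: "X1 + X2 = 0" using B1 unfolding 1 b u2 tb by simp
        \<comment> \<open>At \<open>u1 = 0\<close>, \<open>u2 = -2\<close>, \<open>p = 1\<close> the
          Gram determinant is zero, and the volume is \<open>2 * X2\<close> up to the factor
          \<open>t\<close>.\<close>
        have "X2^2 = 0" using S2' unfolding b u2 p det3_def by simp
        then have "X1 = X2" using s by simp
        with False show ?thesis by simp
      qed
    next
      case c': c
      then have X: "X2 = X1" "X4 = X3" using E1 E3 unfolding 1 by simp_all
      show ?thesis
      proof (cases "X1 = X3")
        case True
        have "X2 = X1" "X3 = X1" "X4 = X1" using X True by simp_all
        from all_eq[OF this] 1 pq show ?thesis by blast
      next
        case False
        then have p: "p = 1" using C13' X 1 by auto
        have tb: "t * b = 0" using e(2) c' p by simp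
        have "(X1 - u1 - 1) * (u1 + 2) = 0" "(X3 - u1 - 1) * (u1 + 2) = 0"
          using P1 P3 tb t2 unfolding c 1 c' X by algebra+
        then have "(X1 - X3) * (u1 + 2) = 0" by algebra
        then have "u1 + 2 = 0" using False by simp
        then have u1: "u1 = - 2" by algebra
        have s: "X1 + X3 = 0" using B2 unfolding 1 c' u1 tb X by simp
        have "X1^2 = 0" using S2' unfolding c' u1 p X det3_def by simp
        then have "X1 = X3" using s by simp
        with False show ?thesis by simp
      qed
    next
      case d
      have tb: "t * b = 1 - p" using e(2) d by simp
      have s: "X1 + X2 = 1 + p" "X2 + X3 = 1 + p" "X3 + X4 = 1 + p"
        using B1 B2 B3 unfolding 1 d tb by algebra+
      then have X: "X3 = X1" "X4 = X2" by algebra+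
      show ?thesis
      proof (cases "p = 1")
        case True
        have "(2 * X1 - 2)^2 = 2^2" using S1' unfolding 1 d pq True det3_def by simp
        then have "2 * X1 - 2 = 2 \<or> 2 * X1 - 2 = - 2" by (simp only: power2_eq_iff)
        \<comment> \<open>\<open>X1 = 2\<close> leads to \<open>X_6_1\<close> and
          \<open>X1 = 0\<close> to \<open>X_6_2\<close>; at \<open>t^2 = 1\<close> the two families
          have all pair traces in common.\<close>
        then have "X1 = 2 \<or> X1 = 0" by auto
        moreover have "X2 = 2 - X1" using s(1) True by algebra
        ultimately show ?thesis using 1 d True pq X by (auto simp: T)
      next
        case False
        have D: "D3 = D1" "D4 = D2" using D1 D2 D3 D4 T X 1 d by simp_all
        have "t * D2 = - (t * D1)" using tD(1,2) s(1) unfolding d pq 1 by algebra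
        then have "t * (D2 + D1) = 0" by algebra
        then have "D2 + D1 = 0" using t0 by simp
        then have D2': "D2 = - D1" by algebra
        have "2 * D1 * (p - 1) = 0" using L1 unfolding D D2' 1 d t2 by algebra
        with False have "D1 = 0" by simp
        then have "X1 = X2" using tD(1,2) unfolding D2' 1 d pq by algebra
        then have "X2 = X1" "X3 = X1" "X4 = X1" using X by simp_all
        from all_eq[OF this] 1 pq show ?thesis by blast
      qed
    qed
  next
    case 2
    have "u1 * (u2 - u4) = 0" using e(1,3) e(2,4) 2 by algebra
    with 2 have "u1 = 0" by simp
    with E1 2 show ?thesis by simp
  next
    case 3
    have h: "(u1 - u3) * (u2 + u4) = 0" "(u1 + u3) * (u4 - u2) = 0" using e by algebra+
    then have "u2 + u4 = 0" using 3 by simp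
    then have u4: "u4 = - u2" by algebra
    have u20: "u2 \<noteq> 0" using E2 3 by auto
    have "(u1 + u3) * u2 = 0" using h(2) u4 by algebra
    then have "u1 + u3 = 0" using u20 by simp
    then have u3: "u3 = - u1" by algebra
    have u10: "u1 \<noteq> 0" using 3 u3 by auto
    have "4 * (u2^2 - u1^2) = 0"
    proof -
      \<comment> \<open>The differences of consecutive \<open>X\<close> sum to zero around the
        cycle.\<close>
      have "u2 * (u1 * (X1 - X2)) + u1 * (u2 * (X2 - X3)) - u2 * (u3 * (X3 - X4)) - u1 * (u4 * (X4 - X1)) = 0"
        unfolding u3 u4 by algebra
      then show ?thesis unfolding E1 E2 E3 E4 unfolding u3 u4 by algebra
    qed
    then have "u2^2 = u1^2" by simp
    then have "u2 = u1 \<or> u2 = - u1" by (simp only: power2_eq_iff)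
    then show ?thesis
    proof
      assume u2: "u2 = u1"
      have "u1 * (X1 - X2 - 2 * (1 - u1)) = 0" "u1 * (X2 - X3 + 2 * (1 - u1)) = 0"
        "u1 * (X4 - X1 + 2 * (1 + u1)) = 0"
        using E1 E2 E4 unfolding u3 u4 u2 by algebra+
      then have "X1 - X2 - 2 * (1 - u1) = 0" "X2 - X3 + 2 * (1 - u1) = 0" "X4 - X1 + 2 * (1 + u1) = 0"
        using u10 by simp_all
      then have X: "X1 = X2 + 2 - 2 * u1" "X3 = X2 + 2 - 2 * u1" "X4 = X2 - 4 * u1" by algebra+
      define e where "e = 1 - t * b"
      have b1: "X2 * (2 + u1) = - 1 + 3 * u1 + e + 2 * u1^2 + e * u1"
        using B1 unfolding e_def u3 u4 u2 X by algebra
      have b3: "X2 * (2 - u1) = - 1 + 5 * u1 + e - 2 * u1^2 - e * u1"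
        using B3 unfolding e_def u3 u4 u2 X by algebra
      have "2 * u1 * (X2 + 1 - 2 * u1 - e) = 0" using b1 b3 by algebra
      then have "X2 + 1 - 2 * u1 - e = 0" using u10 by simp
      then have X2: "X2 = 2 * u1 + e - 1" by algebra
      have e1: "e = 1" using b1 b3 unfolding X2 by algebra
      have p: "p = 1 - u1^2" using e(2) e1 unfolding e_def u2 by algebra
      have "16 * u1^2 = 0" using S2' unfolding X2 e1 u2 p det3_def by algebra
      with u10 show ?thesis by simp
    next
      assume u2: "u2 = - u1"
      have "u1 * (X1 - X2 + 2 * (1 - u1)) = 0" "u1 * (X2 - X3 - 2 * (1 + u1)) = 0"
        "u1 * (X4 - X1 - 2 * (1 - u1)) = 0"
        using E1 E2 E4 unfolding u3 u4 u2 by algebra+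
      then have "X1 - X2 + 2 * (1 - u1) = 0" "X2 - X3 - 2 * (1 + u1) = 0" "X4 - X1 - 2 * (1 - u1) = 0"
        using u10 by simp_all
      then have X: "X2 = X1 + 2 - 2 * u1" "X3 = X1 - 4 * u1" by algebra+
      define e where "e = 1 - t * b"
      have b1: "X1 * (2 + u1) = - 1 + 3 * u1 + e + 2 * u1^2 + e * u1"
        using B1 unfolding e_def u3 u4 u2 X by algebra
      have b2: "X1 * (2 - u1) = - 1 + 5 * u1 + e - 2 * u1^2 - e * u1"
        using B2 unfolding e_def u3 u4 u2 X by algebra
      have "2 * u1 * (X1 + 1 - 2 * u1 - e) = 0" using b1 b2 by algebra
      then have "X1 + 1 - 2 * u1 - e = 0" using u10 by simp
      then have X1: "X1 = 2 * u1 + e - 1" by algebra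
      have e1: "e = 1" using b1 b2 unfolding X1 by algebra
      have q: "q = 1 - u1^2" using e(1) e1 unfolding e_def u4 u2 by algebra
      have "16 * u1^2 = 0" using S1' unfolding X1 e1 u4 u2 q det3_def by algebra
      with u10 show ?thesis by simp
    qed
  qed
qed

end

section \<open>Irreducible representations solve the trace equations\<close>

lemma m2_square: "(X::m2) ** X = mat (trace X) ** X - mat (det X)"
  by (simp add: m2_simps det_2 algebra_simps)

definition knot_quad :: "m2 \<Rightarrow> m2 \<Rightarrow> m2 \<Rightarrow> m2 \<Rightarrow> bool" where
  "knot_quad A B C E \<longleftrightarrow> det A = 1 \<and> det B = 1 \<and> det C = 1 \<and> det E = 1 \<and>
     crossing E A B = crossing A B C \<and> crossing A B C = crossing B C E \<and> crossing B C E = crossing C E A"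

definition common_eigenvector :: "m2 set \<Rightarrow> bool" where
  "common_eigenvector S \<longleftrightarrow> (\<exists>v. v \<noteq> 0 \<and> (\<forall>A\<in>S. \<exists>c. A *v v = c *s v))"

lemma knot_quad_rotate: "knot_quad A B C E \<Longrightarrow> knot_quad B C E A"
  by (simp add: knot_quad_def)

lemma trace_conjugate:
  assumes "P' ** (P::m2) = mat 1"
  shows "trace (P ** (Z ** P')) = trace Z"
  using trace_mul_sym[of P "Z ** P'"] assms by (metis matrix_mul_assoc matrix_mul_rid)

text \<open>Multiplying both words on the right by the inverse of \<open>L ** X\<close> shows that
  \<open>R\<close> and \<open>Z\<close> are conjugate. This is the source of the common trace of the
  generators.\<close>

lemma trace_crossing_neighbours:
  assumes "det X = 1" "det L = 1" and eq: "crossing L X R = crossing Z L X"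
  shows "trace R = trace Z"
proof -
  have X: "X ** adj2 X = mat 1" "adj2 X ** X = mat 1" and L: "L ** adj2 L = mat 1" "adj2 L ** L = mat 1"
    using assms by (simp_all add: adj2_right adj2_left)
  let ?P = "L ** X ** adj2 L" and ?P' = "L ** adj2 X ** adj2 L"
  have "?P' ** ?P = L ** (adj2 X ** ((adj2 L ** L) ** X)) ** adj2 L"
    by (simp only: matrix_mul_assoc)
  also have "\<dots> = mat 1" unfolding X L by (simp only: matrix_mul_lid matrix_mul_rid X L)
  finally have P: "?P' ** ?P = mat 1" .
  have "X ** (R ** adj2 X) = crossing L X R ** adj2 X ** adj2 L"
  proof -
    have "crossing L X R ** adj2 X ** adj2 L = X ** R ** adj2 X ** (L ** (X ** adj2 X) ** adj2 L)"
      unfolding crossing_def by (simp only: matrix_mul_assoc)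
    also have "\<dots> = X ** (R ** adj2 X)"
      by (simp only: X L matrix_mul_rid) (simp only: matrix_mul_assoc)
    finally show ?thesis by simp
  qed
  also have "\<dots> = ?P ** (Z ** ?P')"
    unfolding eq by (simp only: crossing_def matrix_mul_assoc)
  finally show ?thesis
    using trace_conjugate[OF P, of Z] trace_conjugate[OF X(2), of R] by simp
qed

lemma singular_kernel:
  assumes "det (M::m2) = 0"
  shows "\<exists>v. v \<noteq> 0 \<and> M *v v = 0"
proof -
  have "\<not> invertible M" using assms invertible_det_nz by blast
  then show ?thesis
    using matrix_left_invertible_ker[of M] invertible_left_inverse[of M] by auto
qed

lemma eigenvector_exists:
  assumes "det (A::m2) = 1"
  shows "\<exists>v c. v \<noteq> 0 \<and> A *v v = c *s v"
proof -
  define c where "c = (trace A + csqrt ((trace A)^2 - 4)) / 2"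
  have "2 * c - trace A = csqrt ((trace A)^2 - 4)" by (simp add: c_def field_simps)
  then have "(2 * c - trace A)^2 = (trace A)^2 - 4" by simp
  then have "c^2 - trace A * c + 1 = 0" by algebra
  moreover have "det (A - mat c) = det A - c * trace A + c^2"
    by (simp add: det_2 m2_trace m2_mat_nth power2_eq_square algebra_simps)
  ultimately have "det (A - mat c) = 0" using assms by (simp add: algebra_simps)
  then obtain v where "v \<noteq> 0" "(A - mat c) *v v = 0" using singular_kernel by blast
  then have "A *v v = mat c *v v" by (simp add: matrix_vector_mult_diff_rdistrib)
  also have "mat c *v v = c *s v"
    by (simp add: vec_eq_iff forall_2 matrix_vector_mult_def sum_2 mat_def)
  finally show ?thesis using \<open>v \<noteq> 0\<close> by blast
qed

lemma m2_vector: "(M::m2) *v v = vector [M$1$1 * v$1 + M$1$2 * v$2, M$2$1 * v$1 + M$2$2 * v$2]"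
  by (simp add: vec_eq_iff forall_2 matrix_vector_mult_def sum_2)

text \<open>The image of a nilpotent \<open>N\<close> is invariant under every \<open>A\<close> that is orthogonal to \<open>N\<close> for the
  trace form, since \<open>N A N = tr(N A) N - det(N) adj(A) = 0\<close>.\<close>

lemma nilpotent_orthogonal:
  assumes "trace N = 0" "det N = 0" "N \<noteq> 0" and orth: "\<And>A. A \<in> S \<Longrightarrow> trace (N ** A) = 0"
  shows "common_eigenvector S"
proof -
  have N22: "N$2$2 = - N$1$1" using assms(1) unfolding m2_trace by algebra
  have N11: "N$1$1 * N$1$1 = - (N$1$2 * N$2$1)" using assms(2) unfolding det_2 N22 by algebra
  have row: "N$1$2 \<noteq> 0 \<or> N$2$1 \<noteq> 0"
    using N11 N22 assms(3) by (auto simp: m2_eq_iff)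
  \<comment> \<open>A nonzero column of \<open>N\<close>, which therefore spans its image.\<close>
  define v :: "complex^2" where "v = (if N$1$2 \<noteq> 0 then vector [N$1$2, - N$1$1] else vector [N$1$1, N$2$1])"
  have v0: "v \<noteq> 0" using row by (auto simp: v_def vec_eq_iff forall_2)
  have "\<exists>c. A *v v = c *s v" if "A \<in> S" for A
  proof -
    have o: "N$1$1 * (A$1$1 - A$2$2) + N$1$2 * A$2$1 + N$2$1 * A$1$2 = 0"
      using orth[OF that] by (simp add: m2_trace m2_mult_nth N22 algebra_simps)
    show ?thesis
    proof (cases "N$1$2 = 0")
      case False
      define c where "c = (A$1$1 * N$1$2 - A$1$2 * N$1$1) / N$1$2"
      have c: "c * N$1$2 = A$1$1 * N$1$2 - A$1$2 * N$1$1" using False by (simp add: c_def)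
      have "N$1$2 * (A$2$1 * N$1$2 - A$2$2 * N$1$1 + c * N$1$1) = 0"
      proof -
        have "N$1$2 * (A$2$1 * N$1$2 - A$2$2 * N$1$1 + c * N$1$1)
          = N$1$2 * (A$2$1 * N$1$2 - A$2$2 * N$1$1) + (c * N$1$2) * N$1$1" by (simp add: algebra_simps)
        also have "\<dots> = N$1$2 * (A$2$1 * N$1$2 - A$2$2 * N$1$1) + A$1$1 * N$1$2 * N$1$1 - A$1$2 * (N$1$1 * N$1$1)"
          unfolding c by (simp add: algebra_simps)
        also have "\<dots> = N$1$2 * (N$1$1 * (A$1$1 - A$2$2) + N$1$2 * A$2$1 + N$2$1 * A$1$2)"
          unfolding N11 by (simp add: algebra_simps)
        finally show ?thesis unfolding o by simp
      qed
      then have "A$2$1 * N$1$2 - A$2$2 * N$1$1 + c * N$1$1 = 0" using False by simp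
      then have "A$2$1 * N$1$2 - A$2$2 * N$1$1 = - (c * N$1$1)" by algebra
      with c False show ?thesis
        by (intro exI[of _ c]) (simp add: v_def m2_vector vec_eq_iff forall_2)
    next
      case True
      then have N11: "N$1$1 = 0" "N$2$1 \<noteq> 0" using N11 row by auto
      then have "A$1$2 = 0" using o True by simp
      then show ?thesis using N11 True
        by (intro exI[of _ "A$2$2"]) (simp add: v_def m2_vector vec_eq_iff forall_2)
    qed
  qed
  with v0 show ?thesis unfolding common_eigenvector_def by blast
qed

lemma trace_crossing_1:
  assumes "det X = 1" "trace L = t" "trace X = t" "trace R = t"
  shows "trace (crossing L X R) = t * crossing_coeff L X R - t^3 + t * (trace (L ** X) + trace (X ** R))
     - trace (L ** X ** R)"
proof -
  have "trace (crossing L X R) = crossing_coeff L X R * t - trace (adj2 L ** X ** adj2 R)"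
    using trace_crossing[OF assms(1), of L R "mat 1"] assms by simp
  moreover have "trace (adj2 L ** X ** adj2 R) = trace L * trace X * trace R - trace L * trace (X ** R)
      - trace R * trace (L ** X) + trace (L ** X ** R)"
    unfolding m2_simps by algebra
  ultimately show ?thesis unfolding assms by (simp add: power3_eq_cube algebra_simps)
qed

text \<open>The word ends in \<open>X\<close>, so multiplying by \<open>X\<close> creates
  \<open>X ** X\<close>, which Cayley-Hamilton reduces. Applied to the four equal words, this gives
  the trace of their common value against every generator.\<close>

lemma trace_crossing_self:
  assumes "det X = 1" "trace X = t"
  shows "trace (crossing L X R ** X) = t * trace (crossing L X R) - crossing_coeff L X R"
proof -
  have "trace (crossing L X R ** X) = trace (X ** (R ** adj2 X ** L) ** (X ** X))"
    by (simp add: crossing_def matrix_mul_assoc)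
  also have "X ** X = mat t ** X - mat 1"
    using m2_square[of X] assms by simp
  also have "trace (X ** (R ** adj2 X ** L) ** (mat t ** X - mat 1)) = t * trace (crossing L X R) - crossing_coeff L X R"
    by (simp add: crossing_def crossing_coeff_def m2_simps algebra_simps)
  finally show ?thesis .
qed

lemma trace_crossing_right:
  assumes "det X = 1" "det R = 1" "trace L = t" "trace X = t"
  shows "trace (crossing L X R ** R) = crossing_coeff L X R * trace (X ** R) - (t^2 - trace (L ** X))"
proof -
  have "adj2 L ** X ** adj2 R ** R = adj2 L ** X"
    using adj2_left[of R] assms by (simp flip: matrix_mul_assoc)
  moreover have "trace (adj2 L ** X) = trace L * trace X - trace (L ** X)"
    unfolding m2_simps by algebra
  ultimately show ?thesis
    using trace_crossing[OF assms(1), of L R R] assms by (simp add: power2_eq_square)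
qed

lemma trace_crossing_left:
  assumes "det X = 1" "det L = 1" "trace R = t" "trace X = t"
  shows "trace (crossing L X R ** L) = crossing_coeff L X R * trace (L ** X) - (t^2 - trace (X ** R))"
proof -
  have "trace (adj2 L ** X ** adj2 R ** L) = trace (L ** adj2 L ** X ** adj2 R)"
    using trace_mul_sym[of "adj2 L ** X ** adj2 R" L] by (simp add: matrix_mul_assoc)
  also have "L ** adj2 L ** X ** adj2 R = X ** adj2 R"
    using adj2_right[of L] assms by simp
  also have "trace (X ** adj2 R) = trace X * trace R - trace (X ** R)"
    unfolding m2_simps by algebra
  finally show ?thesis
    using trace_crossing[OF assms(1), of L R L] assms trace_mul_sym[of X L] by (simp add: power2_eq_square)
qed

lemma trace_crossing_opposite:
  assumes "det X = 1" "trace L = t" "trace X = t" "trace R = t"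
  shows "trace (crossing L X R ** Z) = crossing_coeff L X R * trace (X ** Z)
    - (t^2 * trace (X ** Z) - t * trace (X ** R ** Z) - t * trace (L ** X ** Z) + trace (L ** X ** R ** Z))"
proof -
  have "trace (adj2 L ** X ** adj2 R ** Z) = trace L * trace R * trace (X ** Z) - trace L * trace (X ** R ** Z)
      - trace R * trace (L ** X ** Z) + trace (L ** X ** R ** Z)"
    unfolding m2_simps by algebra
  then show ?thesis
    unfolding trace_crossing[OF assms(1)] assms by (simp add: power2_eq_square)
qed

lemma trace_sym: "trace ((A::m2) ** B) = trace (B ** A)"
  by (rule trace_mul_sym)

lemma trace_adj2_mult: "trace (adj2 A ** X) = trace A * trace X - trace (A ** X)"
  unfolding m2_simps by algebra

text \<open>\<open>A - B\<close> has trace 0 and determinant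
  \<open>2 - t^2 + trace (A ** B) = 0\<close>. Were it nonzero, it would be a nilpotent orthogonal
  to \<open>S\<close>.\<close>

lemma equal_of_isotropic:
  assumes "det (A::m2) = 1" "det B = 1" "trace A = t" "trace B = t" "trace (A ** B) = t^2 - 2"
    and "\<And>X. X \<in> S \<Longrightarrow> trace (A ** X) = trace (B ** X)"
    and "\<not> common_eigenvector S"
  shows "A = B"
proof -
  have "det (A - B) = det A + det B - trace A * trace B + trace (A ** B)"
    unfolding det_2 m2_trace m2_mult_nth vector_minus_component by algebra
  then have "det (A - B) = 0" using assms by (simp add: power2_eq_square)
  moreover have "trace (A - B) = 0" using assms by (simp add: trace_sub)
  moreover have "trace ((A - B) ** X) = 0" if "X \<in> S" for X
    using assms(6)[OF that] by (simp add: m2_trace m2_mult_nth algebra_simps)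
  ultimately have "A - B = 0" using nilpotent_orthogonal[of "A - B" S] assms(7) by blast
  then show ?thesis by simp
qed

lemma inverse_of_isotropic:
  assumes "det (A::m2) = 1" "det B = 1" "trace A = t" "trace B = t" "trace (A ** B) = 2"
    and "\<And>X. X \<in> S \<Longrightarrow> trace (A ** X) + trace (B ** X) = t^2" "\<And>X. X \<in> S \<Longrightarrow> trace X = t"
    and "\<not> common_eigenvector S"
  shows "B = adj2 A"
proof -
  have "adj2 A = B"
  proof (rule equal_of_isotropic[where S = S])
    show "trace (adj2 A ** B) = t^2 - 2"
      using assms(3-5) by (simp add: trace_adj2_mult power2_eq_square)
    show "trace (adj2 A ** X) = trace (B ** X)" if "X \<in> S" for X
    proof -
      have "trace (B ** X) = t^2 - trace (A ** X)" using assms(6)[OF that] by algebra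
      then show ?thesis using assms(3,7) that by (simp add: trace_adj2_mult power2_eq_square)
    qed
  qed (use assms in simp_all)
  then show ?thesis by simp
qed

text \<open>The equality of words collapses to \<open>adj2 C = C\<close>, so
  \<open>C ** C = mat 1\<close> has trace 2, whereas \<open>t^2 = 2\<close> gives it trace
  0.\<close>

lemma no_inverse_pairs:
  assumes "det (A::m2) = 1" "det C = 1" "trace C = t" "t^2 = 2"
    and eq: "crossing (adj2 C) A (adj2 A) = crossing A (adj2 A) C"
  shows False
proof -
  have A: "A ** adj2 A = mat 1" "adj2 A ** A = mat 1"
    using assms by (simp_all add: adj2_right adj2_left)
  have "crossing (adj2 C) A (adj2 A) = (A ** adj2 A) ** adj2 A ** adj2 C ** A"
    unfolding crossing_def by (simp only: matrix_mul_assoc)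
  moreover have "crossing A (adj2 A) C = adj2 A ** C ** A ** (A ** adj2 A)"
    unfolding crossing_def by (simp only: matrix_mul_assoc adj2_adj2)
  ultimately have "adj2 A ** adj2 C ** A = adj2 A ** C ** A"
    using eq by (simp only: A matrix_mul_lid matrix_mul_rid)
  then have "A ** (adj2 A ** adj2 C ** A) ** adj2 A = A ** (adj2 A ** C ** A) ** adj2 A"
    by simp
  then have "(A ** adj2 A) ** adj2 C ** (A ** adj2 A) = (A ** adj2 A) ** C ** (A ** adj2 A)"
    by (simp only: matrix_mul_assoc)
  then have "adj2 C = C" by (simp only: A matrix_mul_lid matrix_mul_rid)
  then have "C ** C = mat 1" using adj2_right[of C] assms by simp
  moreover have "trace (C ** C) = trace C * trace C - 2 * det C"
    unfolding m2_trace m2_mult_nth det_2 by algebra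
  moreover have "trace (mat 1 :: m2) = 2" by (simp add: m2_trace m2_mat_nth)
  ultimately show False using assms by (simp add: power2_eq_square)
qed

locale knot_rep =
  fixes A B C E :: m2
  assumes quad: "knot_quad A B C E"
    and irred: "\<not> common_eigenvector {A, B, C, E}"
begin

abbreviation "t \<equiv> trace A"

lemma det: "det A = 1" "det B = 1" "det C = 1" "det E = 1"
  using quad by (simp_all add: knot_quad_def)

lemma crossing_equal: "crossing A B C = crossing E A B" "crossing B C E = crossing E A B"
  "crossing C E A = crossing E A B"
  using quad by (simp_all add: knot_quad_def)

lemma tr: "trace B = t" "trace C = t" "trace E = t"
proof -
  have "trace B = trace C" "trace C = trace E" "trace E = trace A"
    using trace_crossing_neighbours[of A E B C] trace_crossing_neighbours[of B A C E]
      trace_crossing_neighbours[of C B E A] det crossing_equal by auto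
  then show "trace B = t" "trace C = t" "trace E = t" by simp_all
qed

lemma sq: "trace (A ** A) = t^2 - 2" "trace (B ** B) = t^2 - 2" "trace (C ** C) = t^2 - 2"
  "trace (E ** E) = t^2 - 2"
proof -
  have "trace (X ** X) = trace X ^ 2 - 2 * det X" for X :: m2
    unfolding m2_trace m2_mult_nth det_2 by algebra
  then show "trace (A ** A) = t^2 - 2" "trace (B ** B) = t^2 - 2" "trace (C ** C) = t^2 - 2"
    "trace (E ** E) = t^2 - 2" using det tr by simp_all
qed

lemma cyc: "trace (E ** A) = trace (A ** E)" "trace (B ** A) = trace (A ** B)" "trace (C ** B) = trace (B ** C)"
  "trace (E ** C) = trace (C ** E)" "trace (C ** A) = trace (A ** C)" "trace (E ** B) = trace (B ** E)"
  "trace (E ** A ** B) = trace (A ** B ** E)" "trace (C ** E ** A) = trace (A ** C ** E)"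
  "trace (E ** A ** C) = trace (A ** C ** E)"
  by (rule trace_sym)+ (rule trace_cyc3, rule HOL.trans[OF trace_cyc3 trace_cyc3], rule trace_cyc3)

lemma gr_values:
  "gr A A = t^2 - 4" "gr B B = t^2 - 4" "gr C C = t^2 - 4" "gr E E = t^2 - 4"
  "gr A B = 2 * trace (A ** B) - t^2" "gr B A = 2 * trace (A ** B) - t^2"
  "gr B C = 2 * trace (B ** C) - t^2" "gr C B = 2 * trace (B ** C) - t^2"
  "gr C E = 2 * trace (C ** E) - t^2" "gr E C = 2 * trace (C ** E) - t^2"
  "gr A E = 2 * trace (A ** E) - t^2" "gr E A = 2 * trace (A ** E) - t^2"
  "gr A C = 2 * trace (A ** C) - t^2" "gr C A = 2 * trace (A ** C) - t^2"
  "gr B E = 2 * trace (B ** E) - t^2" "gr E B = 2 * trace (B ** E) - t^2"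
  by (simp_all add: gr_def sq tr cyc power2_eq_square algebra_simps)

text \<open>Only the other generators have to be tested: against \<open>X\<close> and
  \<open>Y\<close> themselves all traces are \<open>t^2 - 2\<close>.\<close>

lemma equal:
  assumes "X \<in> {A, B, C, E}" "Y \<in> {A, B, C, E}" "trace (X ** Y) = t^2 - 2"
    and "\<And>Z. Z \<in> {A, B, C, E} - {X, Y} \<Longrightarrow> trace (X ** Z) = trace (Y ** Z)"
  shows "X = Y"
proof (rule equal_of_isotropic[OF _ _ _ _ assms(3) _ irred])
  show "det X = 1" "det Y = 1" "trace X = t" "trace Y = t" using assms det tr by auto
  show "trace (X ** Z) = trace (Y ** Z)" if Z: "Z \<in> {A, B, C, E}" for Z
  proof -
    consider "Z = X" | "Z = Y" | "Z \<in> {A, B, C, E} - {X, Y}" using Z by blast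
    then show ?thesis
    proof cases
      case 1
      have "trace (X ** X) = t^2 - 2" using assms(1) sq by blast
      with 1 assms(3) trace_sym[of Y X] show ?thesis by simp
    next
      case 2
      have "trace (Y ** Y) = t^2 - 2" using assms(2) sq by blast
      with 2 assms(3) show ?thesis by simp
    qed (rule assms(4))
  qed
qed

lemma inverse:
  assumes "X \<in> {A, B, C, E}" "Y \<in> {A, B, C, E}" "trace (X ** Y) = 2"
    and "\<And>Z. Z \<in> {A, B, C, E} - {X, Y} \<Longrightarrow> trace (X ** Z) + trace (Y ** Z) = t^2"
  shows "Y = adj2 X"
proof (rule inverse_of_isotropic[OF _ _ _ _ assms(3) _ _ irred])
  show "det X = 1" "det Y = 1" "trace X = t" "trace Y = t" using assms det tr by auto
  show "trace Z = t" if "Z \<in> {A, B, C, E}" for Z using that tr by auto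
  show "trace (X ** Z) + trace (Y ** Z) = t^2" if Z: "Z \<in> {A, B, C, E}" for Z
  proof -
    consider "Z = X" | "Z = Y" | "Z \<in> {A, B, C, E} - {X, Y}" using Z by blast
    then show ?thesis
    proof cases
      case 1
      have "trace (X ** X) = t^2 - 2" using assms(1) sq by blast
      with 1 assms(3) trace_sym[of Y X] show ?thesis by simp
    next
      case 2
      have "trace (Y ** Y) = t^2 - 2" using assms(2) sq by blast
      with 2 assms(3) show ?thesis by simp
    qed (rule assms(4))
  qed
qed

abbreviation "cA \<equiv> crossing_coeff E A B"
abbreviation "cB \<equiv> crossing_coeff A B C"
abbreviation "cC \<equiv> crossing_coeff B C E"
abbreviation "cE \<equiv> crossing_coeff C E A"
abbreviation "b \<equiv> trace (crossing E A B)"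

lemma coeff:
  "cA = t * trace (A ** B ** E) - trace (A ** B) * trace (A ** E) + t^2 - trace (B ** E)"
  "cB = t * trace (A ** B ** C) - trace (A ** B) * trace (B ** C) + t^2 - trace (A ** C)"
  "cC = t * trace (B ** C ** E) - trace (B ** C) * trace (C ** E) + t^2 - trace (B ** E)"
  "cE = t * trace (A ** C ** E) - trace (C ** E) * trace (A ** E) + t^2 - trace (A ** C)"
  by (simp_all add: crossing_coeff_eq det tr cyc power2_eq_square mult.commute)

lemma b_values:
  "b = t * cA - t^3 + t * (trace (A ** E) + trace (A ** B)) - trace (A ** B ** E)"
  "b = t * cB - t^3 + t * (trace (A ** B) + trace (B ** C)) - trace (A ** B ** C)"
  "b = t * cC - t^3 + t * (trace (B ** C) + trace (C ** E)) - trace (B ** C ** E)"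
  "b = t * cE - t^3 + t * (trace (C ** E) + trace (A ** E)) - trace (A ** C ** E)"
  using trace_crossing_1[of A E t B] trace_crossing_1[of B A t C] trace_crossing_1[of C B t E]
    trace_crossing_1[of E C t A] det tr cyc crossing_equal by simp_all

lemma diag:
  "trace (crossing E A B ** A) = t * b - cA" "trace (crossing E A B ** B) = t * b - cB"
  "trace (crossing E A B ** C) = t * b - cC" "trace (crossing E A B ** E) = t * b - cE"
  using trace_crossing_self[of A t E B] trace_crossing_self[of B t A C] trace_crossing_self[of C t B E]
    trace_crossing_self[of E t C A] det tr crossing_equal by simp_all

lemma side:
  "t * b - cB = cA * trace (A ** B) - (t^2 - trace (A ** E))"
  "t * b - cC = cB * trace (B ** C) - (t^2 - trace (A ** B))"
  "t * b - cE = cC * trace (C ** E) - (t^2 - trace (B ** C))"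
  "t * b - cA = cE * trace (A ** E) - (t^2 - trace (C ** E))"
  "t * b - cA = cB * trace (A ** B) - (t^2 - trace (B ** C))"
  "t * b - cB = cC * trace (B ** C) - (t^2 - trace (C ** E))"
  "t * b - cC = cE * trace (C ** E) - (t^2 - trace (A ** E))"
  "t * b - cE = cA * trace (A ** E) - (t^2 - trace (A ** B))"
  using trace_crossing_right[of A B E t] trace_crossing_right[of B C A t] trace_crossing_right[of C E B t]
    trace_crossing_right[of E A C t]
    trace_crossing_left[of A E B t] trace_crossing_left[of B A C t] trace_crossing_left[of C B E t]
    trace_crossing_left[of E C A t] det tr cyc crossing_equal diag by simp_all

lemma opposite:
  defines "Q \<equiv> trace (A ** B ** C ** E)"
  shows "t * b - cC = cA * trace (A ** C) - (t^2 * trace (A ** C) - t * trace (A ** B ** C) - t * trace (A ** C ** E) + Q)"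
    "t * b - cE = cB * trace (B ** E) - (t^2 * trace (B ** E) - t * trace (B ** C ** E) - t * trace (A ** B ** E) + Q)"
    "t * b - cA = cC * trace (A ** C) - (t^2 * trace (A ** C) - t * trace (A ** C ** E) - t * trace (A ** B ** C) + Q)"
    "t * b - cB = cE * trace (B ** E) - (t^2 * trace (B ** E) - t * trace (A ** B ** E) - t * trace (B ** C ** E) + Q)"
proof -
  have "trace (E ** A ** B ** C) = Q" "trace (B ** C ** E ** A) = Q" "trace (C ** E ** A ** B) = Q"
    unfolding Q_def using trace_sym[of E "A ** B ** C"] trace_sym[of A "B ** C ** E"]
      trace_sym[of "A ** B" "C ** E"] by (simp_all add: matrix_mul_assoc)
  moreover have "trace (B ** C ** A) = trace (A ** B ** C)" "trace (C ** E ** B) = trace (B ** C ** E)"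
     "trace (E ** B ** C) = trace (B ** C ** E)" "trace (C ** A ** B) = trace (A ** B ** C)"
     "trace (B ** E ** A) = trace (A ** B ** E)" "trace (E ** A ** B) = trace (A ** B ** E)"
    by (metis trace_cyc3)+
  ultimately show
    "t * b - cC = cA * trace (A ** C) - (t^2 * trace (A ** C) - t * trace (A ** B ** C) - t * trace (A ** C ** E) + Q)"
    "t * b - cE = cB * trace (B ** E) - (t^2 * trace (B ** E) - t * trace (B ** C ** E) - t * trace (A ** B ** E) + Q)"
    "t * b - cA = cC * trace (A ** C) - (t^2 * trace (A ** C) - t * trace (A ** C ** E) - t * trace (A ** B ** C) + Q)"
    "t * b - cB = cE * trace (B ** E) - (t^2 * trace (B ** E) - t * trace (A ** B ** E) - t * trace (B ** C ** E) + Q)"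
    using trace_crossing_opposite[of A E t B C] trace_crossing_opposite[of B A t C E]
      trace_crossing_opposite[of C B t E A] trace_crossing_opposite[of E C t A B] det tr cyc crossing_equal diag Q_def
    by simp_all
qed

lemma trace_ABCE:
  "2 * trace (A ** B ** C ** E) = t * (trace (A ** B ** E) + trace (A ** B ** C) + trace (B ** C ** E) + trace (A ** C ** E))
    + trace (A ** B) * trace (C ** E) + trace (B ** C) * trace (A ** E) - trace (A ** C) * trace (B ** E)
    - t^2 * (trace (A ** B) + trace (B ** C) + trace (C ** E) + trace (A ** E)) + t^4"
  using trace4[of A B C E] unfolding tr by algebra

lemma br_values:
  "br A B E = 2 * trace (A ** B ** E) - t * (trace (A ** B) + trace (A ** E) + trace (B ** E)) + t^3"
  "br A B C = 2 * trace (A ** B ** C) - t * (trace (A ** B) + trace (B ** C) + trace (A ** C)) + t^3"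
  "br B C E = 2 * trace (B ** C ** E) - t * (trace (B ** C) + trace (C ** E) + trace (B ** E)) + t^3"
  "br A C E = 2 * trace (A ** C ** E) - t * (trace (C ** E) + trace (A ** E) + trace (A ** C)) + t^3"
  unfolding br_eq tr by algebra+

text \<open>The \<open>P\<close> and \<open>P'\<close> fields multiply a word by its cyclic
  neighbours; \<open>C13\<close> and \<open>C24\<close> by opposite generators, where the fourfold
  trace cancels in the difference; \<open>Q13\<close> and \<open>Q24\<close> keep that trace and
  insert \<open>trace_ABCE\<close>. The \<open>S\<close> fields are instances of
  \<open>br_mult_br\<close>, \<open>L1\<close> and \<open>L2\<close> of \<open>br_linear\<close>.
  The last five use irreducibility.\<close>

lemma char_eqs:
  "char_eqs t (t^2 - 1) (trace (A ** B) - 1) (trace (B ** C) - 1) (trace (C ** E) - 1) (trace (A ** E) - 1)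
     (trace (A ** C)) (trace (B ** E)) (trace (A ** B ** E)) (trace (A ** B ** C)) (trace (B ** C ** E))
     (trace (A ** C ** E)) cA cB cC cE b (br A B E) (br A B C) (br B C E) (br A C E)"
  (is "char_eqs t ?a ?u1 ?u2 ?u3 ?u4 ?p ?q ?T1 ?T2 ?T3 ?T4 _ _ _ _ _ ?D1 ?D2 ?D3 ?D4")
proof
  show "?a * ?T1 = b - t + t * (?q + ?u1 * ?u4)" using coeff(1) b_values(1) by algebra
  show "?a * ?T2 = b - t + t * (?p + ?u1 * ?u2)" using coeff(2) b_values(2) by algebra
  show "?a * ?T3 = b - t + t * (?q + ?u2 * ?u3)" using coeff(3) b_values(3) by algebra
  show "?a * ?T4 = b - t + t * (?p + ?u3 * ?u4)" using coeff(4) b_values(4) by algebra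
  show "cA = t * ?T1 - (?u1 + 1) * (?u4 + 1) + t^2 - ?q" "cB = t * ?T2 - (?u1 + 1) * (?u2 + 1) + t^2 - ?p"
    "cC = t * ?T3 - (?u2 + 1) * (?u3 + 1) + t^2 - ?q" "cE = t * ?T4 - (?u3 + 1) * (?u4 + 1) + t^2 - ?p"
    by (simp_all add: coeff)
  show "cA * (?u1 + 1) + cB = t * b + t^2 - 1 - ?u4" using side(1) by algebra
  show "cB * (?u2 + 1) + cC = t * b + t^2 - 1 - ?u1" using side(2) by algebra
  show "cC * (?u3 + 1) + cE = t * b + t^2 - 1 - ?u2" using side(3) by algebra
  show "cE * (?u4 + 1) + cA = t * b + t^2 - 1 - ?u3" using side(4) by algebra
  show "cB * (?u1 + 1) + cA = t * b + t^2 - 1 - ?u2" using side(5) by algebra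
  show "cC * (?u2 + 1) + cB = t * b + t^2 - 1 - ?u3" using side(6) by algebra
  show "cE * (?u3 + 1) + cC = t * b + t^2 - 1 - ?u4" using side(7) by algebra
  show "cA * (?u4 + 1) + cE = t * b + t^2 - 1 - ?u1" using side(8) by algebra
  show "(cA - cC) * (?p - 1) = 0" using opposite(1,3) by algebra
  show "(cB - cE) * (?q - 1) = 0" using opposite(2,4) by algebra
  show "2 * (cA * ?p + cC) = 2 * t * b + 2 * t^2 * ?p - 2 * t * (?T2 + ?T4) + t * (?T1 + ?T2 + ?T3 + ?T4)
       + (?u1 + 1) * (?u3 + 1) + (?u2 + 1) * (?u4 + 1) - ?p * ?q - t^2 * (?u1 + ?u2 + ?u3 + ?u4 + 4) + t^4"
    using opposite(1) trace_ABCE by algebra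
  show "2 * (cB * ?q + cE) = 2 * t * b + 2 * t^2 * ?q - 2 * t * (?T1 + ?T3) + t * (?T1 + ?T2 + ?T3 + ?T4)
       + (?u1 + 1) * (?u3 + 1) + (?u2 + 1) * (?u4 + 1) - ?p * ?q - t^2 * (?u1 + ?u2 + ?u3 + ?u4 + 4) + t^4"
    using opposite(2) trace_ABCE by algebra
  show "?D1 = 2 * ?T1 - t * (?u1 + ?u4 + 2 + ?q) + t^3" "?D2 = 2 * ?T2 - t * (?u1 + ?u2 + 2 + ?p) + t^3"
    "?D3 = 2 * ?T3 - t * (?u2 + ?u3 + 2 + ?q) + t^3" "?D4 = 2 * ?T4 - t * (?u3 + ?u4 + 2 + ?p) + t^3"
    by (simp_all add: br_values)
  show "4 * ?D1^2 = - det3 (t^2 - 4) (2*?u1 + 2 - t^2) (2*?u4 + 2 - t^2) (2*?u1 + 2 - t^2) (t^2 - 4) (2*?q - t^2)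
                               (2*?u4 + 2 - t^2) (2*?q - t^2) (t^2 - 4)"
    using br_mult_br[of A B E A B E] by (simp add: gr_values power2_eq_square mult.assoc)
  show "4 * ?D2^2 = - det3 (t^2 - 4) (2*?u1 + 2 - t^2) (2*?p - t^2) (2*?u1 + 2 - t^2) (t^2 - 4) (2*?u2 + 2 - t^2)
                               (2*?p - t^2) (2*?u2 + 2 - t^2) (t^2 - 4)"
    using br_mult_br[of A B C A B C] by (simp add: gr_values power2_eq_square mult.assoc)
  show "4 * ?D2 * ?D3 = - det3 (2*?u1 + 2 - t^2) (2*?p - t^2) (2*?u4 + 2 - t^2)
       (t^2 - 4) (2*?u2 + 2 - t^2) (2*?q - t^2) (2*?u2 + 2 - t^2) (t^2 - 4) (2*?u3 + 2 - t^2)"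
    using br_mult_br[of A B C B C E] by (simp add: gr_values)
  show "4 * ?D2 * ?D4 = - det3 (t^2 - 4) (2*?p - t^2) (2*?u4 + 2 - t^2)
       (2*?u1 + 2 - t^2) (2*?u2 + 2 - t^2) (2*?q - t^2) (2*?p - t^2) (t^2 - 4) (2*?u3 + 2 - t^2)"
    using br_mult_br[of A B C A C E] by (simp add: gr_values)
  show "?D3 * (t^2 - 4) - ?D4 * (2*?u1 + 2 - t^2) + ?D1 * (2*?p - t^2) - ?D2 * (2*?u4 + 2 - t^2) = 0"
    using br_linear[of B C E A A] by (simp add: gr_values)
  show "?D3 * (2*?u1 + 2 - t^2) - ?D4 * (t^2 - 4) + ?D1 * (2*?u2 + 2 - t^2) - ?D2 * (2*?q - t^2) = 0"
    using br_linear[of B C E A B] by (simp add: gr_values)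
  show "\<not> (?u1 = t^2 - 3 \<and> ?u2 = t^2 - 3 \<and> ?u3 = t^2 - 3 \<and> ?u4 = t^2 - 3 \<and> ?p = t^2 - 2 \<and> ?q = t^2 - 2)"
  proof
    assume "?u1 = t^2 - 3 \<and> ?u2 = t^2 - 3 \<and> ?u3 = t^2 - 3 \<and> ?u4 = t^2 - 3 \<and> ?p = t^2 - 2 \<and> ?q = t^2 - 2"
    then have g: "trace (A ** B) = t^2 - 2" "trace (B ** C) = t^2 - 2" "trace (C ** E) = t^2 - 2"
      "trace (A ** E) = t^2 - 2" "trace (A ** C) = t^2 - 2" "trace (B ** E) = t^2 - 2"
      by (simp_all add: diff_eq_eq)
    have "A = B" by (rule equal) (auto simp: g)
    moreover have "A = C" by (rule equal) (auto simp: g cyc)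
    moreover have "A = E" by (rule equal) (auto simp: g cyc)
    ultimately have "common_eigenvector {A, B, C, E}"
      using eigenvector_exists[OF det(1)] unfolding common_eigenvector_def by auto
    with irred show False by simp
  qed
  show "?T2 = t * ?p - t" if "?u1 = t^2 - 3" "?p = ?u2 + 1" "?q = ?u4 + 1"
  proof -
    have "A = B" using that by (intro equal) (auto simp: diff_eq_eq)
    then have "?T2 = trace (A ** A ** C)" by simp
    also have "\<dots> = t * ?p - t"
      using det(1) tr(2) unfolding m2_square by (simp add: m2_simps algebra_simps)
    finally show ?thesis .
  qed
  show "?T2 = t * ?p - t" if "?u2 = t^2 - 3" "?p = ?u1 + 1" "?q = ?u3 + 1"
  proof -
    have "B = C" using that by (intro equal) (auto simp: diff_eq_eq cyc)
    then have "?T2 = trace (A ** (C ** C))" by (simp add: matrix_mul_assoc)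
    also have "\<dots> = t * ?p - t"
      using det(3) tr(2) unfolding m2_square by (simp add: m2_simps algebra_simps)
    finally show ?thesis .
  qed
  show "\<not> (t^2 = 2 \<and> ?u1 = 1 \<and> ?u3 = 1 \<and> ?u2 = 0 \<and> ?u4 = 0 \<and> ?p = 1 \<and> ?q = 1)"
  proof
    assume h: "t^2 = 2 \<and> ?u1 = 1 \<and> ?u3 = 1 \<and> ?u2 = 0 \<and> ?u4 = 0 \<and> ?p = 1 \<and> ?q = 1"
    then have g: "trace (A ** B) = 2" "trace (B ** C) = 1" "trace (C ** E) = 2"
      "trace (A ** E) = 1" "trace (A ** C) = 1" "trace (B ** E) = 1"
      by (auto simp: diff_eq_eq)
    have "B = adj2 A" by (rule inverse) (auto simp: g cyc h[THEN conjunct1])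
    moreover have "E = adj2 C" by (rule inverse) (auto simp: g cyc h[THEN conjunct1])
    moreover have "crossing E A B = crossing A B C" using crossing_equal by simp
    ultimately have "crossing (adj2 C) A (adj2 A) = crossing A (adj2 A) C"
      by (metis (no_types))
    then show False
      by (rule no_inverse_pairs[OF det(1,3) tr(2) h[THEN conjunct1]])
  qed
  show "\<not> (t^2 = 2 \<and> ?u2 = 1 \<and> ?u4 = 1 \<and> ?u1 = 0 \<and> ?u3 = 0 \<and> ?p = 1 \<and> ?q = 1)"
  proof
    assume h: "t^2 = 2 \<and> ?u2 = 1 \<and> ?u4 = 1 \<and> ?u1 = 0 \<and> ?u3 = 0 \<and> ?p = 1 \<and> ?q = 1"
    then have g: "trace (A ** B) = 1" "trace (B ** C) = 2" "trace (C ** E) = 1"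
      "trace (A ** E) = 2" "trace (A ** C) = 1" "trace (B ** E) = 1"
      by (auto simp: diff_eq_eq)
    have "C = adj2 B" by (rule inverse) (auto simp: g cyc h[THEN conjunct1])
    moreover have "A = adj2 E" by (rule inverse) (auto simp: g cyc h[THEN conjunct1])
    moreover have "crossing A B C = crossing B C E" using crossing_equal by simp
    ultimately have "crossing (adj2 E) B (adj2 B) = crossing B (adj2 B) E"
      by (metis (no_types))
    then show False
      by (rule no_inverse_pairs[OF det(2,4) tr(3) h[THEN conjunct1]])
  qed
qed simp

end

section \<open>The excluded parameter values as double roots\<close>

lemma sqrt2_square: "complex_of_real (sqrt 2) ^ 2 = 2"
  by (metis numeral_le_iff of_real_numeral of_real_power real_sqrt_pow2 zero_le_numeral)

lemma sqrt2_square': "complex_of_real (sqrt 2) ^ 2 - 2 = 0"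
  by (simp add: sqrt2_square)

text \<open>\<open>x\<close> and \<open>\<mu> - x\<close> are the two roots of the quadratic for
  \<open>x\<close>. On the curve of \<mu> its discriminant vanishes exactly at the excluded values
  other than \<open>\<alpha> = 0\<close>.\<close>

lemma cond_1_iff:
  "cond_1 \<alpha> \<mu> x \<longleftrightarrow> \<alpha> \<noteq> 0 \<and> \<alpha> * (x * (\<mu> - x)) = 2 * \<mu> + \<alpha>^2 - 4 * \<alpha> \<and>
     \<mu>^2 + (\<alpha>^2 - 4*\<alpha>) * \<mu> + 4*\<alpha>^2 - \<alpha>^3 = 0 \<and> x \<noteq> \<mu> - x"
proof (cases "\<alpha> \<noteq> 0 \<and> \<alpha> * (x * (\<mu> - x)) = 2 * \<mu> + \<alpha>^2 - 4 * \<alpha> \<and>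
     \<mu>^2 + (\<alpha>^2 - 4*\<alpha>) * \<mu> + 4*\<alpha>^2 - \<alpha>^3 = 0")
  case True
  then have a0: "\<alpha> \<noteq> 0" and x: "\<alpha> * (x * (\<mu> - x)) = 2 * \<mu> + \<alpha>^2 - 4 * \<alpha>"
    and mu: "\<mu>^2 + (\<alpha>^2 - 4*\<alpha>) * \<mu> + 4*\<alpha>^2 - \<alpha>^3 = 0" by auto
  have x': "x^2 - \<mu>*x + 2*\<mu>/\<alpha> + \<alpha> - 4 = 0"
    using a0 x by (simp add: field_simps power2_eq_square)
  let ?s = "complex_of_real (sqrt 2)"
  have "x = \<mu> - x \<longleftrightarrow> \<alpha> = 2 \<or> \<alpha> = 4 \<or> (\<alpha> = 2 + 2 * ?s \<and> \<mu> = 2 * ?s) \<or> (\<alpha> = 2 - 2 * ?s \<and> \<mu> = - 2 * ?s)"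
    (is "_ \<longleftrightarrow> ?R")
  proof
    assume "x = \<mu> - x"
    then have m: "\<mu> = 2 * x" by algebra
    have 1: "\<alpha> * x^2 = 4 * x + \<alpha>^2 - 4 * \<alpha>" using x unfolding m by algebra
    \<comment> \<open>Eliminating \<open>x^2\<close> between the double-root equation and the curve
      leaves an equation linear in \<open>x\<close>.\<close>
    have "(\<alpha> - 2) * (2 * x * (\<alpha>^2 - 2 * \<alpha> - 4) - \<alpha> * (\<alpha> - 4) * (\<alpha> + 2)) = 0"
      using 1 mu unfolding m by algebra
    show ?R
    proof (cases "\<alpha> = 2")
      case False
      then have 2: "2 * x * (\<alpha>^2 - 2 * \<alpha> - 4) = \<alpha> * (\<alpha> - 4) * (\<alpha> + 2)"
        using \<open>(\<alpha> - 2) * _ = 0\<close> by simp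
      have "\<alpha> * (\<alpha> - 4) * (\<alpha>^3 * (\<alpha>^2 - 4 * \<alpha> - 4)) = 0"
        using 1 2 by algebra
      with a0 have "\<alpha> = 4 \<or> \<alpha>^2 - 4 * \<alpha> - 4 = 0" by auto
      then show ?R
      proof
        assume q: "\<alpha>^2 - 4 * \<alpha> - 4 = 0"
        then have "(\<alpha> - 2)^2 = (2 * ?s)^2"
          unfolding power_mult_distrib sqrt2_square by algebra
        then have s: "\<alpha> - 2 = 2 * ?s \<or> \<alpha> - 2 = - (2 * ?s)" by (simp only: power2_eq_iff)
        have "2 * \<alpha> * (2 * x - (\<alpha> - 2)) = 0" using 2 q by algebra
        then have "2 * x - (\<alpha> - 2) = 0" using a0 by simp
        then have "\<mu> = \<alpha> - 2" unfolding m by algebra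
        then show ?R using s by (metis add.commute diff_add_cancel diff_conv_add_uminus mult_minus_left)
      qed simp
    qed simp
  next
    assume ?R
    have "\<alpha> * (2 * x - \<mu>)^2 = \<alpha> * \<mu>^2 - 8 * \<mu> - 4 * \<alpha>^2 + 16 * \<alpha>" using x by algebra
    moreover from \<open>?R\<close> have "\<alpha> * \<mu>^2 - 8 * \<mu> - 4 * \<alpha>^2 + 16 * \<alpha> = 0"
    proof (elim disjE)
      assume a: "\<alpha> = 2"
      show ?thesis using mu unfolding a by algebra
    next
      assume a: "\<alpha> = 4"
      show ?thesis using mu unfolding a by algebra
    next
      assume "\<alpha> = 2 + 2 * ?s \<and> \<mu> = 2 * ?s"
      then have s: "\<alpha> = 2 + 2 * ?s" "\<mu> = 2 * ?s" by auto
      show ?thesis using sqrt2_square' unfolding s by algebra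
    next
      assume "\<alpha> = 2 - 2 * ?s \<and> \<mu> = - 2 * ?s"
      then have s: "\<alpha> = 2 - 2 * ?s" "\<mu> = - 2 * ?s" by auto
      show ?thesis using sqrt2_square' unfolding s by algebra
    qed
    ultimately have "(2 * x - \<mu>)^2 = 0" using a0 by simp
    then show "x = \<mu> - x" by algebra
  qed
  with a0 x x' mu show ?thesis unfolding cond_1_def by auto
next
  case False
  have "\<alpha> * (x * (\<mu> - x)) = 2 * \<mu> + \<alpha>^2 - 4 * \<alpha>" if "\<alpha> \<noteq> 0" "x^2 - \<mu>*x + 2*\<mu>/\<alpha> + \<alpha> - 4 = 0"
    using that by (simp add: field_simps power2_eq_square)
  with False show ?thesis unfolding cond_1_def by auto
qed

text \<open>The roots of the quadratic for \<gamma> have product \<open>z^2\<close>, so a double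
  root means \<open>\<gamma> = z\<close> or \<open>\<gamma> = - z\<close>. The first gives
  \<open>\<alpha> = 2\<close>, the second \<open>(\<alpha> - 2) * z = 4\<close>, from which the
  other exclusions come.\<close>

lemma cond_2_iff:
  "cond_2 \<alpha> z \<gamma> \<longleftrightarrow> \<alpha> \<noteq> 0 \<and> z^2 - \<alpha>*z + \<alpha> = 0 \<and> \<gamma>^2 + ((\<alpha> - 2)*z^2 - 2*z)*\<gamma> + z^2 = 0 \<and> \<gamma>^2 \<noteq> z^2"
proof (cases "\<alpha> \<noteq> 0 \<and> z^2 - \<alpha>*z + \<alpha> = 0 \<and> \<gamma>^2 + ((\<alpha> - 2)*z^2 - 2*z)*\<gamma> + z^2 = 0")
  case True
  then have a0: "\<alpha> \<noteq> 0" and z: "z^2 - \<alpha>*z + \<alpha> = 0"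
    and g: "\<gamma>^2 + ((\<alpha> - 2)*z^2 - 2*z)*\<gamma> + z^2 = 0" by auto
  have z0: "z \<noteq> 0" using z a0 by auto
  have g0: "\<gamma> \<noteq> 0" using g z0 by auto
  let ?s = "complex_of_real (sqrt 2)"
  have "\<gamma>^2 = z^2 \<longleftrightarrow> \<alpha> = 2 \<or> \<alpha> = 4 \<or> (\<alpha> = 2 + 2 * ?s \<and> z = ?s) \<or> (\<alpha> = 2 - 2 * ?s \<and> z = - ?s)"
    (is "_ \<longleftrightarrow> ?R")
  proof
    assume gz: "\<gamma>^2 = z^2"
    then have "\<gamma> = z \<or> \<gamma> = - z" by (simp only: power2_eq_iff)
    then have "z * z * (\<alpha> - 2) * ((\<alpha> - 2) * z - 4) = 0"
    proof
      assume g': "\<gamma> = z"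
      have "z * z * ((\<alpha> - 2) * z) = 0" using g unfolding g' by algebra
      then show ?thesis using z0 by auto
    next
      assume g': "\<gamma> = - z"
      have "z * z * ((\<alpha> - 2) * z - 4) = 0" using g unfolding g' by algebra
      then show ?thesis by auto
    qed
    then have "\<alpha> = 2 \<or> (\<alpha> - 2) * z = 4" using z0 by auto
    then show ?R
    proof
      assume "(\<alpha> - 2) * z = 4"
      then have e: "(\<alpha> - 2) * z - 4 = 0" by simp
      have "(\<alpha> - 4) * (\<alpha>^2 - 4 * \<alpha> - 4) = 0" using e z by algebra
      then have "\<alpha> = 4 \<or> \<alpha>^2 - 4 * \<alpha> - 4 = 0" by simp
      then show ?R
      proof
        assume q: "\<alpha>^2 - 4 * \<alpha> - 4 = 0"
        then have "(\<alpha> - 2)^2 = (2 * ?s)^2"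
          unfolding power_mult_distrib sqrt2_square by algebra
        then have s: "\<alpha> - 2 = 2 * ?s \<or> \<alpha> - 2 = - (2 * ?s)" by (simp only: power2_eq_iff)
        have "2 * z = \<alpha> - 2" using e q by algebra
        with s have "\<alpha> - 2 = 2 * ?s \<and> 2 * z = 2 * ?s \<or> \<alpha> - 2 = - (2 * ?s) \<and> 2 * z = 2 * (- ?s)" by auto
        then have "\<alpha> = 2 + 2 * ?s \<and> z = ?s \<or> \<alpha> = 2 - 2 * ?s \<and> z = - ?s" by algebra
        then show ?R by blast
      qed simp
    qed simp
  next
    assume ?R
    then have "(\<alpha> - 2) * ((\<alpha> - 2) * z - 4) = 0"
    proof (elim disjE)
      assume "\<alpha> = 4"
      with z have "(z - 2)^2 = 0" by (simp add: power2_eq_square algebra_simps)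
      then have "z = 2" by simp
      with \<open>\<alpha> = 4\<close> show ?thesis by simp
    next
      assume "\<alpha> = 2 + 2 * ?s \<and> z = ?s"
      then have s: "\<alpha> = 2 + 2 * ?s" "z = ?s" by auto
      show ?thesis using sqrt2_square' unfolding s by algebra
    next
      assume "\<alpha> = 2 - 2 * ?s \<and> z = - ?s"
      then have s: "\<alpha> = 2 - 2 * ?s" "z = - ?s" by auto
      show ?thesis using sqrt2_square' unfolding s by algebra
    qed simp
    then have "(\<alpha> - 2) * z = 0 \<or> (\<alpha> - 2) * z = 4" by auto
    then show "\<gamma>^2 = z^2"
    proof
      assume "(\<alpha> - 2) * z = 0"
      then have "(\<gamma> - z)^2 = 0" using g by algebra
      then show ?thesis by simp
    next
      assume "(\<alpha> - 2) * z = 4"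
      then have "(\<alpha> - 2) * z - 4 = 0" by simp
      then have "(\<gamma> + z)^2 = 0" using g by algebra
      then have "\<gamma> + z = 0" by simp
      then show ?thesis by algebra
    qed
  qed
  with a0 z g show ?thesis unfolding cond_2_def by auto
next
  case False
  then show ?thesis unfolding cond_2_def by auto
qed

context char_eqs begin

text \<open>Since \<open>q\<close> differs from 1, \<open>C24\<close> applies. It rules out
  \<open>u1 = u2\<close>, \<open>u3 = u4\<close>, because the two values would then sum to
  \<open>2 * a\<close>, against \<open>two_pairs\<close>.\<close>

lemma p_one_not_adjacent:
  assumes a0: "a \<noteq> 0" and p: "p = 1" and q: "q \<noteq> 1" and ne: "u2 \<noteq> u4" "u1 \<noteq> u3"
  shows "u4 = u1" "u3 = u2"
proof -
  have pq: "p \<noteq> q" using p q by simp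
  note tp = two_pairs[OF a0 pq ne]
  have "c2 = c4" using C24 q by simp
  then have v: "(u1 - a) * (u2 - a) = (u3 - a) * (u4 - a)" using ac2 ac4 by simp
  have "\<not> (u1 = u2 \<and> u3 = u4)"
  proof
    assume u: "u1 = u2 \<and> u3 = u4"
    have "(u1 - u3) * (u1 + u3 - 2 * a) = 0" using v u by algebra
    with ne have "u1 + u3 - 2 * a = 0" by simp
    with tp(1) have "2 * a * a = 0" by algebra
    with a0 show False by simp
  qed
  with tp(3) show "u4 = u1" "u3 = u2" by auto
qed

end

section \<open>The rotation symmetry\<close>

text \<open>The coordinates of the quadruple \<open>(B, C, E, A)\<close> in terms of those of
  \<open>(A, B, C, E)\<close>, rewritten by cyclic invariance of the trace.\<close>

fun rot :: "point \<Rightarrow> point" where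
  "rot (t, (t12, t23, t34, t14), (t13, t24), (t123, t124, t134, t234)) =
     (t, (t23, t34, t14, t12), (t24, t13), (t234, t123, t124, t134))"

definition quad_point :: "m2 \<Rightarrow> m2 \<Rightarrow> m2 \<Rightarrow> m2 \<Rightarrow> point" where
  "quad_point A B C E =
    (trace A, (trace (A ** B), trace (B ** C), trace (C ** E), trace (A ** E)),
     (trace (A ** C), trace (B ** E)),
     (trace (A ** B ** C), trace (A ** B ** E), trace (A ** C ** E), trace (B ** C ** E)))"

definition all_components :: "point set" where
  "all_components = X_1_1 \<union> X_1_2 \<union> X_2_1 \<union> X_2_2 \<union> X_3 \<union> X_4 \<union> X_5_1 \<union> X_5_2 \<union> X_6_1 \<union> X_6_2"

lemma rot4: "rot (rot (rot (rot x))) = x"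
  by (cases x) auto

text \<open>\<open>rot\<close> has order four, so the third iterate of a point of \<open>S'\<close>
  lies in \<open>S\<close> and is a preimage.\<close>

lemma rot_image_eq:
  assumes "rot ` S \<subseteq> S'" "rot ` S' \<subseteq> S"
  shows "rot ` S = S'"
proof
  show "S' \<subseteq> rot ` S"
  proof
    fix x assume "x \<in> S'"
    then have "rot (rot (rot x)) \<in> S" using assms by blast
    then show "x \<in> rot ` S" using rot4[of x] by (metis image_eqI)
  qed
qed fact

lemma cond_1_swap: "cond_1 \<alpha> \<mu> x \<Longrightarrow> cond_1 \<alpha> \<mu> (\<mu> - x)"
  unfolding cond_1_iff by (auto simp: mult.commute)

lemma sigma_swap:
  assumes "\<alpha> \<noteq> 0"
  shows "\<sigma>_plus \<alpha> \<mu> (\<mu> - x) = \<sigma>_minus \<alpha> \<mu> x" "\<sigma>_minus \<alpha> \<mu> (\<mu> - x) = \<sigma>_plus \<alpha> \<mu> x"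
  using assms by (simp_all add: \<sigma>_plus_def \<sigma>_minus_def field_simps power2_eq_square)

lemma rot_X_1: "rot ` X_1_1 = X_1_2"
proof (rule rot_image_eq)
  show "rot ` X_1_1 \<subseteq> X_1_2"
  proof
    fix y assume "y \<in> rot ` X_1_1"
    then obtain t \<alpha> \<mu> x where a: "\<alpha> = t^2 - 1" and c: "cond_1 \<alpha> \<mu> x"
      and y: "y = rot (t, (x + 1, \<mu> + 1 - x, \<mu> + 1 - x, x + 1), (1, \<tau> \<alpha> \<mu>),
             (t*\<mu>/\<alpha>, t * \<sigma>_plus \<alpha> \<mu> x, t*\<mu>/\<alpha>, t * \<sigma>_minus \<alpha> \<mu> x))"
      unfolding X_1_1_def by blast
    have "\<alpha> \<noteq> 0" using c by (simp add: cond_1_def)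
    \<comment> \<open>Rotation interchanges the two roots here, so the new parameter is
      \<open>\<mu> - x\<close>.\<close>
    then have "y = (t, ((\<mu> - x) + 1, (\<mu> - x) + 1, \<mu> + 1 - (\<mu> - x), \<mu> + 1 - (\<mu> - x)), (\<tau> \<alpha> \<mu>, 1),
             (t * \<sigma>_plus \<alpha> \<mu> (\<mu> - x), t*\<mu>/\<alpha>, t * \<sigma>_minus \<alpha> \<mu> (\<mu> - x), t*\<mu>/\<alpha>))"
      unfolding y sigma_swap[OF \<open>\<alpha> \<noteq> 0\<close>] by (simp add: algebra_simps)
    then show "y \<in> X_1_2" unfolding X_1_2_def using a cond_1_swap[OF c] by blast
  qed
  show "rot ` X_1_2 \<subseteq> X_1_1"
    unfolding X_1_1_def X_1_2_def by clarsimp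
qed

lemma cond_2_nonzero:
  assumes "cond_2 \<alpha> z \<gamma>"
  shows "\<alpha> \<noteq> 0" "z \<noteq> 0" "\<gamma> \<noteq> 0"
  using assms unfolding cond_2_def by auto

text \<open>\<open>z^2 / \<gamma>\<close> is the second root of the quadratic for \<gamma>, whose
  constant term is \<open>z^2\<close>.\<close>

lemma cond_2_swap:
  assumes c: "cond_2 \<alpha> z \<gamma>"
  shows "cond_2 \<alpha> z (z^2 / \<gamma>)"
proof -
  note nz = cond_2_nonzero[OF c]
  have g: "\<gamma>^2 + ((\<alpha> - 2)*z^2 - 2*z)*\<gamma> + z^2 = 0" and ne: "\<gamma>^2 \<noteq> z^2"
    using c unfolding cond_2_iff by auto
  have "(z^2/\<gamma>)^2 + ((\<alpha> - 2)*z^2 - 2*z)*(z^2/\<gamma>) + z^2 = (z^2 / \<gamma>^2) * (\<gamma>^2 + ((\<alpha> - 2)*z^2 - 2*z)*\<gamma> + z^2)"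
    using nz by (simp add: field_simps power2_eq_square)
  moreover have "(z^2/\<gamma>)^2 \<noteq> z^2"
    using nz ne by (auto simp: field_simps power2_eq_square)
  ultimately show ?thesis using c g unfolding cond_2_iff by simp
qed

lemma rot_X_2: "rot ` X_2_1 = X_2_2"
proof (rule rot_image_eq)
  show "rot ` X_2_1 \<subseteq> X_2_2"
  proof
    fix y assume "y \<in> rot ` X_2_1"
    then obtain t \<alpha> z \<gamma> where a: "\<alpha> = t^2 - 1" and c: "cond_2 \<alpha> z \<gamma>"
      and y: "y = rot (t, (\<gamma> + \<alpha> - 1, z + 1, z^2/\<gamma> + \<alpha> - 1, z + 1), (1, 1),
             (t + t*z*\<gamma>/\<alpha>, t + t*z*\<gamma>/\<alpha>, t + t*z^3/(\<alpha>*\<gamma>), t + t*z^3/(\<alpha>*\<gamma>)))"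
      unfolding X_2_1_def by blast
    note nz = cond_2_nonzero[OF c]
    define d where "d = z^2 / \<gamma>"
    have g: "\<gamma> = z^2 / d" and 1: "t*z*\<gamma>/\<alpha> = t*z^3/(\<alpha>*d)" "t*z^3/(\<alpha>*\<gamma>) = t*z*d/\<alpha>"
      using nz by (simp_all add: d_def field_simps power2_eq_square power3_eq_cube)
    have "y = (t, (z + 1, d + \<alpha> - 1, z + 1, z^2/d + \<alpha> - 1), (1, 1),
             (t + t*z*d/\<alpha>, t + t*z^3/(\<alpha>*d), t + t*z^3/(\<alpha>*d), t + t*z*d/\<alpha>))"
      unfolding y 1 g[symmetric] d_def[symmetric] by simp
    then show "y \<in> X_2_2" unfolding X_2_2_def using a cond_2_swap[OF c] d_def by blast
  qed
  show "rot ` X_2_2 \<subseteq> X_2_1"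
    unfolding X_2_1_def X_2_2_def by clarsimp
qed

lemma rot_X_3: "rot ` X_3 = X_3"
  by (rule rot_image_eq; unfold X_3_def; clarsimp; blast)

lemma rot_X_4: "rot ` X_4 = X_4"
  by (rule rot_image_eq; unfold X_4_def; clarsimp; blast)

lemma rot_X_5: "rot ` X_5_1 = X_5_2"
  by (rule rot_image_eq; unfold X_5_1_def X_5_2_def; clarsimp)

lemma rot_X_6: "rot ` X_6_1 = X_6_2"
  by (rule rot_image_eq; unfold X_6_1_def X_6_2_def; clarsimp)

lemma rot_X_1': "rot ` X_1_2 \<subseteq> X_1_1"
  unfolding X_1_1_def X_1_2_def by clarsimp

lemma rot_X_2': "rot ` X_2_2 \<subseteq> X_2_1"
  unfolding X_2_1_def X_2_2_def by clarsimp

lemma rot_X_5': "rot ` X_5_2 \<subseteq> X_5_1"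
  unfolding X_5_1_def X_5_2_def by clarsimp

lemma rot_X_6': "rot ` X_6_2 \<subseteq> X_6_1"
  unfolding X_6_1_def X_6_2_def by clarsimp

lemma rot_components: "rot x \<in> all_components \<longleftrightarrow> x \<in> all_components"
proof -
  have "rot ` all_components \<subseteq> all_components"
    unfolding all_components_def image_Un rot_X_1 rot_X_2 rot_X_3 rot_X_4 rot_X_5 rot_X_6
    by (intro Un_least) (use rot_X_1' rot_X_2' rot_X_5' rot_X_6' in \<open>simp_all add: le_supI1 le_supI2\<close>)
  then have 1: "rot y \<in> all_components" if "y \<in> all_components" for y
    using that by blast
  show ?thesis
  proof
    assume "rot x \<in> all_components"
    then have "rot (rot (rot (rot x))) \<in> all_components" by (rule 1[OF 1[OF 1]])
    then show "x \<in> all_components" by (simp only: rot4)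
  qed (rule 1)
qed

lemma quad_point_rotate:
  assumes "trace B = trace A"
  shows "quad_point B C E A = rot (quad_point A B C E)"
proof -
  have "trace (C ** E ** A) = trace (A ** C ** E)" "trace (B ** E ** A) = trace (A ** B ** E)"
    "trace (B ** C ** A) = trace (A ** B ** C)"
    by (rule trace_cyc3[symmetric])+
  then show ?thesis
    using assms trace_sym[of E A] trace_sym[of B A] trace_sym[of C A] by (simp add: quad_point_def)
qed

context char_eqs begin

text \<open>\<open>T2, T1, T4, T3\<close> are \<open>t123, t124, t134, t234\<close>: each
  \<open>T\<close> is numbered by the middle of its cyclic triple, while the coordinates are ordered
  lexicographically.\<close>

abbreviation "point_of \<equiv> (t, (u1 + 1, u2 + 1, u3 + 1, u4 + 1), (p, q), (T2, T1, T4, T3))"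

lemma two_periodic_in_components:
  assumes u: "u3 = u1" "u4 = u2" and q: "q = p" and T: "T2 = T1" "T3 = T1" "T4 = T1"
  shows "point_of \<in> all_components"
proof (cases "u1 = u2")
  case False
  note two = two_values[OF u False q T]
  from two have "u1 = 0 \<and> u2 = t^2 - 3 \<or> u1 = t^2 - 3 \<and> u2 = 0" by blast
  then show ?thesis
  proof
    assume "u1 = 0 \<and> u2 = t^2 - 3"
    then have "point_of \<in> X_5_1" unfolding X_5_1_def using two u q T by simp
    then show ?thesis by (simp add: all_components_def)
  next
    assume "u1 = t^2 - 3 \<and> u2 = 0"
    then have "point_of \<in> X_5_2" unfolding X_5_2_def using two u q T by simp
    then show ?thesis by (simp add: all_components_def)
  qed
next
  case True
  have u': "u2 = u1" "u3 = u1" "u4 = u1" using u True by simp_all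
  from all_equal[OF u' q T] show ?thesis
  proof
    assume h: "T1 = t * u1 \<and> p = t^2 - 2 \<and> u1^2 - a * u1 + a = 0 \<and> a \<noteq> 4"
    define u where "u = u1 + 1"
    have "T1 = t * u - t" using h by (simp add: u_def algebra_simps)
    moreover have "t^2 \<noteq> 5" using h a by auto
    moreover have "u^2 - (t^2 + 1) * u + 2 * t^2 - 1 = 0" using h a unfolding u_def by algebra
    ultimately have "point_of \<in> X_3"
      unfolding X_3_def using h q T unfolding u' u_def[symmetric] by blast
    then show ?thesis by (simp add: all_components_def)
  next
    assume h: "p = 2 * u1 + 4 - t^2 \<and> t * T1 = u1^2 + 3 * u1 + 3 - t^2 \<and> u1 \<noteq> 0 \<and>
     T1^2 + t * (t^2 + 2 - 2 * u1) * T1 - 5 * t^2 * (u1 + 1) + t^4 + 4 * t^2 - 6 = 0"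
    define u where "u = u1 + 1"
    have "p = 2 * u + 2 - t^2" "u \<noteq> 1" using h by (simp_all add: u_def algebra_simps)
    moreover have "t * T1 = u^2 + u - t^2 + 1" using h unfolding u_def by algebra
    moreover have "T1^2 + t * (t^2 + 4 - 2 * u) * T1 - 5 * t^2 * u + t^4 + 4 * t^2 - 6 = 0"
      using h by (simp add: u_def algebra_simps)
    ultimately have "point_of \<in> X_4"
      unfolding X_4_def using q T unfolding u' u_def[symmetric] by blast
    then show ?thesis by (simp add: all_components_def)
  qed
qed

lemma zero_in_X_6_1:
  assumes u: "u1 = 0" "u2 = 0" "u3 = 0" "u4 = 0" and p: "p = 1" and q: "q = 2 * a + 1 - a^2" and a2: "a \<noteq> 2"
    and T: "T1 = t * (2 - a)" "T2 = 0" "T3 = t * (2 - a)" "T4 = 0"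
  shows "point_of \<in> all_components"
proof -
  have "t^2 \<noteq> 3" using a a2 by auto
  moreover have "q = 4 * t^2 - 2 - t^4" using q a by algebra
  moreover have "t * (2 - a) = 3 * t - t^3" using a by algebra
  ultimately have "point_of \<in> X_6_1" unfolding X_6_1_def using u p T by simp
  then show ?thesis by (simp add: all_components_def)
qed

lemma zero_in_X_6_2:
  assumes u: "u1 = 0" "u2 = 0" "u3 = 0" "u4 = 0" and a0: "a = 0" and "p = 1" "q = 1"
    and T: "T1 = 0" "T2 = 2 * t" "T3 = 0" "T4 = 2 * t"
  shows "point_of \<in> all_components"
proof -
  have t2: "t^2 = 1" using a a0 by simp
  then have "t^4 = 1" "t^3 = t" by (simp_all add: power4_eq_xxxx power3_eq_cube power2_eq_square)
  then have "point_of \<in> X_6_2" unfolding X_6_2_def using assms t2 by simp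
  then show ?thesis by (simp add: all_components_def)
qed

lemma p_one_in_X_1_1:
  assumes a0: "a \<noteq> 0" and p: "p = 1" and q: "q \<noteq> 1" and ne: "u2 \<noteq> u4" "u1 \<noteq> u3"
  shows "point_of \<in> all_components"
proof -
  note u = p_one_not_adjacent[OF assms]
  have pq: "p \<noteq> q" using p q by simp
  have ne': "u1 \<noteq> u2" using ne u by simp
  note S = two_pairs(1,2)[OF a0 pq ne, unfolded u]
  note pp = p_one_pairs[OF a0 p q u ne' S(2,1)]
  define x \<mu> where "x = u1" and "\<mu> = u1 + u2"
  have u2: "u2 = \<mu> - x" by (simp add: x_def \<mu>_def)
  have c: "cond_1 a \<mu> x"
    unfolding cond_1_iff using pp(1,2) a0 ne' by (simp add: x_def \<mu>_def)
  have "q = \<tau> a \<mu>"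
    using pp(3) a0 unfolding \<tau>_def \<mu>_def[symmetric] by (simp add: field_simps power2_eq_square power3_eq_cube power4_eq_xxxx)
  moreover have "T2 = t * \<mu> / a" "T4 = t * \<mu> / a"
    using pp(4,5) a0 by (simp_all add: \<mu>_def field_simps)
  moreover have "T1 = t * \<sigma>_plus a \<mu> x" "T3 = t * \<sigma>_minus a \<mu> x"
  proof -
    have "a * \<sigma>_plus a \<mu> x = (1 + a) * \<mu> - 2 * a + \<mu> * x - \<mu>^2"
      "a * \<sigma>_minus a \<mu> x = (1 + a) * \<mu> - 2 * a - \<mu> * x"
      using a0 by (simp_all add: \<sigma>_plus_def \<sigma>_minus_def field_simps power2_eq_square)
    then have "a * T1 = a * (t * \<sigma>_plus a \<mu> x)" "a * T3 = a * (t * \<sigma>_minus a \<mu> x)"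
      using pp(6,7) unfolding \<mu>_def[symmetric] unfolding x_def[symmetric] by (metis mult.left_commute)+
    with a0 show "T1 = t * \<sigma>_plus a \<mu> x" "T3 = t * \<sigma>_minus a \<mu> x" by simp_all
  qed
  moreover have "u1 + 1 = x + 1" "u4 + 1 = x + 1" "u2 + 1 = \<mu> + 1 - x" "u3 + 1 = \<mu> + 1 - x"
    unfolding u u2 x_def[symmetric] by simp_all
  ultimately have "point_of \<in> X_1_1"
    unfolding X_1_1_def using a c p by blast
  then show ?thesis by (simp add: all_components_def)
qed

lemma pq_one_in_X_2_1:
  assumes a0: "a \<noteq> 0" and p: "p = 1" and q: "q = 1" and u4: "u4 = u2" and ne: "u1 \<noteq> u3"
  shows "point_of \<in> all_components"
proof -
  note pp = pq_one_pairs[OF assms]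
  define z \<gamma> \<gamma>' where "z = u2" and "\<gamma> = u1 - a + 2" and "\<gamma>' = u3 - a + 2"
  note g = pp[folded z_def \<gamma>_def \<gamma>'_def]
  have z0: "z \<noteq> 0" using g(1) a0 by auto
  then have g0: "\<gamma> \<noteq> 0" using g(2) by auto
  have g': "\<gamma>' = z^2 / \<gamma>" using g(2) g0 by (simp add: field_simps)
  have "\<gamma>^2 + ((a - 2) * z^2 - 2 * z) * \<gamma> + z^2 = 0" using g(2,3) by algebra
  moreover have "\<gamma>^2 \<noteq> z^2"
  proof
    assume "\<gamma>^2 = z^2"
    then have "\<gamma> * (\<gamma> - \<gamma>') = 0" using g(2) by algebra
    with g0 ne show False by (simp add: \<gamma>_def \<gamma>'_def)
  qed
  ultimately have c: "cond_2 a z \<gamma>" unfolding cond_2_iff using a0 g(1) by simp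
  have "u1 + 1 = \<gamma> + a - 1" "u2 + 1 = z + 1" "u4 + 1 = z + 1" "u3 + 1 = z^2 / \<gamma> + a - 1"
    unfolding u4 g'[symmetric] by (simp_all add: z_def \<gamma>_def \<gamma>'_def)
  moreover have "T1 = t + t * z * \<gamma> / a" "T2 = t + t * z * \<gamma> / a"
    using g(4,5) a0 by (simp_all add: field_simps)
  moreover have "T3 = t + t * z^3 / (a * \<gamma>)" "T4 = t + t * z^3 / (a * \<gamma>)"
    using g(6,7) a0 g0 unfolding g' by (simp_all add: field_simps power2_eq_square power3_eq_cube)
  ultimately have "point_of \<in> X_2_1"
    unfolding X_2_1_def using a c p q by blast
  then show ?thesis by (simp add: all_components_def)
qed

lemma point_in_components:
  assumes "\<not> (a \<noteq> 0 \<and> p \<noteq> 1 \<and> q = 1)" "\<not> (a \<noteq> 0 \<and> p = 1 \<and> q = 1 \<and> u3 = u1 \<and> u4 \<noteq> u2)"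
  shows "point_of \<in> all_components"
proof (cases "a = 0")
  case True
  from a_zero[OF True] show ?thesis
    using two_periodic_in_components zero_in_X_6_1 zero_in_X_6_2 True
    by (elim disjE conjE) (simp_all add: mult.commute)
next
  case a0: False
  show ?thesis
  proof (cases "p = 1")
    case p: True
    show ?thesis
    proof (cases "q = 1")
      case q: True
      show ?thesis
      proof (cases "u4 = u2")
        case True
        show ?thesis
        proof (cases "u3 = u1")
          case u3: True
          have "q = p" using p q by simp
          then show ?thesis using two_periodic_in_components T_equal a0 True u3 by blast
        next
          case False
          then show ?thesis using pq_one_in_X_2_1[OF a0 p q True] by simp
        qed
      next
        case False
        then show ?thesis using pq_one[OF a0 p q] assms(2) a0 p q by blast
      qed
    next
      case q: False
      show ?thesis
      proof (cases "u2 = u4 \<or> u1 = u3")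
        case True
        have "p \<noteq> q" using p q by simp
        note u = alternating_zero[OF a0 this True]
        from p_one_zero[OF a0 p q u] show ?thesis using zero_in_X_6_1[OF u p] by blast
      next
        case False
        then show ?thesis using p_one_in_X_1_1[OF a0 p q] by blast
      qed
    qed
  next
    case p: False
    then have "q \<noteq> 1" using assms(1) a0 by blast
    from generic[OF a0 p this] show ?thesis
      using two_periodic_in_components T_equal a0 by blast
  qed
qed

end

lemma (in knot_rep) rotated: "knot_rep B C E A"
proof
  show "knot_quad B C E A" using quad by (rule knot_quad_rotate)
  have "{B, C, E, A} = {A, B, C, E}" by auto
  then show "\<not> common_eigenvector {B, C, E, A}" using irred by simp
qed

context knot_rep begin

interpretation eqs: char_eqs t "t^2 - 1" "trace (A ** B) - 1" "trace (B ** C) - 1" "trace (C ** E) - 1" "trace (A ** E) - 1"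
     "trace (A ** C)" "trace (B ** E)" "trace (A ** B ** E)" "trace (A ** B ** C)" "trace (B ** C ** E)"
     "trace (A ** C ** E)" cA cB cC cE b "br A B E" "br A B C" "br B C E" "br A C E"
  by (rule char_eqs)

lemma quad_point_cases:
  "quad_point A B C E \<in> all_components \<or> t^2 - 1 \<noteq> 0 \<and> trace (A ** C) \<noteq> 1 \<and> trace (B ** E) = 1 \<or>
     t^2 - 1 \<noteq> 0 \<and> trace (A ** C) = 1 \<and> trace (B ** E) = 1 \<and> trace (C ** E) = trace (A ** B) \<and> trace (A ** E) \<noteq> trace (B ** C)"
  using eqs.point_in_components unfolding quad_point_def by auto

text \<open>Rotation exchanges \<open>p\<close> with \<open>q\<close> and shifts the side traces, so
  a point in an exceptional case leaves both exceptions.\<close>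

lemma quad_point_in_components: "quad_point A B C E \<in> all_components"
proof -
  interpret r: knot_rep B C E A by (rule rotated)
  have "quad_point B C E A = rot (quad_point A B C E)"
    by (rule quad_point_rotate) (rule tr)
  then have "quad_point A B C E \<in> all_components" if "quad_point B C E A \<in> all_components"
    using that rot_components by simp
  then show ?thesis
    using quad_point_cases r.quad_point_cases tr cyc by auto
qed

end

section \<open>Realizing the points of the components\<close>

text \<open>The Gram determinant of two traceless parts, equal to four times the determinant of the
  commutator (\<open>gram2_commutator\<close>); when it is nonzero there is no common
  eigenvector.\<close>

definition gram2 :: "m2 \<Rightarrow> m2 \<Rightarrow> complex" where
  "gram2 X Y = gr X X * gr Y Y - (gr X Y)^2"

lemma exists_pair:
  "\<exists>X Y :: m2. det X = 1 \<and> det Y = 1 \<and> trace X = t \<and> trace Y = t \<and> trace (X ** Y) = p"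
proof -
  define s where "s = (t + csqrt (t^2 - 4)) / 2"
  have "2 * s - t = csqrt (t^2 - 4)" by (simp add: s_def field_simps)
  then have "(2 * s - t)^2 = t^2 - 4" by simp
  then have "s^2 - t * s + 1 = 0" by algebra
  then have s: "s * (t - s) = 1" by (simp add: power2_eq_square algebra_simps)
  \<comment> \<open>Triangular matrices with diagonal \<open>s\<close> and \<open>t - s\<close>,
    whose product is 1; the lower left corner of \<open>Y\<close> adjusts the trace of the
    product.\<close>
  define X :: m2 where "X = vector [vector [s, 1], vector [0, t - s]]"
  define Y :: m2 where "Y = vector [vector [s, 0], vector [p + 2 - t^2, t - s]]"
  have "trace (X ** Y) = p"
    using s unfolding X_def Y_def m2_trace m2_mult_nth by simp algebra
  then show ?thesis
    using s by (intro exI[of _ X] exI[of _ Y]) (simp add: X_def Y_def m2_trace det_2)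
qed

lemma cramer3:
  fixes a1 :: complex
  assumes "det3 a1 a2 a3 b1 b2 b3 c1 c2 c3 \<noteq> 0"
  shows "\<exists>x y z. a1 * x + a2 * y + a3 * z = p \<and> b1 * x + b2 * y + b3 * z = q \<and> c1 * x + c2 * y + c3 * z = r"
proof -
  let ?D = "det3 a1 a2 a3 b1 b2 b3 c1 c2 c3"
  let ?x = "det3 p a2 a3 q b2 b3 r c2 c3" and ?y = "det3 a1 p a3 b1 q b3 c1 r c3"
    and ?z = "det3 a1 a2 p b1 b2 q c1 c2 r"
  have "a1 * ?x + a2 * ?y + a3 * ?z = p * ?D" "b1 * ?x + b2 * ?y + b3 * ?z = q * ?D"
    "c1 * ?x + c2 * ?y + c3 * ?z = r * ?D"
    unfolding det3_def by algebra+
  then show ?thesis using assms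
    by (intro exI[of _ "?x / ?D"] exI[of _ "?y / ?D"] exI[of _ "?z / ?D"])
      (simp flip: add_divide_distrib add: eq_divide_eq)
qed

text \<open>The rows are the coefficients of the linear forms \<open>gr X Z\<close>,
  \<open>gr Y Z\<close>, \<open>br X Y Z\<close> in the entries
  \<open>(Z11 - Z22, Z12, Z21)\<close>, so \<open>gram2\<close> decides whether their values can be
  prescribed.\<close>

lemma gram2_det3:
  "gram2 X Y = det3 (X$1$1 - X$2$2) (2 * X$2$1) (2 * X$1$2) (Y$1$1 - Y$2$2) (2 * Y$2$1) (2 * Y$1$2)
     (X$1$2 * Y$2$1 - Y$1$2 * X$2$1)
     ((Y$1$1 - Y$2$2) * X$2$1 - (X$1$1 - X$2$2) * Y$2$1)
     ((X$1$1 - X$2$2) * Y$1$2 - (Y$1$1 - Y$2$2) * X$1$2)"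
  unfolding gram2_def gr_entries det3_def by algebra

lemma exists_third:
  assumes "gram2 X Y \<noteq> 0"
  shows "\<exists>Z. trace Z = m \<and> gr X Z = a \<and> gr Y Z = b \<and> br X Y Z = d"
proof -
  obtain h e f where hef: "(X$1$1 - X$2$2) * h + (2 * X$2$1) * e + (2 * X$1$2) * f = a"
    "(Y$1$1 - Y$2$2) * h + (2 * Y$2$1) * e + (2 * Y$1$2) * f = b"
    "(X$1$2 * Y$2$1 - Y$1$2 * X$2$1) * h + ((Y$1$1 - Y$2$2) * X$2$1 - (X$1$1 - X$2$2) * Y$2$1) * e
      + ((X$1$1 - X$2$2) * Y$1$2 - (Y$1$1 - Y$2$2) * X$1$2) * f = d"
    using cramer3[OF assms[unfolded gram2_det3], of a b d] by blast
  define Z :: m2 where "Z = vector [vector [(m + h) / 2, e], vector [f, (m - h) / 2]]"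
  have Z: "Z$1$1 - Z$2$2 = h" "Z$1$2 = e" "Z$2$1 = f" "trace Z = m"
    by (simp_all add: Z_def m2_trace field_simps)
  show ?thesis
    using hef by (intro exI[of _ Z]) (simp add: gr_entries br_entries Z, simp add: algebra_simps)
qed

lemma zero_of_orthogonal:
  assumes "gram2 X Y \<noteq> 0" "trace Z = 0" "gr X Z = 0" "gr Y Z = 0" "br X Y Z = 0"
  shows "Z = 0"
proof -
  let ?h = "Z$1$1 - Z$2$2"
  have "gram2 X Y * ?h = 0" "gram2 X Y * Z$1$2 = 0" "gram2 X Y * Z$2$1 = 0"
    using assms(3-5) unfolding gram2_det3 det3_def gr_entries br_entries by algebra+
  then have 1: "?h = 0" "Z$1$2 = 0" "Z$2$1 = 0" using assms(1) by simp_all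
  moreover have "2 * Z$1$1 = 0" "2 * Z$2$2 = 0" using 1 assms(2) unfolding m2_trace by algebra+
  ultimately show ?thesis by (simp add: m2_eq_iff)
qed

lemma m2_diff_mult: "((M::m2) - N) ** X = M ** X - N ** X" "X ** ((M::m2) - N) = X ** M - X ** N"
  by (simp_all add: m2_simps algebra_simps)

lemma gr_square: "gr X X = (trace X)^2 - 4 * det X"
  unfolding gr_def m2_trace m2_mult_nth det_2 by algebra

lemma gr_sym: "gr X Y = gr Y X"
  using trace_sym[of X Y] by (simp add: gr_def)

lemma br_flip: "br X Z Y = - br X Y Z"
  by (simp add: br_def)

lemma equal_of_traces:
  assumes "gram2 X Y \<noteq> 0" and "trace M = trace N" "trace (M ** X) = trace (N ** X)"
    "trace (M ** Y) = trace (N ** Y)" "trace (M ** X ** Y) = trace (N ** X ** Y)"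
  shows "M = N"
proof -
  have 0: "trace (M - N) = 0" using assms by (simp add: trace_sub)
  have X: "trace (X ** (M - N)) = 0" and Y: "trace (Y ** (M - N)) = 0"
    using assms by (simp_all add: trace_sym[of X] trace_sym[of Y] m2_diff_mult trace_sub)
  have "trace (X ** Y ** (M - N)) = 0"
    using assms trace_sym[of "X ** Y" "M - N"] by (simp add: m2_diff_mult trace_sub matrix_mul_assoc)
  then have "br X Y (M - N) = 0" unfolding br_eq using 0 X Y by simp
  then have "M - N = 0" using zero_of_orthogonal[of X Y "M - N"] assms(1) 0 X Y by (simp add: gr_def)
  then show ?thesis by simp
qed

lemma gram2_commutator: "gram2 X Y = 4 * det (X ** Y - Y ** X)"
  unfolding gram2_def gr_entries det_2 vector_minus_component m2_mult_nth by algebra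

text \<open>A common eigenvector is killed by the commutator, which is invertible here.\<close>

lemma no_common_eigenvector:
  assumes "gram2 X Y \<noteq> 0" "X \<in> S" "Y \<in> S"
  shows "\<not> common_eigenvector S"
proof
  assume "common_eigenvector S"
  then obtain v c d where v: "v \<noteq> 0" and "X *v v = c *s v" "Y *v v = d *s v"
    using assms(2,3) unfolding common_eigenvector_def by blast
  then have "(X ** Y - Y ** X) *v v = 0"
    by (simp add: matrix_vector_mult_diff_rdistrib vector_scalar_commute mult.commute flip: matrix_vector_mul_assoc)
  moreover have "invertible (X ** Y - Y ** X)"
    using assms(1) invertible_det_nz[of "X ** Y - Y ** X"] unfolding gram2_commutator by simp
  ultimately show False
    using v matrix_left_invertible_ker[of "X ** Y - Y ** X"] invertible_left_inverse by blast
qed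

text \<open>After \<open>A\<close> and \<open>C\<close>, the matrices \<open>B\<close> and
  \<open>E\<close> are determined by linear data. Their determinants, \<open>gr B E\<close> and the
  remaining triple traces cannot be prescribed as well; the Gram relations force them to the
  required values.\<close>

lemma exists_quad:
  fixes t a12 a23 a34 a14 p q T1 T2 T3 T4 :: complex
  defines "g \<equiv> t^2 - 4" and "g12 \<equiv> 2 * a12 - t^2" and "g23 \<equiv> 2 * a23 - t^2" and "g34 \<equiv> 2 * a34 - t^2"
    and "g14 \<equiv> 2 * a14 - t^2" and "g13 \<equiv> 2 * p - t^2" and "g24 \<equiv> 2 * q - t^2"
    and "D1 \<equiv> 2 * T1 - t * (a12 + a14 + q) + t^3" and "D2 \<equiv> 2 * T2 - t * (a12 + a23 + p) + t^3"
    and "D3 \<equiv> 2 * T3 - t * (a23 + a34 + q) + t^3" and "D4 \<equiv> 2 * T4 - t * (a34 + a14 + p) + t^3"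
  assumes N: "(p - 2) * (p + 2 - t^2) \<noteq> 0"
    and S2: "4 * D2^2 = - det3 g g13 g12 g13 g g23 g12 g23 g"
    and S4: "4 * D4^2 = - det3 g g13 g14 g13 g g34 g14 g34 g"
    and S24: "4 * (- D2) * D4 = - det3 g g13 g14 g13 g g34 g12 g23 g24"
    and L1: "D3 * g - D4 * g12 + D1 * g13 - D2 * g14 = 0"
    and L3: "D3 * g13 - D4 * g23 + D1 * g - D2 * g34 = 0"
  shows "\<exists>A B C E. det A = 1 \<and> det B = 1 \<and> det C = 1 \<and> det E = 1 \<and> trace B = t \<and> trace C = t \<and> trace E = t \<and>
    gram2 A C \<noteq> 0 \<and> quad_point A B C E = (t, (a12, a23, a34, a14), (p, q), (T2, T1, T4, T3))"
proof -
  obtain A C :: m2 where AC: "det A = 1" "det C = 1" "trace A = t" "trace C = t" "trace (A ** C) = p"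
    using exists_pair by blast
  have gAC: "gr A A = g" "gr C C = g" "gr A C = g13" "gr C A = g13"
    using AC gr_sym[of A C] by (simp_all add: gr_square g_def g13_def, simp_all add: gr_def power2_eq_square)
  have \<Delta>: "gram2 A C = g^2 - g13^2"
    by (simp add: gram2_def gAC power2_eq_square)
  also have "\<dots> = - 4 * ((p - 2) * (p + 2 - t^2))"
    unfolding g_def g13_def by algebra
  finally have nd: "gram2 A C \<noteq> 0" using N by simp
  then have nd': "g^2 - g13^2 \<noteq> 0" using \<Delta> by simp
  \<comment> \<open>The sign comes from transposing \<open>B\<close> and \<open>C\<close> in
    \<open>br\<close>.\<close>
  obtain B where B: "trace B = t" "gr A B = g12" "gr C B = g23" "br A C B = - D2"
    using exists_third[OF nd] by blast
  obtain E where E: "trace E = t" "gr A E = g14" "gr C E = g34" "br A C E = D4"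
    using exists_third[OF nd] by blast
  have gBA: "gr B A = g12" "gr B C = g23" and gEA: "gr E A = g14" "gr E C = g34"
    using B E gr_sym[of B] gr_sym[of E] by simp_all
  \<comment> \<open>\<open>S2\<close> is the Gram relation with \<open>g\<close> in place of the
    unknown \<open>gr B B\<close>, which enters linearly with this factor.\<close>
  have "(g^2 - g13^2) * (gr B B - g) = 0"
    using br_mult_br[of A C B A C B] S2 unfolding gAC B gBA det3_def by algebra
  then have "gr B B = g" using nd' by simp
  then have detB: "det B = 1" using B(1) by (simp add: gr_square g_def)
  have "(g^2 - g13^2) * (gr E E - g) = 0"
    using br_mult_br[of A C E A C E] S4 unfolding gAC E gEA det3_def by algebra
  then have "gr E E = g" using nd' by simp
  then have detE: "det E = 1" using E(1) by (simp add: gr_square g_def)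
  have "(g^2 - g13^2) * (gr B E - g24) = 0"
    using br_mult_br[of A C B A C E] S24 unfolding gAC B gBA E gEA det3_def by algebra
  then have gBE: "gr B E = g24" using nd' by simp
  have "br B C E * g - D4 * g12 + br A B E * g13 - D2 * g14 = 0"
    "br B C E * g13 - D4 * g23 + br A B E * g - D2 * g34 = 0"
    using br_linear[of B C E A A] br_linear[of B C E A C] br_flip[of A C B]
    unfolding gAC B gBA E gEA by (simp_all add: B)
  \<comment> \<open>The two dependencies form a linear system for \<open>br A B E\<close> and
    \<open>br B C E\<close> whose determinant is this factor up to sign.\<close>
  then have "(g^2 - g13^2) * (br A B E - D1) = 0" "(g^2 - g13^2) * (br B C E - D3) = 0"
    using L1 L3 by algebra+
  then have D: "br A B E = D1" "br B C E = D3" using nd' by simp_all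
  have tr2: "trace (A ** B) = a12" "trace (B ** C) = a23" "trace (C ** E) = a34" "trace (A ** E) = a14"
    "trace (B ** E) = q"
    using B gBA E gEA gBE AC unfolding gr_def g12_def g23_def g34_def g14_def g24_def
    by (simp_all add: power2_eq_square)
  have "br A B C = D2" using B(4) br_flip[of A C B] by simp
  then have tr3: "trace (A ** B ** C) = T2" "trace (A ** C ** E) = T4" "trace (A ** B ** E) = T1" "trace (B ** C ** E) = T3"
    using E(4) D unfolding br_eq D1_def D2_def D3_def D4_def
    by (simp_all add: AC B E tr2 power3_eq_cube algebra_simps)
  show ?thesis
    using AC B(1) E(1) detB detE nd tr2 tr3 unfolding quad_point_def by auto
qed

section \<open>Testing the relations against the basis \<open>1, A, C, A ** C\<close>\<close>

lemma trace_word_left: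
  assumes "det X = 1" "trace X = t" "trace L = t" "trace R = t" "trace Z = t"
  shows "trace (crossing L X R ** X ** Z) = crossing_coeff L X R * (t * trace (X ** Z) - t)
    - (t^2 - trace (X ** R)) * (t * trace (X ** Z) - trace (L ** X ** Z))
    + t * trace (R ** Z) - trace (L ** R ** Z)"
proof -
  have "trace (crossing L X R ** X ** Z) = crossing_coeff L X R * trace (X ** X ** Z)
      - trace (adj2 L ** (X ** adj2 R ** X) ** Z)"
    using trace_crossing[OF assms(1), of L R "X ** Z"] by (simp add: matrix_mul_assoc)
  also have "trace (X ** X ** Z) = t * trace (X ** Z) - t"
    unfolding m2_square assms by (simp add: m2_diff_mult trace_sub trace_scale assms flip: matrix_mul_assoc)
  also have "trace (X ** adj2 R) = t^2 - trace (X ** R)"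
    using trace_adj2_mult[of R X] trace_sym[of X] assms by (simp add: power2_eq_square)
  then have "X ** adj2 R ** X = mat (t^2 - trace (X ** R)) ** X - R"
    using sandwich[OF assms(1), of "adj2 R"] by simp
  also have "trace (adj2 L ** (mat (t^2 - trace (X ** R)) ** X - R) ** Z)
      = (t^2 - trace (X ** R)) * trace (adj2 L ** (X ** Z)) - trace (adj2 L ** (R ** Z))"
    by (simp add: m2_simps algebra_simps)
  also have "\<dots> = (t^2 - trace (X ** R)) * (t * trace (X ** Z) - trace (L ** X ** Z)) - (t * trace (R ** Z) - trace (L ** R ** Z))"
    unfolding trace_adj2_mult assms by (simp add: matrix_mul_assoc)
  finally show ?thesis by simp
qed

lemma trace_word_right:
  assumes "det X = 1" "trace X = t" "trace L = t" "trace R = t" "trace Z = t"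
  shows "trace (crossing L X R ** Z ** X) = crossing_coeff L X R * (t * trace (X ** Z) - t)
    - (t^2 - trace (L ** X)) * (t * trace (X ** Z) - trace (X ** R ** Z))
    + t * trace (L ** Z) - trace (L ** R ** Z)"
proof -
  have "trace (crossing L X R ** Z ** X) = crossing_coeff L X R * trace (X ** Z ** X)
      - trace (adj2 L ** X ** adj2 R ** Z ** X)"
    using trace_crossing[OF assms(1), of L R "Z ** X"] by (simp add: matrix_mul_assoc)
  also have "trace (X ** Z ** X) = trace (X ** X ** Z)"
    using trace_sym[of "X ** Z" X] by (simp add: matrix_mul_assoc)
  also have "trace (X ** X ** Z) = t * trace (X ** Z) - t"
    unfolding m2_square assms by (simp add: m2_diff_mult trace_sub trace_scale assms flip: matrix_mul_assoc)
  also have "trace (adj2 L ** X ** adj2 R ** Z ** X) = trace ((X ** adj2 L ** X) ** adj2 R ** Z)"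
    using trace_sym[of "adj2 L ** X ** adj2 R ** Z" X] by (simp add: matrix_mul_assoc)
  also have "trace (X ** adj2 L) = t^2 - trace (L ** X)"
    using trace_adj2_mult[of L X] trace_sym[of X] assms by (simp add: power2_eq_square)
  then have "X ** adj2 L ** X = mat (t^2 - trace (L ** X)) ** X - L"
    using sandwich[OF assms(1), of "adj2 L"] by simp
  also have "trace ((mat (t^2 - trace (L ** X)) ** X - L) ** adj2 R ** Z)
      = (t^2 - trace (L ** X)) * trace (adj2 R ** (Z ** X)) - trace (adj2 R ** (Z ** L))"
    by (simp add: m2_simps algebra_simps)
  also have "\<dots> = (t^2 - trace (L ** X)) * (t * trace (X ** Z) - trace (X ** R ** Z)) - (t * trace (L ** Z) - trace (L ** R ** Z))"
    unfolding trace_adj2_mult assms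
    using trace_sym[of Z X] trace_sym[of Z L] trace_cyc3[of X R Z] trace_cyc3[of L R Z] by (simp add: matrix_mul_assoc)
  finally show ?thesis by simp
qed

lemma trace_word_middle:
  assumes "det X = 1" "det L = 1" "det R = 1"
  shows "trace (crossing L X R ** R ** L) = crossing_coeff L X R * trace (L ** X ** R) - trace X"
proof -
  have "trace (crossing L X R ** R ** L) = crossing_coeff L X R * trace (X ** R ** L)
      - trace (adj2 L ** (X ** (adj2 R ** R) ** L))"
    using trace_crossing[OF assms(1), of L R "R ** L"] by (simp add: matrix_mul_assoc)
  also have "trace (adj2 L ** (X ** (adj2 R ** R) ** L)) = trace X"
    using trace_conjugate[of L "adj2 L" X] adj2_right[of L] adj2_left[of R] assms by simp
  finally show ?thesis using trace_cyc3[of L X R] by simp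
qed

text \<open>Polarised Cayley-Hamilton for \<open>A ** C + C ** A\<close>. It serves the word centred
  at \<open>B\<close>, where the product with \<open>C ** A\<close> is the one that cancels
  (\<open>trace_word_middle\<close>).\<close>

lemma trace_anticommute:
  "trace (W ** A ** C) = - trace (W ** C ** A) + trace A * trace (W ** C) + trace C * trace (W ** A)
     + (trace (A ** C) - trace A * trace C) * trace (W::m2)"
  unfolding m2_simps by algebra

text \<open>The fields up to \<open>L3\<close> provide the four matrices through
  \<open>exists_quad\<close>. The fields \<open>b1\<close> to \<open>b4\<close> compare the words
  against 1, those named \<open>A\<close> and \<open>C\<close> against \<open>x1\<close> and
  \<open>x3\<close>, and those named \<open>R\<close> against \<open>x1 x3\<close>, with the word
  centred at \<open>x4\<close> as reference. Everything is polynomial, so a family is realized by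
  substituting its coordinates.\<close>

locale trace_data =
  fixes t a12 a23 a34 a14 p q T1 T2 T3 T4 c1 c2 c3 c4 b Q :: complex
  assumes nd: "(p - 2) * (p + 2 - t^2) \<noteq> 0"
    and S2: "4 * (2 * T2 - t * (a12 + a23 + p) + t^3)^2 =
      - det3 (t^2 - 4) (2 * p - t^2) (2 * a12 - t^2) (2 * p - t^2) (t^2 - 4) (2 * a23 - t^2)
             (2 * a12 - t^2) (2 * a23 - t^2) (t^2 - 4)"
    and S4: "4 * (2 * T4 - t * (a34 + a14 + p) + t^3)^2 =
      - det3 (t^2 - 4) (2 * p - t^2) (2 * a14 - t^2) (2 * p - t^2) (t^2 - 4) (2 * a34 - t^2)
             (2 * a14 - t^2) (2 * a34 - t^2) (t^2 - 4)"
    and S24: "4 * (- (2 * T2 - t * (a12 + a23 + p) + t^3)) * (2 * T4 - t * (a34 + a14 + p) + t^3) =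
      - det3 (t^2 - 4) (2 * p - t^2) (2 * a14 - t^2) (2 * p - t^2) (t^2 - 4) (2 * a34 - t^2)
             (2 * a12 - t^2) (2 * a23 - t^2) (2 * q - t^2)"
    and L1: "(2 * T3 - t * (a23 + a34 + q) + t^3) * (t^2 - 4) - (2 * T4 - t * (a34 + a14 + p) + t^3) * (2 * a12 - t^2)
      + (2 * T1 - t * (a12 + a14 + q) + t^3) * (2 * p - t^2) - (2 * T2 - t * (a12 + a23 + p) + t^3) * (2 * a14 - t^2) = 0"
    and L3: "(2 * T3 - t * (a23 + a34 + q) + t^3) * (2 * p - t^2) - (2 * T4 - t * (a34 + a14 + p) + t^3) * (2 * a23 - t^2)
      + (2 * T1 - t * (a12 + a14 + q) + t^3) * (t^2 - 4) - (2 * T2 - t * (a12 + a23 + p) + t^3) * (2 * a34 - t^2) = 0"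
    and c1: "c1 = t * T1 - a12 * a14 + t^2 - q" and c2: "c2 = t * T2 - a12 * a23 + t^2 - p"
    and c3: "c3 = t * T3 - a23 * a34 + t^2 - q" and c4: "c4 = t * T4 - a34 * a14 + t^2 - p"
    and Q: "2 * Q = t * (T1 + T2 + T3 + T4) + a12 * a34 + a23 * a14 - p * q - t^2 * (a12 + a23 + a34 + a14) + t^4"
    and b1: "b = t * c1 - t^3 + t * (a14 + a12) - T1" and b2: "b = t * c2 - t^3 + t * (a12 + a23) - T2"
    and b3: "b = t * c3 - t^3 + t * (a23 + a34) - T3" and b4: "b = t * c4 - t^3 + t * (a34 + a14) - T4"
    and A2: "t * b - c1 = c2 * a12 - (t^2 - a23)" and A4: "t * b - c1 = c4 * a14 - (t^2 - a34)"
    and A3: "t * b - c1 = c3 * p - (t^2 * p - t * (T2 + T4) + Q)"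
    and C2: "t * b - c3 = c2 * a23 - (t^2 - a12)" and C4: "t * b - c3 = c4 * a34 - (t^2 - a14)"
    and C1: "t * b - c3 = c1 * p - (t^2 * p - t * (T2 + T4) + Q)"
    and R1: "c4 * T4 - t = c1 * (t * p - t) - (t^2 - a12) * (t * p - T4) + t * a23 - T3"
    and R3: "c4 * T4 - t = c3 * (t * p - t) - (t^2 - a23) * (t * p - T4) + t * a12 - T1"
    and R2: "c4 * T4 - t = - (c2 * T2 - t) + t * (t * b - c1) + t * (t * b - c3) + (p - t^2) * b"
begin

lemma realizable:
  "\<exists>A B C E. knot_quad A B C E \<and> \<not> common_eigenvector {A, B, C, E} \<and>
     quad_point A B C E = (t, (a12, a23, a34, a14), (p, q), (T2, T1, T4, T3))"
proof -
  obtain A B C E where det: "det A = 1" "det B = 1" "det C = 1" "det E = 1"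
    and tr': "trace B = t" "trace C = t" "trace E = t"
    and gram: "gram2 A C \<noteq> 0"
    and pt: "quad_point A B C E = (t, (a12, a23, a34, a14), (p, q), (T2, T1, T4, T3))"
    using exists_quad[OF nd S2 S4 S24 L1 L3] by blast
  have tr: "trace A = t" "trace B = t" "trace C = t" "trace E = t"
    and tr2: "trace (A ** B) = a12" "trace (B ** C) = a23" "trace (C ** E) = a34" "trace (A ** E) = a14"
      "trace (A ** C) = p" "trace (B ** E) = q"
    and tr3: "trace (A ** B ** C) = T2" "trace (A ** B ** E) = T1" "trace (A ** C ** E) = T4" "trace (B ** C ** E) = T3"
    using pt tr' by (simp_all add: quad_point_def)
  have sy: "trace (E ** A) = a14" "trace (C ** A) = p" "trace (B ** A) = a12" "trace (C ** B) = a23"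
    "trace (E ** C) = a34" "trace (E ** B) = q"
    using tr2 trace_sym[of A E] trace_sym[of A C] trace_sym[of A B] trace_sym[of B C] trace_sym[of C E] trace_sym[of B E] by simp_all
  have cy: "trace (E ** A ** B) = T1" "trace (C ** E ** A) = T4" "trace (E ** A ** C) = T4" "trace (E ** B ** C) = T3"
    "trace (B ** C ** A) = T2" "trace (B ** E ** A) = T1"
    using tr3 trace_cyc3[of E A B] trace_cyc3[of A C E] trace_cyc3[of E A C] trace_cyc3[of E B C]
      trace_cyc3[of A B C] trace_cyc3[of A B E] by simp_all
  have cc: "crossing_coeff E A B = c1" "crossing_coeff A B C = c2" "crossing_coeff B C E = c3" "crossing_coeff C E A = c4"
    unfolding c1 c2 c3 c4 by (simp_all add: crossing_coeff_eq det tr tr2 tr3 sy cy power2_eq_square mult.commute)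
  have bb: "trace (crossing E A B) = b" "trace (crossing A B C) = b" "trace (crossing B C E) = b" "trace (crossing C E A) = b"
    using trace_crossing_1[of A E t B] trace_crossing_1[of B A t C] trace_crossing_1[of C B t E] trace_crossing_1[of E C t A]
      b1 b2 b3 b4 by (simp_all add: det tr tr2 tr3 sy cy cc)
  have Q4: "trace (A ** B ** C ** E) = Q"
  proof -
    have "2 * trace (A ** B ** C ** E) = 2 * Q"
      unfolding trace4 Q tr tr2 tr3 by algebra
    then show ?thesis by simp
  qed
  have Q4': "trace (E ** A ** B ** C) = Q" "trace (B ** C ** E ** A) = Q"
    using Q4 trace_sym[of E "A ** B ** C"] trace_sym[of A "B ** C ** E"] by (simp_all add: matrix_mul_assoc)
  have o: "trace (crossing B C E ** A) = c3 * p - (t^2 * p - t * (T2 + T4) + Q)"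
    "trace (crossing E A B ** C) = c1 * p - (t^2 * p - t * (T2 + T4) + Q)"
    using trace_crossing_opposite[of C B t E A] trace_crossing_opposite[of A E t B C]
    by (simp_all add: det tr tr2 tr3 sy cy cc Q4' distrib_left)
  have wA: "trace (crossing E A B ** A) = t * b - c1" "trace (crossing A B C ** A) = t * b - c1"
    "trace (crossing B C E ** A) = t * b - c1" "trace (crossing C E A ** A) = t * b - c1"
    using trace_crossing_self[of A t E B] trace_crossing_left[of B A C t] trace_crossing_right[of E A C t]
      A2 A3 A4 by (simp_all add: det tr tr2 tr3 sy cy cc bb o)
  have wC: "trace (crossing E A B ** C) = t * b - c3" "trace (crossing A B C ** C) = t * b - c3"
    "trace (crossing B C E ** C) = t * b - c3" "trace (crossing C E A ** C) = t * b - c3"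
    using trace_crossing_self[of C t B E] trace_crossing_left[of E C A t] trace_crossing_right[of B C A t]
      C2 C1 C4 by (simp_all add: det tr tr2 tr3 sy cy cc bb o)
  have w4: "trace (crossing C E A ** A ** C) = c4 * T4 - t"
    using trace_word_middle[of E C A] by (simp add: det tr cy cc)
  have w1: "trace (crossing E A B ** A ** C) = c4 * T4 - t"
    using trace_word_left[of A t E B C] R1 by (simp add: det tr tr2 tr3 sy cy cc)
  have w3: "trace (crossing B C E ** A ** C) = c4 * T4 - t"
    using trace_word_right[of C t B E A] R3 by (simp add: det tr tr2 tr3 sy cy cc)
  have "trace (crossing A B C ** C ** A) = c2 * T2 - t"
    using trace_word_middle[of B A C] by (simp add: det tr tr3 cc)
  then have w2: "trace (crossing A B C ** A ** C) = c4 * T4 - t"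
    using trace_anticommute[of "crossing A B C" A C] R2 by (simp add: tr tr2 wA wC bb power2_eq_square)
  have "crossing E A B = crossing A B C" "crossing A B C = crossing B C E" "crossing B C E = crossing C E A"
    using equal_of_traces[OF gram, of "crossing E A B" "crossing A B C"] equal_of_traces[OF gram, of "crossing A B C" "crossing B C E"]
      equal_of_traces[OF gram, of "crossing B C E" "crossing C E A"] bb wA wC w1 w2 w3 w4 by simp_all
  then have "knot_quad A B C E" using det by (simp add: knot_quad_def)
  moreover have "\<not> common_eigenvector {A, B, C, E}" using no_common_eigenvector[OF gram] by simp
  ultimately show ?thesis using pt by blast
qed

end

section \<open>Realization of each family\<close>

definition realizable_point :: "point \<Rightarrow> bool" where
  "realizable_point x \<longleftrightarrow> (\<exists>A B C E. knot_quad A B C E \<and> \<not> common_eigenvector {A, B, C, E} \<and> quad_point A B C E = x)"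

lemma X_6_1_realizable:
  assumes "x \<in> X_6_1"
  shows "realizable_point x"
proof -
  obtain t where x: "x = (t, (1, 1, 1, 1), (1, 4*t^2 - 2 - t^4), (0, 3*t - t^3, 0, 3*t - t^3))" and t: "t^2 \<noteq> 3"
    using assms unfolding X_6_1_def by blast
  \<comment> \<open>The last six arguments are \<open>c1\<close> to \<open>c4\<close>,
    \<open>b\<close> and \<open>Q\<close>, solved from their defining equations. For
    \<open>p = 1\<close>, nondegeneracy of the pair \<open>A, C\<close> amounts to
    \<open>t^2 \<noteq> 3\<close>.\<close>
  interpret trace_data t 1 1 1 1 1 "4*t^2 - 2 - t^4" "3*t - t^3" 0 "3*t - t^3" 0 1 "t^2 - 2" 1 "t^2 - 2" 0 "2 - t^2"
  proof
    show "(1 - 2) * (1 + 2 - t^2) \<noteq> 0" using t by simp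
  qed (unfold det3_def, algebra+)
  show ?thesis using realizable unfolding realizable_point_def x .
qed

lemma X_2_1_realizable:
  assumes "x \<in> X_2_1"
  shows "realizable_point x"
proof -
  obtain t a z \<gamma> where a: "a = t^2 - 1" and c: "cond_2 a z \<gamma>"
    and x: "x = (t, (\<gamma> + a - 1, z + 1, z^2/\<gamma> + a - 1, z + 1), (1, 1),
             (t + t*z*\<gamma>/a, t + t*z*\<gamma>/a, t + t*z^3/(a*\<gamma>), t + t*z^3/(a*\<gamma>)))"
    using assms unfolding X_2_1_def by blast
  note nz = cond_2_nonzero[OF c]
  \<comment> \<open>With names for the two quotients all coordinates become polynomial, and
    \<open>z * y = z - 1\<close> replaces the division by \<open>a\<close>.\<close>
  define y g where "y = z / a" and "g = z^2 / \<gamma>"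
  have x': "x = (t, (\<gamma> + a - 1, z + 1, g + a - 1, z + 1), (1, 1),
             (t + t*y*\<gamma>, t + t*y*\<gamma>, t + t*y*g, t + t*y*g))"
    using nz unfolding x y_def g_def by (simp add: field_simps power2_eq_square power3_eq_cube)
  have z: "z^2 = a * z - a" and c2: "\<gamma>^2 + ((a - 2)*z^2 - 2*z)*\<gamma> + z^2 = 0"
    using c unfolding cond_2_iff by (auto simp: algebra_simps)
  have a2: "a \<noteq> 2" using c unfolding cond_2_def by simp
  have gg: "\<gamma> * g = z^2" using nz by (simp add: g_def)
  have "\<gamma> * (\<gamma> + g - (2 * z - (a - 2) * z^2)) = 0" using c2 gg by algebra
  then have "\<gamma> + g - (2 * z - (a - 2) * z^2) = 0" using nz by simp
  then have gs: "g = 2 * z - (a - 2) * z^2 - \<gamma>" by algebra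
  have ay: "a * y = z" using nz by (simp add: y_def)
  have "a * (z * y - (z - 1)) = z * (a * y) - a * z + a" by algebra
  also have "\<dots> = 0" unfolding ay using z by (simp add: power2_eq_square)
  finally have "z * y - (z - 1) = 0" using nz by simp
  then have zy: "z * y = z - 1" by simp
  have t2: "t^2 = a + 1" using a by simp
  interpret trace_data t "\<gamma> + a - 1" "z + 1" "g + a - 1" "z + 1" 1 1 "t + t*y*\<gamma>" "t + t*y*\<gamma>" "t + t*y*g" "t + t*y*g"
    "(1 - y) * (g + a)" "(1 - y) * (g + a)" "(1 - y) * (\<gamma> + a)" "(1 - y) * (\<gamma> + a)" "t * (2 * z - z^2)"
    "((1 - y) * (g + a) + (1 - y) * (\<gamma> + a) - t^2 * (2 * z - z^2) - t^2 + t * (2 * t + t*y*\<gamma> + t*y*g))"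
  proof
    show "(1 - 2) * (1 + 2 - t^2) \<noteq> 0" using t2 a2 by auto
  qed (unfold det3_def, (use t2 ay zy z gg gs in algebra)+)
  show ?thesis using realizable unfolding realizable_point_def x' .
qed

lemma X_1_1_realizable:
  assumes "x \<in> X_1_1"
  shows "realizable_point x"
proof -
  obtain t a \<mu> r where a: "a = t^2 - 1" and c: "cond_1 a \<mu> r"
    and x: "x = (t, (r + 1, \<mu> + 1 - r, \<mu> + 1 - r, r + 1), (1, \<tau> a \<mu>),
             (t*\<mu>/a, t * \<sigma>_plus a \<mu> r, t*\<mu>/a, t * \<sigma>_minus a \<mu> r))"
    using assms unfolding X_1_1_def by blast
  have a0: "a \<noteq> 0" and a2: "a \<noteq> 2" using c unfolding cond_1_def by simp_all
  \<comment> \<open>Rescaling \<mu> by \<open>a\<close> makes all coordinates polynomials in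
    \<open>a\<close>, \<open>m\<close>, \<open>r\<close> and \<open>t\<close>.\<close>
  define m where "m = \<mu> / a"
  have mu: "\<mu> = a * m" using a0 by (simp add: m_def)
  have x': "x = (t, (r + 1, a * m - r + 1, a * m - r + 1, r + 1), (1, (a^3 - 3 * a^2 + 4) * m - a^3 + 4 * a^2 - 7),
             (t * m, t * (m + a * m - 2 + m * r - a * m^2), t * m, t * (m + a * m - 2 - m * r)))"
    using a0 unfolding x mu \<tau>_def \<sigma>_plus_def \<sigma>_minus_def
    by (simp add: field_simps power2_eq_square power3_eq_cube)
  have "a * (a * (m^2 + (a - 4) * m + 4 - a)) = 0" "a * (r^2 - a * m * r + 2 * m + a - 4) = 0"
    using c unfolding cond_1_iff mu by algebra+
  then have "m^2 + (a - 4) * m + 4 - a = 0" "r^2 - a * m * r + 2 * m + a - 4 = 0"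
    using a0 by simp_all
  then have m2: "m^2 = (4 - a) * m + a - 4" and r2: "r^2 = a * m * r - 2 * m - a + 4" by algebra+
  have t2: "t^2 = a + 1" using a by simp
  interpret trace_data t "r + 1" "a * m - r + 1" "a * m - r + 1" "r + 1" 1 "(a^3 - 3 * a^2 + 4) * m - a^3 + 4 * a^2 - 7"
     "t * (m + a * m - 2 + m * r - a * m^2)" "t * m" "t * (m + a * m - 2 - m * r)" "t * m"
     "(m - 2) * r + (a^2 - 2 * a - 1) * m - a^2 + 4 * a + 1" "3 - m"
     "(m - 2) * (a * m - r) + (a^2 - 2 * a - 1) * m - a^2 + 4 * a + 1" "3 - m" "t * (a * m - 2 * m - a + 4)"
     "(a + 2) * m - 3"
  proof
    show "(1 - 2) * (1 + 2 - t^2) \<noteq> 0" using t2 a2 by auto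
  qed (unfold det3_def, (use m2 r2 t2 in algebra)+)
  show ?thesis using realizable unfolding realizable_point_def x' .
qed

lemma trace_m2_square: "trace (X ** X) = (trace (X::m2))^2 - 2 * det X"
  unfolding m2_trace m2_mult_nth det_2 by algebra

lemma gram2_values:
  assumes "det A = 1" "det B = 1" "trace A = t" "trace B = t" "trace (A ** B) = u"
  shows "gram2 A B = 4 * (u - 2) * (t^2 - 2 - u)"
  unfolding gram2_def gr_square gr_def assms by algebra

text \<open>Identifying \<open>x4\<close> with \<open>x1\<close> and \<open>x3\<close> with
  \<open>x2\<close> turns the presentation into the braid relation of the trefoil group, which
  \<open>trace (A ** B) = 1\<close> enforces.\<close>

lemma X_5_1_realizable:
  assumes "x \<in> X_5_1"
  shows "realizable_point x"
proof -
  obtain t where x: "x = (t, (1, t^2 - 2, 1, t^2 - 2), (1, 1), (0, 0, 0, 0))" and t: "t^2 \<noteq> 3"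
    using assms unfolding X_5_1_def by blast
  obtain A B :: m2 where AB: "det A = 1" "det B = 1" "trace A = t" "trace B = t" "trace (A ** B) = 1"
    using exists_pair by blast
  have "gram2 A B \<noteq> 0" using t unfolding gram2_values[OF AB] by simp
  then have irr: "\<not> common_eigenvector {A, B, B, A}" by (rule no_common_eigenvector) simp_all
  have BA: "trace (B ** A) = 1" using AB trace_sym[of A B] by simp
  have inv: "A ** adj2 A = mat 1" "adj2 A ** A = mat 1" "B ** adj2 B = mat 1" "adj2 B ** B = mat 1"
    using AB by (simp_all add: adj2_right adj2_left)
  have "A ** B ** A = A - (mat t - B)" "B ** A ** B = B - (mat t - A)"
    using sandwich[of A B] sandwich[of B A] AB BA by (simp_all add: adj2_def)
  then have braid: "A ** B ** A = B ** A ** B" by simp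
  have "crossing A A B = A ** B ** (adj2 A ** A) ** A" "crossing B A A = A ** (A ** adj2 A) ** B ** A"
    "crossing A B B = B ** (B ** adj2 B) ** A ** B" "crossing B B A = B ** A ** (adj2 B ** B) ** B"
    unfolding crossing_def by (simp_all only: matrix_mul_assoc)
  then have "crossing A A B = A ** B ** A" "crossing B A A = A ** B ** A"
    "crossing A B B = A ** B ** A" "crossing B B A = A ** B ** A"
    by (simp_all add: inv braid)
  then have "knot_quad A B B A" using AB by (simp add: knot_quad_def)
  moreover have "trace (A ** A) = t^2 - 2" "trace (B ** B) = t^2 - 2"
    "trace (A ** B ** B) = 0" "trace (A ** B ** A) = 0" "trace (B ** B ** A) = 0"
  proof -
    show "trace (A ** A) = t^2 - 2" "trace (B ** B) = t^2 - 2"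
      using AB by (simp_all add: trace_m2_square)
    have "trace (A ** A ** B) = 0" "trace (B ** B ** A) = 0"
      using AB BA by (simp_all add: m2_square m2_diff_mult trace_sub trace_scale flip: matrix_mul_assoc)
    then show "trace (A ** B ** B) = 0" "trace (A ** B ** A) = 0" "trace (B ** B ** A) = 0"
      using trace_cyc3[of A B B] trace_cyc3[of A A B] by simp_all
  qed
  moreover from this have "trace (A ** B ** A) = 0" by simp
  ultimately show ?thesis
    using irr AB BA unfolding realizable_point_def x quad_point_def by (intro exI[of _ A] exI[of _ B]) simp
qed

text \<open>Here \<open>p = t^2 - 2\<close>, so the pair \<open>A, C\<close> is degenerate.
  Identifying \<open>x3\<close> with \<open>x1\<close> and \<open>x4\<close> with \<open>x2\<close>
  gives the figure-eight knot group, and the equation for \<open>u\<close> is the one of its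
  irreducible characters.\<close>

lemma X_3_realizable:
  assumes "x \<in> X_3"
  shows "realizable_point x"
proof -
  obtain t u where x: "x = (t, (u, u, u, u), (t^2 - 2, t^2 - 2), (t*u - t, t*u - t, t*u - t, t*u - t))"
    and u: "u^2 - (t^2 + 1)*u + 2*t^2 - 1 = 0" and t: "t^2 \<noteq> 5"
    using assms unfolding X_3_def by blast
  obtain A B :: m2 where AB: "det A = 1" "det B = 1" "trace A = t" "trace B = t" "trace (A ** B) = u"
    using exists_pair by blast
  have "u \<noteq> 2" using u by auto
  moreover have "t^2 - 2 - u \<noteq> 0"
  proof
    assume "t^2 - 2 - u = 0"
    then have "t^2 - 5 = 0" using u by algebra
    with t show False by simp
  qed
  ultimately have "gram2 A B \<noteq> 0" unfolding gram2_values[OF AB] by simp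
  then have irr: "\<not> common_eigenvector {A, B, A, B}" by (rule no_common_eigenvector) simp_all
  have BA: "trace (B ** A) = u" using AB trace_sym[of A B] by simp
  have sq: "trace (A ** A) = t^2 - 2" "trace (B ** B) = t^2 - 2"
    using AB by (simp_all add: trace_m2_square)
  have t3: "trace (A ** A ** B) = t * u - t" "trace (B ** B ** A) = t * u - t"
    using AB BA by (simp_all add: m2_square m2_diff_mult trace_sub trace_scale flip: matrix_mul_assoc)
  then have t3': "trace (A ** B ** B) = t * u - t" "trace (A ** B ** A) = t * u - t" "trace (B ** A ** B) = t * u - t"
    using trace_cyc3[of A B B] trace_cyc3[of A A B] trace_cyc3[of B B A] by simp_all
  \<comment> \<open>The right hand side is symmetric in \<open>X\<close> and \<open>Y\<close>, so
    the two kinds of words agree.\<close>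
  have cross: "crossing Y X Y = mat (t^2 - u) ** (X + Y) + mat (t - (t^2 - u) * t)"
    if "det X = 1" "det Y = 1" "trace X = t" "trace Y = t" "trace (X ** Y) = u" "trace (Y ** X) = u" "trace (Y ** Y) = t^2 - 2"
      "trace (Y ** X ** Y) = t * u - t" for X Y
  proof -
    have c: "crossing_coeff Y X Y = t^2 + 1 - u"
      using u that by (simp add: crossing_coeff_eq) algebra
    have "adj2 Y ** X ** adj2 Y = mat (t^2 - u) ** adj2 Y - adj2 X"
      using sandwich[of "adj2 Y" X] that by (simp add: trace_adj2_mult power2_eq_square)
    then have "crossing Y X Y = mat (t^2 + 1 - u) ** X - (mat (t^2 - u) ** (mat t - Y) - (mat t - X))"
      using crossing_eq[of X Y Y] that c by (simp add: adj2_def)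
    then show ?thesis by (simp add: m2_simps algebra_simps)
  qed
  have "crossing B A B = crossing A B A"
    using cross[of A B] cross[of B A] AB BA sq t3' by (simp add: add.commute)
  then have "knot_quad A B A B" using AB by (simp add: knot_quad_def)
  then show ?thesis
    using irr AB BA sq t3 t3' unfolding realizable_point_def x quad_point_def by (intro exI[of _ A] exI[of _ B]) simp
qed

lemma trace_mat1: "trace (mat 1 :: m2) = 2"
  by (simp add: m2_trace m2_mat_nth)

lemma mat_commute: "X ** mat c = mat c ** (X::m2)"
  by (simp add: m2_simps)

text \<open>Explicit quadruples for the points of \<open>X_4\<close> with \<open>p = 2\<close>:
  there \<open>C\<close> is the inverse of \<open>A\<close>, so the two commute and
  \<open>trace_data\<close> does not apply.\<close>

lemma knot_quad_self_inverse:
  assumes AB: "det A = 1" "det B = 1" "trace A = t" "trace B = t" "2 * trace (A ** B) = t^2"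
    and t4: "t^4 - 6 * t^2 + 4 = 0"
  shows "knot_quad A B (adj2 A) (adj2 B)"
proof -
  define h where "h = trace (A ** B)"
  have t2: "t^2 = 2 * h" using AB by (simp add: h_def)
  \<comment> \<open>The quartic in \<open>t\<close> is what makes the crossing coefficients equal to
    \<open>h - 1\<close>.\<close>
  have h2: "4 * h - h^2 - 2 = h - 1" using t4 t2 by algebra
  \<comment> \<open>The common closed form of two consecutive words. Its invariance under inverting
    both arguments links them to the other two.\<close>
  define W where "W X Y = mat h ** (X + Y) - mat t ** (Y ** X) - mat t" for X Y :: m2
  have cross: "crossing (adj2 Y) X Y = W X Y" "crossing X Y (adj2 X) = W X Y"
    if d: "det X = 1" "det Y = 1" and t: "trace X = t" "trace Y = t" and h: "trace (X ** Y) = h" for X Y :: m2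
  proof -
    have h': "trace (Y ** X) = h" using h trace_sym[of X Y] by simp
    have inv: "X ** adj2 X = mat 1" "adj2 X ** X = mat 1" "Y ** adj2 Y = mat 1" "adj2 Y ** Y = mat 1"
      using d by (simp_all add: adj2_right adj2_left)
    have tr: "trace (adj2 Y ** X) = h" "trace (adj2 Y ** Y) = 2" "trace (Y ** adj2 X) = h" "trace (X ** adj2 X) = 2"
      using h h' t t2 trace_sym[of Y "adj2 X"] by (simp_all add: trace_adj2_mult inv trace_mat1 power2_eq_square)
    have "trace (adj2 Y ** (X ** Y)) = t" "trace (X ** (Y ** adj2 X)) = t"
      using trace_conjugate[of Y "adj2 Y" X] trace_conjugate[of "adj2 X" X Y] inv t by simp_all
    then have c: "crossing_coeff (adj2 Y) X Y = h - 1" "crossing_coeff X Y (adj2 X) = h - 1"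
      using h h' t t2 h2 tr trace_sym[of "adj2 X" X]
      by (simp_all add: crossing_coeff_eq d power2_eq_square matrix_mul_assoc)
    have "Y ** X ** Y = mat h ** Y - adj2 X" "X ** Y ** X = mat h ** X - adj2 Y"
      using sandwich[OF d(1), of Y] sandwich[OF d(2), of X] h h' by simp_all
    then have "Y ** X ** adj2 Y = mat t ** (Y ** X) - (mat h ** Y - (mat t - X))"
      "adj2 X ** Y ** X = mat t ** (Y ** X) - (mat h ** X - (mat t - Y))"
      using t by (simp_all add: adj2_def m2_diff_mult mat_commute matrix_mul_assoc)
    then show "crossing (adj2 Y) X Y = W X Y" "crossing X Y (adj2 X) = W X Y"
      unfolding crossing_eq[OF d(1)] crossing_eq[OF d(2)] c W_def
      by (simp_all add: m2_simps algebra_simps)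
  qed
  have W: "W (adj2 A) (adj2 B) = W A B"
  proof -
    have "adj2 B ** adj2 A = mat h - A ** B"
      using adj2_mult[of A B] by (simp add: adj2_def[of "A ** B"] h_def)
    also have "A ** B = mat t ** A + mat t ** B + mat (h - t^2) - B ** A"
      using AB unfolding h_def by (simp add: m2_eq_iff m2_mult_nth m2_mat_nth m2_trace power2_eq_square) algebra
    finally have BA: "adj2 B ** adj2 A = mat h - (mat t ** A + mat t ** B + mat (h - t^2) - B ** A)" .
    have "W (adj2 A) (adj2 B) = mat (t^2 - h) ** (A + B) - mat t ** (B ** A) - mat t + mat (t * (2 * h - t^2))"
      unfolding W_def BA unfolding adj2_def AB
      by (simp add: m2_eq_iff m2_mult_nth m2_mat_nth power2_eq_square algebra_simps)
    then show ?thesis unfolding W_def t2 by (simp add: m2_eq_iff m2_mult_nth m2_mat_nth)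
  qed
  have "trace (adj2 A ** adj2 B) = h"
    using adj2_mult[of B A] trace_sym[of A B] trace_adj2[of "B ** A"] by (simp add: h_def)
  then have "crossing B (adj2 A) (adj2 B) = W A B" "crossing (adj2 A) (adj2 B) A = W A B"
    using cross[of "adj2 A" "adj2 B"] AB W by simp_all
  moreover have "crossing (adj2 B) A B = W A B" "crossing A B (adj2 A) = W A B"
    using cross[of A B] AB by (simp_all add: h_def)
  ultimately show ?thesis using AB by (simp add: knot_quad_def)
qed

lemma X_4_realizable:
  assumes "x \<in> X_4"
  shows "realizable_point x"
proof -
  obtain t u \<eta> where x: "x = (t, (u, u, u, u), (2*u + 2 - t^2, 2*u + 2 - t^2), (\<eta>, \<eta>, \<eta>, \<eta>))"
    and eta: "t*\<eta> = u^2 + u - t^2 + 1" and u1: "u \<noteq> 1"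
    and quad: "\<eta>^2 + t*(t^2 + 4 - 2*u)*\<eta> - 5*t^2*u + t^4 + 4*t^2 - 6 = 0"
    using assms unfolding X_4_def by blast
  have une: "u + 2 - t^2 \<noteq> 0"
  proof
    assume "u + 2 - t^2 = 0"
    then have u: "u = t^2 - 2" by algebra
    have e: "t * \<eta> = t^4 - 4 * t^2 + 3" using eta unfolding u by algebra
    have q: "\<eta>^2 + t * (8 - t^2) * \<eta> - 4 * t^4 + 14 * t^2 - 6 = 0" using quad unfolding u by algebra
    have "(t^2 - 3)^2 = 0" using e q by algebra
    then have "t^2 = 3" by simp
    with u u1 show False by simp
  qed
  show ?thesis
  \<comment> \<open>\<open>(p - 2) * (p + 2 - t^2)\<close> equals
    \<open>2 * (2 * u - t^2) * (u + 2 - t^2)\<close>, so \<open>trace_data\<close> fails exactly in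
    the second case.\<close>
  proof (cases "2 * u = t^2")
    case False
    interpret trace_data t u u u u "2*u + 2 - t^2" "2*u + 2 - t^2" \<eta> \<eta> \<eta> \<eta> "t^2 - 1 - u" "t^2 - 1 - u" "t^2 - 1 - u" "t^2 - 1 - u"
      "t * (u - 1) - \<eta>" "u^2 - 2 * u"
    proof
      have "(2*u + 2 - t^2 - 2) * (2*u + 2 - t^2 + 2 - t^2) = 2 * (2 * u - t^2) * (u + 2 - t^2)" by algebra
      also have "\<dots> \<noteq> 0" using False une by simp
      finally show "(2*u + 2 - t^2 - 2) * (2*u + 2 - t^2 + 2 - t^2) \<noteq> 0" .
    qed (unfold det3_def, (algebra | use eta quad in algebra)+)
    show ?thesis using realizable unfolding realizable_point_def x .
  next
    case True
    obtain A B :: m2 where AB: "det A = 1" "det B = 1" "trace A = t" "trace B = t" "trace (A ** B) = u"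
      using exists_pair by blast
    have e: "4 * (t * \<eta>) = t^4 - 2 * t^2 + 4" using eta True by algebra
    have q: "2 * \<eta>^2 + 8 * (t * \<eta>) - 3 * t^4 + 8 * t^2 - 12 = 0" using quad True by algebra
    \<comment> \<open>At \<open>2 * u = t^2\<close> the two equations leave only finitely many
      \<open>t\<close>, all with \<open>\<eta> = t\<close>.\<close>
    have "(t^4 - 6 * t^2 + 4)^2 = 0" using e q by algebra
    then have t4: "t^4 - 6 * t^2 + 4 = 0" by simp
    then have t0: "t \<noteq> 0" by auto
    have "4 * (t * (\<eta> - t)) = 0" using e t4 by algebra
    with t0 have eta_t: "\<eta> = t" by simp
    have "u \<noteq> 2"
    proof
      assume "u = 2"
      with True have "t^2 = 4" by simp
      then have "t^4 = 16" by (simp add: power4_eq_xxxx power2_eq_square)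
      with t4 \<open>t^2 = 4\<close> show False by simp
    qed
    moreover have "t^2 - 2 - u \<noteq> 0" using une by algebra
    ultimately have "gram2 A B \<noteq> 0" unfolding gram2_values[OF AB] by simp
    then have irr: "\<not> common_eigenvector {A, B, adj2 A, adj2 B}" by (rule no_common_eigenvector) simp_all
    have kq: "knot_quad A B (adj2 A) (adj2 B)" by (rule knot_quad_self_inverse) (use AB True t4 in simp_all)
    have inv: "A ** adj2 A = mat 1" "B ** adj2 B = mat 1" using AB by (simp_all add: adj2_right)
    have BA: "trace (B ** A) = u" using AB trace_sym[of A B] by simp
    have tr: "trace (B ** adj2 A) = u" "trace (adj2 A ** adj2 B) = u" "trace (A ** adj2 B) = u"
      "trace (A ** adj2 A) = 2" "trace (B ** adj2 B) = 2"
      using AB BA True inv trace_sym[of B "adj2 A"] trace_sym[of A "adj2 B"] trace_adj2_mult[of A B] trace_adj2_mult[of B A]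
        trace_adj2_mult[of A "adj2 B"]
      by (simp_all add: power2_eq_square trace_mat1 right_diff_distrib)
    have "trace (A ** (B ** adj2 A)) = t" "trace (B ** (adj2 A ** adj2 B)) = t" "trace (A ** adj2 A ** adj2 B) = t"
      "trace (A ** (B ** adj2 B)) = t"
      using trace_conjugate[of "adj2 A" A B] trace_conjugate[of "adj2 B" B "adj2 A"] AB
      by (simp_all only: inv adj2_left adj2_right trace_adj2 matrix_mul_lid matrix_mul_rid)
    then have tr3: "trace (A ** B ** adj2 A) = \<eta>" "trace (B ** adj2 A ** adj2 B) = \<eta>" "trace (A ** adj2 A ** adj2 B) = \<eta>"
      "trace (A ** B ** adj2 B) = \<eta>"
      by (simp_all only: eta_t matrix_mul_assoc)
    have p2: "2*u + 2 - t^2 = 2" using True by simp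
    show ?thesis
      using kq irr AB tr tr3 unfolding realizable_point_def x p2 quad_point_def
      by (intro exI[of _ A] exI[of _ B] exI[of _ "adj2 A"] exI[of _ "adj2 B"]) simp
  qed
qed

lemma realizable_rotate:
  assumes "realizable_point x"
  shows "realizable_point (rot x)"
proof -
  obtain A B C E where k: "knot_quad A B C E" and i: "\<not> common_eigenvector {A, B, C, E}" and x: "quad_point A B C E = x"
    using assms unfolding realizable_point_def by blast
  interpret knot_rep A B C E by standard (fact k i)+
  interpret r: knot_rep B C E A by (rule rotated)
  have "quad_point B C E A = rot x"
    using quad_point_rotate[of B A C E] tr x by simp
  then show ?thesis using r.quad r.irred unfolding realizable_point_def by blast
qed

lemma components_realizable:
  assumes "x \<in> all_components"
  shows "realizable_point x"
proof -
  have rot: "realizable_point y" if "S' = rot ` S" "\<And>z. z \<in> S \<Longrightarrow> realizable_point z" "y \<in> S'" for S S' y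
    using that realizable_rotate by blast
  from assms show ?thesis
    unfolding all_components_def
    using X_1_1_realizable X_2_1_realizable X_3_realizable X_4_realizable X_5_1_realizable X_6_1_realizable
      rot[OF rot_X_1[symmetric] X_1_1_realizable] rot[OF rot_X_2[symmetric] X_2_1_realizable]
      rot[OF rot_X_5[symmetric] X_5_1_realizable] rot[OF rot_X_6[symmetric] X_6_1_realizable]
    by (elim UnE) blast+
qed

section \<open>Characters of the knot group\<close>

fun word_value :: "('g \<Rightarrow> m2) \<Rightarrow> 'g word \<Rightarrow> m2" where
  "word_value f [] = mat 1"
| "word_value f ((x, e) # w) = (if e then f x else adj2 (f x)) ** word_value f w"

lemma word_value_append: "word_value f (u @ v) = word_value f u ** word_value f v"
  by (induction u) (auto simp: matrix_mul_assoc)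

lemma word_value_det:
  assumes "\<And>x. det (f x) = 1"
  shows "det (word_value f w) = 1"
  using assms by (induction w) (auto simp: det_mul det_I)

lemma word_value_pres_eq:
  assumes det: "\<And>x. det (f x) = 1" and rels: "\<And>l r. (l, r) \<in> R \<Longrightarrow> word_value f l = word_value f r"
    and "pres_eq R v w"
  shows "word_value f v = word_value f w"
  using assms(3)
proof (induction rule: pres_eq.induct)
  case (cancel u x b v)
  have "f x ** adj2 (f x) = mat 1" "adj2 (f x) ** f x = mat 1"
    using det by (simp_all add: adj2_left adj2_right)
  then have "word_value f [(x, b), (x, \<not> b)] = mat 1"
    by (cases b) simp_all
  then show ?case by (simp only: word_value_append matrix_mul_lid)
qed (simp_all add: word_value_append rels)

lemma common_eigenvector_word:
  assumes "v \<noteq> 0" "\<And>x. \<exists>c. f x *v v = c *s v"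
  shows "\<exists>c. word_value f w *v v = c *s v"
proof (induction w)
  case Nil
  have "mat 1 *v v = 1 *s v" by simp
  then show ?case unfolding word_value.simps by blast
next
  case (Cons l w)
  obtain x b where l: "l = (x, b)" by (cases l)
  obtain c where c: "word_value f w *v v = c *s v" using Cons by blast
  obtain d where d: "f x *v v = d *s v" using assms by blast
  \<comment> \<open>The adjugate is the trace minus the matrix, so an eigenvector of a generator is
    one of its inverse.\<close>
  have "mat (trace (f x)) *v v = trace (f x) *s v"
    by (simp add: vec_eq_iff forall_2 m2_vector m2_mat_nth)
  then have "adj2 (f x) *v v = (trace (f x) - d) *s v"
    unfolding adj2_def by (simp only: matrix_vector_mult_diff_rdistrib d vector_sub_rdistrib)
  then have "\<exists>e. (if b then f x else adj2 (f x)) *v v = e *s v"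
    using d by (metis (full_types))
  then obtain e where e: "(if b then f x else adj2 (f x)) *v v = e *s v" by blast
  have "word_value f (l # w) *v v = (c * e) *s v"
    unfolding l by (simp add: c e vector_scalar_commute flip: matrix_vector_mul_assoc)
  then show ?case by blast
qed

definition quad_gen :: "m2 \<Rightarrow> m2 \<Rightarrow> m2 \<Rightarrow> m2 \<Rightarrow> gen \<Rightarrow> m2" where
  "quad_gen A B C E x = (case x of x1 \<Rightarrow> A | x2 \<Rightarrow> B | x3 \<Rightarrow> C | x4 \<Rightarrow> E)"

lemma quad_gen_simps [simp]:
  "quad_gen A B C E x1 = A" "quad_gen A B C E x2 = B" "quad_gen A B C E x3 = C" "quad_gen A B C E x4 = E"
  by (simp_all add: quad_gen_def)

lemma word_value_T_rels:
  "(\<forall>(l, r)\<in>T_rels. word_value f l = word_value f r) \<longleftrightarrow>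
    crossing (f x4) (f x1) (f x2) = crossing (f x1) (f x2) (f x3) \<and>
    crossing (f x1) (f x2) (f x3) = crossing (f x2) (f x3) (f x4) \<and>
    crossing (f x2) (f x3) (f x4) = crossing (f x3) (f x4) (f x1)"
  by (simp add: T_rels_def Let_def crossing_def matrix_mul_assoc)

text \<open>A class is evaluated on an arbitrary representing word;
  \<open>word_value_pres_eq\<close> makes the choice immaterial.\<close>

definition rep_of :: "(gen \<Rightarrow> m2) \<Rightarrow> gen word set \<Rightarrow> m2" where
  "rep_of f g = word_value f (SOME w. g = pres_class T_rels w)"

definition gen_rep :: "(gen word set \<Rightarrow> m2) \<Rightarrow> gen \<Rightarrow> m2" where
  "gen_rep \<rho> x = \<rho> (pres_class T_rels [pos x])"

lemma group_knot_group_T: "group knot_group_T"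
  unfolding knot_group_T_def by (rule group_presented_group)

lemma knot_group_carrier: "carrier knot_group_T = range (pres_class T_rels)"
  by (simp add: knot_group_T_def presented_group_def)

lemma knot_group_mult: "pres_class T_rels u \<otimes>\<^bsub>knot_group_T\<^esub> pres_class T_rels v = pres_class T_rels (u @ v)"
  unfolding knot_group_T_def by (rule presented_group_mult)

lemma knot_group_one: "\<one>\<^bsub>knot_group_T\<^esub> = pres_class T_rels []"
  by (simp add: knot_group_T_def presented_group_def)

lemma hom_word_value:
  assumes h: "\<rho> \<in> hom knot_group_T SL2C"
  shows "det (gen_rep \<rho> x) = 1" "\<rho> (pres_class T_rels w) = word_value (gen_rep \<rho>) w"
proof -
  have one: "\<rho> (pres_class T_rels []) = mat 1"
    using hom_one[OF h group_knot_group_T group_SL2C] by (simp add: knot_group_one SL2C_def)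
  have mult: "\<rho> (pres_class T_rels (u @ v)) = \<rho> (pres_class T_rels u) ** \<rho> (pres_class T_rels v)" for u v
    using hom_mult[OF h, of "pres_class T_rels u" "pres_class T_rels v"]
    by (simp add: knot_group_mult knot_group_carrier SL2C_def)
  show det: "det (gen_rep \<rho> x) = 1" for x
    using hom_in_carrier[OF h, of "pres_class T_rels [pos x]"]
    by (simp add: knot_group_carrier SL2C_def gen_rep_def)
  have inv: "\<rho> (pres_class T_rels [neg x]) = adj2 (gen_rep \<rho> x)" for x
  proof -
    have "pres_class T_rels ([pos x] @ [neg x]) = pres_class T_rels []"
      unfolding pres_class_eq_iff using pres_eq.cancel[of T_rels "[]" x True "[]"] by simp
    then have "gen_rep \<rho> x ** \<rho> (pres_class T_rels [neg x]) = mat 1"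
      using mult[of "[pos x]" "[neg x]"] one by (simp add: gen_rep_def)
    then have "(adj2 (gen_rep \<rho> x) ** gen_rep \<rho> x) ** \<rho> (pres_class T_rels [neg x]) = adj2 (gen_rep \<rho> x)"
      by (metis matrix_mul_assoc matrix_mul_rid)
    then show ?thesis by (simp add: adj2_left det)
  qed
  show "\<rho> (pres_class T_rels w) = word_value (gen_rep \<rho>) w"
  proof (induction w)
    case Nil
    then show ?case by (simp add: one)
  next
    case (Cons l w)
    obtain x b where l: "l = (x, b)" by (cases l)
    have "\<rho> (pres_class T_rels [(x, b)]) = (if b then gen_rep \<rho> x else adj2 (gen_rep \<rho> x))"
      using inv[of x] by (cases b) (simp_all add: gen_rep_def)
    moreover have "\<rho> (pres_class T_rels (l # w)) = \<rho> (pres_class T_rels [l]) ** word_value (gen_rep \<rho>) w"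
      using mult[of "[l]" w] unfolding Cons by simp
    ultimately show ?case by (simp only: l word_value.simps)
  qed
qed

lemma reducible_iff:
  assumes h: "\<rho> \<in> hom knot_group_T SL2C"
  shows "reducible_rep knot_group_T \<rho> \<longleftrightarrow>
    common_eigenvector {gen_rep \<rho> x1, gen_rep \<rho> x2, gen_rep \<rho> x3, gen_rep \<rho> x4}"
proof
  assume "reducible_rep knot_group_T \<rho>"
  then obtain v where v: "v \<noteq> 0" "\<forall>g\<in>carrier knot_group_T. \<exists>c. \<rho> g *v v = c *s v"
    unfolding reducible_rep_def by (elim exE conjE)
  have "\<exists>c. gen_rep \<rho> x *v v = c *s v" for x
    unfolding gen_rep_def by (rule bspec[OF v(2)]) (simp add: knot_group_carrier)
  then show "common_eigenvector {gen_rep \<rho> x1, gen_rep \<rho> x2, gen_rep \<rho> x3, gen_rep \<rho> x4}"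
    unfolding common_eigenvector_def using v(1) by (intro exI[of _ v]) simp
next
  assume "common_eigenvector {gen_rep \<rho> x1, gen_rep \<rho> x2, gen_rep \<rho> x3, gen_rep \<rho> x4}"
  then obtain v where v: "v \<noteq> 0"
    and e: "\<forall>M\<in>{gen_rep \<rho> x1, gen_rep \<rho> x2, gen_rep \<rho> x3, gen_rep \<rho> x4}. \<exists>c. M *v v = c *s v"
    unfolding common_eigenvector_def by (elim exE conjE)
  have "\<exists>c. gen_rep \<rho> x *v v = c *s v" for x by (rule bspec[OF e]) (cases x; simp)
  then have "\<exists>c. \<rho> (pres_class T_rels w) *v v = c *s v" for w
    unfolding hom_word_value(2)[OF h] by (rule common_eigenvector_word[OF v])
  then show "reducible_rep knot_group_T \<rho>"
    unfolding reducible_rep_def knot_group_carrier using v by (intro exI[of _ v]) simp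
qed

lemma coords_character:
  assumes h: "\<rho> \<in> hom knot_group_T SL2C"
  shows "coords (character knot_group_T \<rho>) = quad_point (gen_rep \<rho> x1) (gen_rep \<rho> x2) (gen_rep \<rho> x3) (gen_rep \<rho> x4)"
proof -
  have "t_val (character knot_group_T \<rho>) xs = trace (word_value (gen_rep \<rho>) (map pos xs))" for xs
    by (simp add: t_val_def character_def knot_group_carrier hom_word_value(2)[OF h])
  then show ?thesis by (simp add: coords_def quad_point_def matrix_mul_assoc)
qed

lemma knot_rep_of_hom:
  assumes h: "\<rho> \<in> hom knot_group_T SL2C" and irr: "\<not> reducible_rep knot_group_T \<rho>"
  shows "knot_rep (gen_rep \<rho> x1) (gen_rep \<rho> x2) (gen_rep \<rho> x3) (gen_rep \<rho> x4)"
proof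
  have "word_value (gen_rep \<rho>) l = word_value (gen_rep \<rho>) r" if "(l, r) \<in> T_rels" for l r
  proof -
    have "pres_class T_rels l = pres_class T_rels r"
      unfolding pres_class_eq_iff using pres_eq.relation[OF that, of "[]" "[]"] by simp
    then show ?thesis using hom_word_value(2)[OF h] by metis
  qed
  then show "knot_quad (gen_rep \<rho> x1) (gen_rep \<rho> x2) (gen_rep \<rho> x3) (gen_rep \<rho> x4)"
    using word_value_T_rels[of "gen_rep \<rho>"] hom_word_value(1)[OF h] unfolding knot_quad_def by blast
  show "\<not> common_eigenvector {gen_rep \<rho> x1, gen_rep \<rho> x2, gen_rep \<rho> x3, gen_rep \<rho> x4}"
    using irr reducible_iff[OF h] by simp
qed

lemma hom_of_knot_quad:
  assumes q: "knot_quad A B C E"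
  obtains \<rho> where "\<rho> \<in> hom knot_group_T SL2C" "gen_rep \<rho> = quad_gen A B C E"
proof -
  let ?f = "quad_gen A B C E"
  have det: "det (?f x) = 1" for x using q by (cases x) (simp_all add: knot_quad_def)
  have rels: "word_value ?f l = word_value ?f r" if "(l, r) \<in> T_rels" for l r
    using word_value_T_rels[of ?f] q that unfolding knot_quad_def by auto
  have rep: "rep_of ?f (pres_class T_rels w) = word_value ?f w" for w
  proof -
    have "pres_class T_rels w = pres_class T_rels (SOME v. pres_class T_rels w = pres_class T_rels v)"
      by (rule someI) simp
    then show ?thesis
      unfolding rep_of_def pres_class_eq_iff using word_value_pres_eq[OF det rels] by metis
  qed
  have "rep_of ?f \<in> hom knot_group_T SL2C"
  proof (rule homI)
    fix g assume "g \<in> carrier knot_group_T"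
    then show "rep_of ?f g \<in> carrier SL2C"
      by (auto simp: knot_group_carrier SL2C_def rep word_value_det det)
  next
    fix g h assume "g \<in> carrier knot_group_T" "h \<in> carrier knot_group_T"
    then show "rep_of ?f (g \<otimes>\<^bsub>knot_group_T\<^esub> h) = rep_of ?f g \<otimes>\<^bsub>SL2C\<^esub> rep_of ?f h"
      by (auto simp: knot_group_carrier SL2C_def rep knot_group_mult word_value_append)
  qed
  moreover have "gen_rep (rep_of ?f) = ?f"
    by (rule ext) (simp add: gen_rep_def rep)
  ultimately show ?thesis by (rule that)
qed

lemma coords_image: "coords ` X_irr_T = all_components"
proof
  show "coords ` X_irr_T \<subseteq> all_components"
  proof
    fix y assume "y \<in> coords ` X_irr_T"
    then obtain \<rho> where h: "\<rho> \<in> hom knot_group_T SL2C" "\<not> reducible_rep knot_group_T \<rho>"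
      and y: "y = coords (character knot_group_T \<rho>)"
      unfolding X_irr_T_def irr_characters_def by blast
    interpret knot_rep "gen_rep \<rho> x1" "gen_rep \<rho> x2" "gen_rep \<rho> x3" "gen_rep \<rho> x4"
      by (rule knot_rep_of_hom[OF h])
    show "y \<in> all_components" unfolding y coords_character[OF h(1)] by (rule quad_point_in_components)
  qed
  show "all_components \<subseteq> coords ` X_irr_T"
  proof
    fix y assume "y \<in> all_components"
    then obtain A B C E where q: "knot_quad A B C E" and irr: "\<not> common_eigenvector {A, B, C, E}"
      and y: "quad_point A B C E = y"
      using components_realizable unfolding realizable_point_def by blast
    obtain \<rho> where h: "\<rho> \<in> hom knot_group_T SL2C" and g: "gen_rep \<rho> = quad_gen A B C E"
      using hom_of_knot_quad[OF q] by blast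
    have "\<not> reducible_rep knot_group_T \<rho>" using irr unfolding reducible_iff[OF h] g by simp
    then have "character knot_group_T \<rho> \<in> X_irr_T"
      unfolding X_irr_T_def irr_characters_def using h by blast
    moreover have "coords (character knot_group_T \<rho>) = y"
      unfolding coords_character[OF h] g using y by simp
    ultimately show "y \<in> coords ` X_irr_T" by blast
  qed
qed

section \<open>The eleven coordinates determine the character\<close>

text \<open>The relations \<open>S\<close> used below say that \<open>M\<close> and
  \<open>M'\<close> are the same linear combination of the same products of generators, evaluated in
  two representations.\<close>

definition linear_rel :: "(m2 \<Rightarrow> m2 \<Rightarrow> bool) \<Rightarrow> bool" where
  "linear_rel S \<longleftrightarrow> (\<forall>M M' N N'. S M M' \<longrightarrow> S N N' \<longrightarrow> S (M + N) (M' + N')) \<and>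
     (\<forall>c M M'. S M M' \<longrightarrow> S (mat c ** M) (mat c ** M'))"

definition stable_rel :: "(m2 \<Rightarrow> m2 \<Rightarrow> bool) \<Rightarrow> m2 \<Rightarrow> m2 \<Rightarrow> bool" where
  "stable_rel S X X' \<longleftrightarrow> (\<forall>M M'. S M M' \<longrightarrow> S (X ** M) (X' ** M'))"

text \<open>Adjoins one generator on the left. Starting from scalars and adjoining
  \<open>x4, x3, x2, x1\<close> gives combinations of the 16 products with increasing
  indices.\<close>

definition extend_rel :: "(m2 \<Rightarrow> m2 \<Rightarrow> bool) \<Rightarrow> m2 \<Rightarrow> m2 \<Rightarrow> m2 \<Rightarrow> m2 \<Rightarrow> bool" where
  "extend_rel S X X' M M' \<longleftrightarrow> (\<exists>P P' N N'. S P P' \<and> S N N' \<and> M = P + X ** N \<and> M' = P' + X' ** N')"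

lemma extend_relI: "S P P' \<Longrightarrow> S N N' \<Longrightarrow> extend_rel S X X' (P + X ** N) (P' + X' ** N')"
  unfolding extend_rel_def by blast

lemma m2_anticommute:
  "(X::m2) ** Y = mat (trace Y) ** X + mat (trace X) ** Y + mat (trace (X ** Y) - trace X * trace Y) - Y ** X"
  by (simp add: m2_simps) (algebra)

lemma linear_extend:
  assumes "linear_rel S"
  shows "linear_rel (extend_rel S X X')"
proof -
  have "extend_rel S X X' (M + N) (M' + N')" if e: "extend_rel S X X' M M'" "extend_rel S X X' N N'" for M M' N N'
  proof -
    obtain P P' Q Q' U U' V V' where "S P P'" "S Q Q'" "S U U'" "S V V'" "M = P + X ** Q" "M' = P' + X' ** Q'"
      "N = U + X ** V" "N' = U' + X' ** V'" using e unfolding extend_rel_def by blast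
    then have "S (P + U) (P' + U')" "S (Q + V) (Q' + V')" "M + N = (P + U) + X ** (Q + V)" "M' + N' = (P' + U') + X' ** (Q' + V')"
      using assms by (simp_all add: linear_rel_def matrix_add_ldistrib)
    then show ?thesis using extend_relI by simp
  qed
  moreover have "extend_rel S X X' (mat c ** M) (mat c ** M')" if e: "extend_rel S X X' M M'" for c M M'
  proof -
    obtain P P' Q Q' where "S P P'" "S Q Q'" "M = P + X ** Q" "M' = P' + X' ** Q'"
      using e unfolding extend_rel_def by blast
    then have "S (mat c ** P) (mat c ** P')" "S (mat c ** Q) (mat c ** Q')" "mat c ** M = mat c ** P + X ** (mat c ** Q)"
      "mat c ** M' = mat c ** P' + X' ** (mat c ** Q')"
      using assms by (simp_all add: linear_rel_def matrix_add_ldistrib matrix_mul_assoc mat_commute)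
    then show ?thesis using extend_relI by simp
  qed
  ultimately show ?thesis unfolding linear_rel_def by blast
qed

text \<open>By Cayley-Hamilton \<open>X ** X\<close> is \<open>trace X\<close> times
  \<open>X\<close> minus 1, the same expression in both representations.\<close>

lemma stable_extend_new:
  assumes S: "linear_rel S" and X: "det X = 1" "det X' = 1" "trace X' = trace X"
  shows "stable_rel (extend_rel S X X') X X'"
  unfolding stable_rel_def
proof (intro allI impI)
  fix M M' assume "extend_rel S X X' M M'"
  then obtain P P' Q Q' where 1: "S P P'" "S Q Q'" and M: "M = P + X ** Q" "M' = P' + X' ** Q'"
    unfolding extend_rel_def by blast
  have "Y ** (R + Y ** T) = mat (- 1) ** T + Y ** (R + mat (trace Y) ** T)" if "det Y = 1" for Y R T :: m2
  proof -
    have "Y ** (R + Y ** T) = Y ** R + (Y ** Y) ** T" by (simp add: matrix_add_ldistrib matrix_mul_assoc)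
    also have "\<dots> = mat (- 1) ** T + Y ** (R + mat (trace Y) ** T)"
      unfolding m2_square that by (simp add: m2_simps algebra_simps)
    finally show ?thesis .
  qed
  from this[of X P Q] this[of X' P' Q']
  have "X ** M = mat (- 1) ** Q + X ** (P + mat (trace X) ** Q)" "X' ** M' = mat (- 1) ** Q' + X' ** (P' + mat (trace X) ** Q')"
    unfolding M using X by simp_all
  moreover have "S (mat (- 1) ** Q) (mat (- 1) ** Q')" "S (P + mat (trace X) ** Q) (P' + mat (trace X) ** Q')"
    using S 1 unfolding linear_rel_def by blast+
  ultimately show "extend_rel S X X' (X ** M) (X' ** M')" using extend_relI by simp
qed

text \<open>A generator adjoined earlier moves past \<open>X\<close> by
  \<open>m2_anticommute\<close>, whose coefficients are traces shared by the two
  representations.\<close>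

lemma stable_extend_old:
  assumes S: "linear_rel S" and st: "stable_rel S Y Y'"
    and tr: "trace X' = trace X" "trace Y' = trace Y" "trace (Y' ** X') = trace (Y ** X)"
  shows "stable_rel (extend_rel S X X') Y Y'"
  unfolding stable_rel_def
proof (intro allI impI)
  fix M M' assume "extend_rel S X X' M M'"
  then obtain P P' Q Q' where 1: "S P P'" "S Q Q'" and M: "M = P + X ** Q" "M' = P' + X' ** Q'"
    unfolding extend_rel_def by blast
  define c where "c = trace (Y ** X) - trace Y * trace X"
  have "V ** (R + U ** T) = (V ** R + (mat (trace U) ** (V ** T) + mat c ** T)) + U ** (mat (- 1) ** (V ** T) + mat (trace V) ** T)"
    if "trace (V ** U) - trace V * trace U = c" for U V R T :: m2
  proof -
    have "V ** (R + U ** T) = V ** R + (V ** U) ** T" by (simp add: matrix_add_ldistrib matrix_mul_assoc)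
    also have "V ** U = mat (trace U) ** V + mat (trace V) ** U + mat c - U ** V"
      using m2_anticommute[of V U] that by simp
    also have "V ** R + (mat (trace U) ** V + mat (trace V) ** U + mat c - U ** V) ** T
      = (V ** R + (mat (trace U) ** (V ** T) + mat c ** T)) + U ** (mat (- 1) ** (V ** T) + mat (trace V) ** T)"
      by (simp add: m2_simps algebra_simps)
    finally show ?thesis .
  qed
  from this[of Y X P Q] this[of Y' X' P' Q']
  have "Y ** M = (Y ** P + (mat (trace X) ** (Y ** Q) + mat c ** Q)) + X ** (mat (- 1) ** (Y ** Q) + mat (trace Y) ** Q)"
    "Y' ** M' = (Y' ** P' + (mat (trace X) ** (Y' ** Q') + mat c ** Q')) + X' ** (mat (- 1) ** (Y' ** Q') + mat (trace Y) ** Q')"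
    unfolding M by (simp_all add: tr c_def)
  moreover
  note add = S[unfolded linear_rel_def, THEN conjunct1, rule_format]
    and scale = S[unfolded linear_rel_def, THEN conjunct2, rule_format]
    and stable = st[unfolded stable_rel_def, rule_format]
  have "S (Y ** P + (mat (trace X) ** (Y ** Q) + mat c ** Q)) (Y' ** P' + (mat (trace X) ** (Y' ** Q') + mat c ** Q'))"
    "S (mat (- 1) ** (Y ** Q) + mat (trace Y) ** Q) (mat (- 1) ** (Y' ** Q') + mat (trace Y) ** Q')"
    by (intro add scale stable[OF 1(1)] stable[OF 1(2)] 1)+
  ultimately show "extend_rel S X X' (Y ** M) (Y' ** M')" using extend_relI by simp
qed

definition trace_rel :: "(m2 \<Rightarrow> m2 \<Rightarrow> bool) \<Rightarrow> m2 \<Rightarrow> m2 \<Rightarrow> bool" where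
  "trace_rel S Z Z' \<longleftrightarrow> (\<forall>M M'. S M M' \<longrightarrow> trace (Z ** M) = trace (Z' ** M'))"

lemma trace_rel_extend:
  assumes "trace_rel S Z Z'" "trace_rel S (Z ** X) (Z' ** X')"
  shows "trace_rel (extend_rel S X X') Z Z'"
  unfolding trace_rel_def
proof (intro allI impI)
  fix M M' assume "extend_rel S X X' M M'"
  then obtain P P' Q Q' where "S P P'" "S Q Q'" and M: "M = P + X ** Q" "M' = P' + X' ** Q'"
    unfolding extend_rel_def by blast
  then have "trace (Z ** P) = trace (Z' ** P')" "trace (Z ** X ** Q) = trace (Z' ** X' ** Q')"
    using assms unfolding trace_rel_def by blast+
  then show "trace (Z ** M) = trace (Z' ** M')"
    unfolding M by (simp add: matrix_add_ldistrib trace_add matrix_mul_assoc)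
qed

definition scalar_rel :: "m2 \<Rightarrow> m2 \<Rightarrow> bool" where
  "scalar_rel M M' \<longleftrightarrow> (\<exists>c. M = mat c \<and> M' = mat c)"

lemma linear_scalar_rel: "linear_rel scalar_rel"
  unfolding linear_rel_def
proof (intro conjI allI impI)
  have plus: "mat c + mat d = (mat (c + d) :: m2)" and mult: "mat c ** mat d = (mat (c * d) :: m2)" for c d
    by (simp_all add: m2_simps)
  show "scalar_rel (M + N) (M' + N')" if M: "scalar_rel M M'" and N: "scalar_rel N N'" for M M' N N'
  proof -
    obtain c d where "M = mat c" "M' = mat c" "N = mat d" "N' = mat d"
      using M N unfolding scalar_rel_def by blast
    then show ?thesis unfolding scalar_rel_def by (intro exI[of _ "c + d"]) (simp add: plus)
  qed
  show "scalar_rel (mat c ** M) (mat c ** M')" if M: "scalar_rel M M'" for c M M'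
  proof -
    obtain d where "M = mat d" "M' = mat d" using M unfolding scalar_rel_def by blast
    then show ?thesis unfolding scalar_rel_def by (intro exI[of _ "c * d"]) (simp add: mult)
  qed
qed

lemma trace_scalar_rel:
  assumes "trace Z = trace Z'"
  shows "trace_rel scalar_rel Z Z'"
  unfolding trace_rel_def
proof (intro allI impI)
  fix M M' assume "scalar_rel M M'"
  then obtain c where "M = mat c" "M' = mat c" unfolding scalar_rel_def by blast
  then show "trace (Z ** M) = trace (Z' ** M')" using assms by (simp only: mat_commute trace_scale)
qed

text \<open>Stability under all generators and their inverses places every word in
  \<open>S1\<close>, so only the traces of the 16 ordered products must agree. The fourfold one does
  by \<open>trace4\<close>.\<close>

lemma word_traces_equal:
  fixes f f' :: "gen \<Rightarrow> m2"
  assumes det: "\<And>x. det (f x) = 1" "\<And>x. det (f' x) = 1" and tr: "\<And>x. trace (f' x) = trace (f x)"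
    and pt: "quad_point (f x1) (f x2) (f x3) (f x4) = quad_point (f' x1) (f' x2) (f' x3) (f' x4)"
  shows "trace (word_value f w) = trace (word_value f' w)"
proof -
  have t2: "trace (f' x1 ** f' x2) = trace (f x1 ** f x2)" "trace (f' x2 ** f' x3) = trace (f x2 ** f x3)"
    "trace (f' x3 ** f' x4) = trace (f x3 ** f x4)" "trace (f' x1 ** f' x4) = trace (f x1 ** f x4)"
    "trace (f' x1 ** f' x3) = trace (f x1 ** f x3)" "trace (f' x2 ** f' x4) = trace (f x2 ** f x4)"
    and t3: "trace (f' x1 ** f' x2 ** f' x3) = trace (f x1 ** f x2 ** f x3)"
      "trace (f' x1 ** f' x2 ** f' x4) = trace (f x1 ** f x2 ** f x4)"
      "trace (f' x1 ** f' x3 ** f' x4) = trace (f x1 ** f x3 ** f x4)"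
      "trace (f' x2 ** f' x3 ** f' x4) = trace (f x2 ** f x3 ** f x4)"
    using pt by (simp_all add: quad_point_def)
  have swap: "trace (Y ** X) = trace (Y' ** X')" if "trace (X ** Y) = trace (X' ** Y')" for X Y X' Y' :: m2
    using that trace_sym[of X Y] trace_sym[of X' Y'] by simp
  have t2': "trace (f' x2 ** f' x1) = trace (f x2 ** f x1)" "trace (f' x3 ** f' x2) = trace (f x3 ** f x2)"
    "trace (f' x4 ** f' x3) = trace (f x4 ** f x3)" "trace (f' x4 ** f' x1) = trace (f x4 ** f x1)"
    "trace (f' x3 ** f' x1) = trace (f x3 ** f x1)" "trace (f' x4 ** f' x2) = trace (f x4 ** f x2)"
    by (rule swap, rule t2)+
  have "2 * trace (f' x1 ** f' x2 ** f' x3 ** f' x4) = 2 * trace (f x1 ** f x2 ** f x3 ** f x4)"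
    unfolding trace4 by (simp only: tr t2 t3)
  then have t4: "trace (f' x1 ** f' x2 ** f' x3 ** f' x4) = trace (f x1 ** f x2 ** f x3 ** f x4)" by simp
  define S4 S3 S2 S1 where "S4 = extend_rel scalar_rel (f x4) (f' x4)" and "S3 = extend_rel S4 (f x3) (f' x3)"
    and "S2 = extend_rel S3 (f x2) (f' x2)" and "S1 = extend_rel S2 (f x1) (f' x1)"
  note S_defs = S4_def S3_def S2_def S1_def
  have lin: "linear_rel S4" "linear_rel S3" "linear_rel S2" "linear_rel S1"
    unfolding S_defs by (intro linear_extend linear_scalar_rel)+
  have st4: "stable_rel S4 (f x4) (f' x4)"
    unfolding S4_def by (rule stable_extend_new[OF linear_scalar_rel det tr])
  have st3: "stable_rel S3 (f x3) (f' x3)" "stable_rel S3 (f x4) (f' x4)"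
    unfolding S3_def by (rule stable_extend_new[OF lin(1) det tr]) (rule stable_extend_old[OF lin(1) st4 tr tr t2'(3)])
  have st2: "stable_rel S2 (f x2) (f' x2)" "stable_rel S2 (f x3) (f' x3)" "stable_rel S2 (f x4) (f' x4)"
    unfolding S2_def by (rule stable_extend_new[OF lin(2) det tr])
      (rule stable_extend_old[OF lin(2) st3(1) tr tr t2'(2)] stable_extend_old[OF lin(2) st3(2) tr tr t2'(6)])+
  have st1: "stable_rel S1 (f x1) (f' x1)" "stable_rel S1 (f x2) (f' x2)" "stable_rel S1 (f x3) (f' x3)" "stable_rel S1 (f x4) (f' x4)"
    unfolding S1_def by (rule stable_extend_new[OF lin(3) det tr])
      (rule stable_extend_old[OF lin(3) st2(1) tr tr t2'(1)] stable_extend_old[OF lin(3) st2(2) tr tr t2'(5)]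
        stable_extend_old[OF lin(3) st2(3) tr tr t2'(4)])+
  have st: "stable_rel S1 (f x) (f' x)" for x using st1 by (cases x) simp_all
  have st': "stable_rel S1 (adj2 (f x)) (adj2 (f' x))" for x
    unfolding stable_rel_def
  proof (intro allI impI)
    fix M M' assume M: "S1 M M'"
    then have "S1 (f x ** M) (f' x ** M')" using st unfolding stable_rel_def by blast
    then have "S1 (mat (trace (f x)) ** M + mat (- 1) ** (f x ** M)) (mat (trace (f x)) ** M' + mat (- 1) ** (f' x ** M'))"
      using lin(4) M unfolding linear_rel_def by blast
    moreover have "adj2 Y ** N = mat (trace Y) ** N + mat (- 1) ** (Y ** N)" for Y N :: m2
      by (simp add: m2_simps algebra_simps)
    ultimately show "S1 (adj2 (f x) ** M) (adj2 (f' x) ** M')" using tr by simp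
  qed
  have "S1 (mat 1) (mat 1)"
  proof -
    have z: "S (mat 0) (mat 0)" if "linear_rel S" "S M M'" for S M M'
    proof -
      have "mat 0 ** M = mat 0" "mat 0 ** M' = mat 0" by (simp_all add: m2_simps)
      moreover have "S (mat 0 ** M) (mat 0 ** M')" using that unfolding linear_rel_def by blast
      ultimately show ?thesis by simp
    qed
    have e: "extend_rel S X X' (mat 1) (mat 1)" if "linear_rel S" "S (mat 1) (mat 1)" for S X X'
    proof -
      have "mat 1 + X ** mat 0 = mat 1" "mat 1 + X' ** mat 0 = mat 1" by (simp_all add: m2_simps)
      then show ?thesis using extend_relI[of S "mat 1" "mat 1" "mat 0" "mat 0" X X'] that z[OF that] by simp
    qed
    have "scalar_rel (mat 1) (mat 1)" unfolding scalar_rel_def by blast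
    then show ?thesis unfolding S_defs by (intro e linear_extend linear_scalar_rel)
  qed
  then have "S1 (word_value f w) (word_value f' w)"
  proof (induction w)
    case (Cons l w)
    obtain x b where l: "l = (x, b)" by (cases l)
    show ?case using Cons st[of x] st'[of x] unfolding l stable_rel_def by (cases b) simp_all
  qed simp
  moreover have "trace_rel S1 (mat 1) (mat 1)"
    unfolding S_defs
    by (intro trace_rel_extend trace_scalar_rel) (simp_all add: tr t2 t3 t4)
  ultimately show ?thesis unfolding trace_rel_def by fastforce
qed

lemma coords_inj: "inj_on coords X_irr_T"
proof (rule inj_onI)
  fix \<phi> \<psi> assume "\<phi> \<in> X_irr_T" "\<psi> \<in> X_irr_T" and eq: "coords \<phi> = coords \<psi>"
  then obtain \<rho> \<sigma> where h: "\<rho> \<in> hom knot_group_T SL2C" "\<sigma> \<in> hom knot_group_T SL2C"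
    and irr: "\<not> reducible_rep knot_group_T \<rho>" "\<not> reducible_rep knot_group_T \<sigma>"
    and chars: "\<phi> = character knot_group_T \<rho>" "\<psi> = character knot_group_T \<sigma>"
    unfolding X_irr_T_def irr_characters_def by blast
  interpret r: knot_rep "gen_rep \<rho> x1" "gen_rep \<rho> x2" "gen_rep \<rho> x3" "gen_rep \<rho> x4"
    by (rule knot_rep_of_hom[OF h(1) irr(1)])
  interpret s: knot_rep "gen_rep \<sigma> x1" "gen_rep \<sigma> x2" "gen_rep \<sigma> x3" "gen_rep \<sigma> x4"
    by (rule knot_rep_of_hom[OF h(2) irr(2)])
  have pt: "quad_point (gen_rep \<rho> x1) (gen_rep \<rho> x2) (gen_rep \<rho> x3) (gen_rep \<rho> x4) =
      quad_point (gen_rep \<sigma> x1) (gen_rep \<sigma> x2) (gen_rep \<sigma> x3) (gen_rep \<sigma> x4)"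
    using eq unfolding chars coords_character[OF h(1)] coords_character[OF h(2)] .
  then have t: "trace (gen_rep \<sigma> x1) = trace (gen_rep \<rho> x1)" by (simp add: quad_point_def)
  have "trace (gen_rep \<sigma> x) = trace (gen_rep \<rho> x)" for x
    using r.tr s.tr t by (cases x) simp_all
  then have "trace (\<rho> (pres_class T_rels w)) = trace (\<sigma> (pres_class T_rels w))" for w
    unfolding hom_word_value(2)[OF h(1)] hom_word_value(2)[OF h(2)]
    by (rule word_traces_equal[OF hom_word_value(1)[OF h(1)] hom_word_value(1)[OF h(2)] _ pt])
  then show "\<phi> = \<psi>"
    unfolding chars character_def knot_group_carrier by (intro restrict_ext) auto
qed

section \<open>Disjointness of the components\<close>

text \<open>The coincidences among the side traces. They separate all families except
  \<open>X_5_1\<close> from \<open>X_5_2\<close>, and \<open>X_3\<close>, \<open>X_4\<close>,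
  \<open>X_6_1\<close>, \<open>X_6_2\<close> from one another.\<close>

fun shape :: "point \<Rightarrow> bool \<times> bool \<times> bool" where
  "shape (t, (t12, t23, t34, t14), _) = (t12 = t34, t23 = t14, t12 = t23)"

lemma disjntI: "(\<And>x. x \<in> S \<Longrightarrow> x \<in> S' \<Longrightarrow> False) \<Longrightarrow> disjnt S S'"
  by (auto simp: disjnt_iff)

lemma shape_X_1_1:
  assumes "x \<in> X_1_1"
  shows "shape x = (False, False, False)"
proof -
  obtain t \<alpha> \<mu> r where c: "cond_1 \<alpha> \<mu> r" and x: "x = (t, (r + 1, \<mu> + 1 - r, \<mu> + 1 - r, r + 1), (1, \<tau> \<alpha> \<mu>),
             (t*\<mu>/\<alpha>, t * \<sigma>_plus \<alpha> \<mu> r, t*\<mu>/\<alpha>, t * \<sigma>_minus \<alpha> \<mu> r))"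
    using assms unfolding X_1_1_def by blast
  have ne: "r + 1 \<noteq> \<mu> + 1 - r" using c unfolding cond_1_iff by algebra
  show ?thesis using ne ne[symmetric] unfolding x by simp
qed

lemma shape_X_1_2:
  assumes "x \<in> X_1_2"
  shows "shape x = (False, False, True)"
proof -
  obtain t \<alpha> \<mu> r where c: "cond_1 \<alpha> \<mu> r" and x: "x = (t, (r + 1, r + 1, \<mu> + 1 - r, \<mu> + 1 - r), (\<tau> \<alpha> \<mu>, 1),
             (t * \<sigma>_plus \<alpha> \<mu> r, t*\<mu>/\<alpha>, t * \<sigma>_minus \<alpha> \<mu> r, t*\<mu>/\<alpha>))"
    using assms unfolding X_1_2_def by blast
  have ne: "r + 1 \<noteq> \<mu> + 1 - r" using c unfolding cond_1_iff by algebra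
  show ?thesis using ne ne[symmetric] unfolding x by simp
qed

lemma cond_2_ne: "cond_2 \<alpha> z \<gamma> \<Longrightarrow> \<gamma> \<noteq> z^2 / \<gamma>"
  using cond_2_nonzero[of \<alpha> z \<gamma>] unfolding cond_2_iff by (simp add: eq_divide_eq power2_eq_square)

lemma shape_X_2_1:
  assumes "x \<in> X_2_1"
  shows "\<exists>e. shape x = (False, True, e)"
proof -
  obtain t \<alpha> z \<gamma> where c: "cond_2 \<alpha> z \<gamma>" and x: "x = (t, (\<gamma> + \<alpha> - 1, z + 1, z^2/\<gamma> + \<alpha> - 1, z + 1), (1, 1),
             (t + t*z*\<gamma>/\<alpha>, t + t*z*\<gamma>/\<alpha>, t + t*z^3/(\<alpha>*\<gamma>), t + t*z^3/(\<alpha>*\<gamma>)))"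
    using assms unfolding X_2_1_def by blast
  show ?thesis using cond_2_ne[OF c] unfolding x by simp
qed

lemma shape_X_2_2:
  assumes "x \<in> X_2_2"
  shows "\<exists>e. shape x = (True, False, e)"
proof -
  obtain t \<alpha> z \<gamma> where c: "cond_2 \<alpha> z \<gamma>" and x: "x = (t, (z + 1, \<gamma> + \<alpha> - 1, z + 1, z^2/\<gamma> + \<alpha> - 1), (1, 1),
             (t + t*z*\<gamma>/\<alpha>, t + t*z^3/(\<alpha>*\<gamma>), t + t*z^3/(\<alpha>*\<gamma>), t + t*z*\<gamma>/\<alpha>))"
    using assms unfolding X_2_2_def by blast
  show ?thesis using cond_2_ne[OF c] unfolding x by simp
qed

lemma t_square_minus_2: "(t::complex)^2 - 2 = 1 \<longleftrightarrow> t^2 = 3" "1 = (t::complex)^2 - 2 \<longleftrightarrow> t^2 = 3"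
proof -
  show "t^2 - 2 = 1 \<longleftrightarrow> t^2 = 3" by (simp add: diff_eq_eq)
  then show "1 = t^2 - 2 \<longleftrightarrow> t^2 = 3" by (simp only: eq_commute)
qed

lemma shape_X_5:
  assumes "x \<in> X_5_1 \<or> x \<in> X_5_2"
  shows "shape x = (True, True, False)"
proof -
  obtain t where "t^2 \<noteq> 3" "x = (t, (1, t^2 - 2, 1, t^2 - 2), (1, 1), (0, 0, 0, 0)) \<or> x = (t, (t^2 - 2, 1, t^2 - 2, 1), (1, 1), (0, 0, 0, 0))"
    using assms unfolding X_5_1_def X_5_2_def by blast
  then show ?thesis using t_square_minus_2[of t] by (elim disjE) simp_all
qed

lemma shape_X_3_4_6:
  assumes "x \<in> X_3 \<or> x \<in> X_4 \<or> x \<in> X_6_1 \<or> x \<in> X_6_2"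
  shows "shape x = (True, True, True)"
proof -
  obtain t u r where "x = (t, (u, u, u, u), r)"
    using assms unfolding X_3_def X_4_def X_6_1_def X_6_2_def by blast
  then show ?thesis by simp
qed

lemma X_5_disjoint: "disjnt X_5_1 X_5_2"
proof (rule disjntI)
  fix x assume "x \<in> X_5_1" "x \<in> X_5_2"
  then obtain t s where "t^2 \<noteq> 3" "x = (t, (1, t^2 - 2, 1, t^2 - 2), (1, 1), (0, 0, 0, 0))"
    "x = (s, (s^2 - 2, 1, s^2 - 2, 1), (1, 1), (0, 0, 0, 0))" unfolding X_5_1_def X_5_2_def by blast
  then show False using t_square_minus_2[of t] by simp
qed

text \<open>A common point would have \<open>u = t^2 - 2\<close>, which the quadratic of
  \<open>X_3\<close> allows only for \<open>t^2 = 5\<close>.\<close>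

lemma X_3_4_disjoint: "disjnt X_3 X_4"
proof (rule disjntI)
  fix x assume "x \<in> X_3" "x \<in> X_4"
  then obtain t u s y \<eta> where h: "u^2 - (t^2 + 1)*u + 2*t^2 - 1 = 0" "t^2 \<noteq> 5"
    "x = (t, (u, u, u, u), (t^2 - 2, t^2 - 2), (t*u - t, t*u - t, t*u - t, t*u - t))"
    and x: "x = (s, (y, y, y, y), (2 * y + 2 - s^2, 2 * y + 2 - s^2), (\<eta>, \<eta>, \<eta>, \<eta>))"
    unfolding X_3_def X_4_def by blast
  have "s = t" "y = u" "2 * y + 2 - s^2 = t^2 - 2" using h(3)[unfolded x, unfolded prod.inject] by blast+
  then have "2 * u + 2 - t^2 = t^2 - 2" by simp
  then have "u = t^2 - 2" by algebra
  then have "t^2 - 5 = 0" using h(1) by algebra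
  with h(2) show False by simp
qed

lemma X_3_6_disjoint: "disjnt X_3 (X_6_1 \<union> X_6_2)"
proof (rule disjntI)
  fix x assume "x \<in> X_3" "x \<in> X_6_1 \<union> X_6_2"
  then obtain t u s p q r where h: "u^2 - (t^2 + 1)*u + 2*t^2 - 1 = 0"
    "x = (t, (u, u, u, u), (t^2 - 2, t^2 - 2), (t*u - t, t*u - t, t*u - t, t*u - t))"
    and x: "x = (s, (1, 1, 1, 1), (p, q), r)" and pq: "p = 1 \<or> q = 1"
    unfolding X_3_def X_6_1_def X_6_2_def by blast
  have "u = 1" "t^2 - 2 = 1" using h(2) pq unfolding x by auto
  then have "t^2 = 1" "t^2 = 3" using h(1) t_square_minus_2 by simp_all
  then show False by simp
qed

lemma X_4_6_disjoint: "disjnt X_4 (X_6_1 \<union> X_6_2)"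
proof (rule disjntI)
  fix x assume "x \<in> X_4" "x \<in> X_6_1 \<union> X_6_2"
  then obtain t u s r r' where "u \<noteq> 1" "x = (t, (u, u, u, u), r)" "x = (s, (1, 1, 1, 1), r')"
    unfolding X_4_def X_6_1_def X_6_2_def by blast
  then show False by simp
qed

lemma X_6_disjoint: "disjnt X_6_1 X_6_2"
proof (rule disjntI)
  fix x assume "x \<in> X_6_1" "x \<in> X_6_2"
  then obtain t s where t: "t^2 \<noteq> 3" and x: "x = (t, (1, 1, 1, 1), (1, 4*t^2 - 2 - t^4), (0, 3*t - t^3, 0, 3*t - t^3))"
    "x = (s, (1, 1, 1, 1), (4 * s^2 - 2 - s^4, 1), (3 * s - s^3, 0, 3 * s - s^3, 0))"
    unfolding X_6_1_def X_6_2_def by blast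
  have 1: "4*t^2 - 2 - t^4 = 1" "3*t - t^3 = 0" using x(1) unfolding x(2) by auto
  have "t * (t^2 - 3) = 0" using 1(2) by algebra
  then have "t = 0" using t by simp
  with 1(1) show False by simp
qed

lemma disjoint_of_shape:
  "(\<And>x. x \<in> S \<Longrightarrow> P (shape x)) \<Longrightarrow> (\<And>x. x \<in> S' \<Longrightarrow> \<not> P (shape x)) \<Longrightarrow> disjnt S S'"
  by (rule disjntI) blast

text \<open>In this order a single predicate on \<open>shape\<close> separates each group from the
  union of all later ones.\<close>

lemma components_disjoint:
  "sorted_wrt disjnt [X_1_1, X_1_2, X_2_1, X_2_2, X_3, X_4, X_5_1, X_5_2, X_6_1, X_6_2]"
proof -
  let ?D = "X_3 \<union> X_4 \<union> X_6_1 \<union> X_6_2" and ?C = "X_5_1 \<union> X_5_2"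
  have D: "shape x = (True, True, True)" if "x \<in> ?D" for x
    using that shape_X_3_4_6 by blast
  have C: "shape x = (True, True, False)" if "x \<in> ?C" for x
    using that shape_X_5 by blast
  have B: "\<exists>e. shape x = (True, False, e)" if "x \<in> X_2_2" for x
    using that by (rule shape_X_2_2)
  have A: "\<exists>e. shape x = (False, True, e)" if "x \<in> X_2_1" for x
    using that by (rule shape_X_2_1)
  have 5: "disjnt ?C ?D"
    by (rule disjoint_of_shape[where P = "\<lambda>e. \<not> snd (snd e)"]) (simp_all only: C D, simp_all)
  have 4: "disjnt X_2_2 (?C \<union> ?D)"
    by (rule disjoint_of_shape[where P = "\<lambda>e. \<not> fst (snd e)"])
      (drule B, force, erule UnE, drule C, force, drule D, force)
  have 3: "disjnt X_2_1 (X_2_2 \<union> (?C \<union> ?D))"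
    by (rule disjoint_of_shape[where P = "\<lambda>e. \<not> fst e"])
      (drule A, force, erule UnE, drule B, force, erule UnE, drule C, force, drule D, force)
  have 2: "disjnt X_1_2 (X_2_1 \<union> (X_2_2 \<union> (?C \<union> ?D)))"
    by (rule disjoint_of_shape[where P = "\<lambda>e. e = (False, False, True)"])
      (drule shape_X_1_2, force, erule UnE, drule A, force, erule UnE, drule B, force, erule UnE, drule C, force, drule D, force)
  have 1: "disjnt X_1_1 (X_1_2 \<union> (X_2_1 \<union> (X_2_2 \<union> (?C \<union> ?D))))"
    by (rule disjoint_of_shape[where P = "\<lambda>e. e = (False, False, False)"])
      (drule shape_X_1_1, force, erule UnE, drule shape_X_1_2, force, erule UnE, drule A, force, erule UnE, drule B, force,
        erule UnE, drule C, force, drule D, force)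
  show ?thesis
    using 1 2 3 4 5 X_5_disjoint X_3_4_disjoint X_3_6_disjoint X_4_6_disjoint X_6_disjoint
    by (simp add: disjnt_Un1 disjnt_Un2 disjnt_sym)
qed

theorem theorem5p1:
  shows "inj_on coords X_irr_T \<and>
    coords ` X_irr_T =
      X_1_1 \<union> X_1_2 \<union> X_2_1 \<union> X_2_2 \<union> X_3 \<union> X_4 \<union> X_5_1 \<union> X_5_2 \<union> X_6_1 \<union> X_6_2 \<and>
    sorted_wrt disjnt [X_1_1, X_1_2, X_2_1, X_2_2, X_3, X_4, X_5_1, X_5_2, X_6_1, X_6_2]"
  using coords_inj coords_image components_disjoint unfolding all_components_def by blast

end
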